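(* After categorified change of basis, the nonsingular crossing bimodules $P'$ and $N'$ over $(\mathcal A_{1,1},\mathcal A_{1,1})$ are homotopy equivalent to Ozsváth–Szabó's bimodules $P_{\rm OSz}$ and $N_{\rm OSz}$ over $(\mathcal A_{1,1}^{\rm can},\mathcal A_{1,1}^{\rm can})$. That is, with the change-of-basis bimodules $\mathcal K$ and $\mathcal L$ of the context, there are (bidegree-preserving) homotopy equivalences of DA bimodules $$\mathcal K\boxtimes P'\boxtimes\mathcal L\simeq P_{\rm OSz},\qquad\mathcal K\boxtimes N'\boxtimes\mathcal L\simeq N_{\rm OSz},$$ or equivalently $\mathcal L\boxtimes P_{\rm OSz}\boxtimes\mathcal K\simeq P'$ and $\mathcal L\boxtimes N_{\rm OSz}\boxtimes\mathcal K\simeq N'$.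
   Context: **Conventions.** Ground field $\mathbb F_2$. Everything is bigraded by $(\deg^q,\deg^h)\in\mathbb Z^2$; products and actions have bidegree $(0,0)$, differentials $(0,1)$. $q^iW[j]$: $\deg^q$ shifted up by $i$, $\deg^h$ shifted down by $j$. Bidegrees are written $(\deg^q,\deg^h)$. For a dg category $A$ put $A(T,S)=\mathrm{Hom}_A(S,T)$, products being compositions; $I\subset A$ is the subcategory of identity morphisms; $A$ is augmented over $I$ (non-identity basis elements map to $0$) with kernel $A_+$. **DA bimodules.** A DA bimodule over $(A',A)$ is an $(I',I)$-bimodule $M$ (a family $M(S',S)$) with bidegree-zero bilinear maps $\delta^1_i:M\otimes_I(A[1])^{\otimes(i-1)}\to A'[1]\otimes_{I'}M$, $i\ge1$, such that for all $i$ $$\sum_{j=1}^i(\mu'\otimes\mathrm{id})(\mathrm{id}\otimes\delta^1_{i-j+1})(\delta^1_j\otimes\mathrm{id})+\sum_{j=1}^{i-1}\delta^1_i(\mathrm{id}\otimes\partial_j)+\sum_{j=1}^{i-2}\delta^1_{i-1}(\mathrm{id}\otimes\mu_{j,j+1})+(\partial'\otimes\mathrm{id})\delta^1_i=0,$$ strictly unital ($\delta^1_2(m,\mathrm{id})=\mathrm{id}\otimes m$, and $\delta^1_i=0$ if $i>2$ and an input is an identity). Write $\delta(m;a_1,\dots,a_n)=a'm'$ for $\delta^1_{n+1}(m\otimes a_1\otimes\cdots\otimes a_n)=a'\otimes m'$ ($\delta(m)$ when $n=0$); unlisted operations on non-identity basis inputs are zero; $k,l\ge0$ arbitrary. A morphism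 $f:M\to N$ is a collection $f_i:M\otimes(A_+[1])^{\otimes(i-1)}\to A'\otimes N$, with differential $$d(f)_i=\sum_j(\mu'\otimes\mathrm{id})(\mathrm{id}\otimes\delta^1_{i-j+1})f_j+\sum_j(\mu'\otimes\mathrm{id})(\mathrm{id}\otimes f_{i-j+1})\delta^1_j+\sum_jf_i(\mathrm{id}\otimes\partial_j)+\sum_jf_{i-1}(\mathrm{id}\otimes\mu_{j,j+1})+(\partial'\otimes\mathrm{id})f_i;$$ composition $gf=\sum(\mu'\otimes\mathrm{id})(\mathrm{id}\otimes g)(f\otimes\mathrm{id})$; $\simeq$ is homotopy equivalence in this dg category. Write $f(m;a_1,\dots)$ similarly, unlisted values zero. The mapping cone of a closed morphism $f:M\to N$ of bidegree $(0,1)$ is $M\oplus N$ with $f$ added to the structure operations. Box product: $M\boxtimes N$ is $M\otimes_{I'}N$ with operations $\sum_j(\delta^{1,M}_{j+1}\otimes\mathrm{id})(\mathrm{id}\otimes\delta^{j,N})$, $\delta^{j,N}$ the $j$-fold iterate of $\delta^{1,N}$. The identity DA bimodule $\mathbb I_A$ has basis $\mathbf I_S\in\mathbb I_A(S,S)$, $\delta(\mathbf I_T;a)=a\,\mathbf I_S$ for $a\in A(T,S)$. **Algebras.** $\mathcal A_{1,1}$: objects $\mathrm{uu},\mathrm{ou},\mathrm{uo},\mathrm{oo}$ with endomorphism algebras $\mathbb F_2,\mathbb F_2[U_1],\mathbb F_2[U_2],\mathbb F_2[U_1,U_2]$; $\mathcal A_{1,1}(\mathrm{uo},\mathrm{ou})=\mathbb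 F_2\lambda$, $\lambda U_1=0=U_2\lambda$; no other morphisms; $U_i$ of bidegree $(-2,2)$, $\lambda$ of bidegree $(1,0)$; zero differential. $\mathcal A_{1,1}^{\rm can}$: objects $\varnothing,A,B,AB$; $\mathrm{End}(\varnothing)=\mathbb F_2$, $\mathrm{End}(AB)=\mathbb F_2[U_1,U_2]$; on the objects $A,B$ it is generated by $R_1\in\mathcal A^{\rm can}_{1,1}(A,B)$, $L_1\in\mathcal A^{\rm can}_{1,1}(B,A)$ and $U_2\in\mathcal A^{\rm can}_{1,1}(B,B)$ with relations $R_1U_2=0$, $U_2L_1=0$; one writes $U_1=R_1L_1$ at $A$ and $U_1=L_1R_1$ at $B$. No other morphisms; zero differential; $R_1,L_1$ of bidegree $(-1,1)$, $U_i$ of bidegree $(-2,2)$. **Our crossings.** $X$ (DA over $(\mathcal A_{1,1},\mathcal A_{1,1})$): basis $xa\in X(\mathrm{ou},\mathrm{ou})$ $(-1,2)$, $ya\in X(\mathrm{uo},\mathrm{ou})$ $(0,1)$, $xb\in X(\mathrm{ou},\mathrm{uo})$ $(0,1)$, $yb\in X(\mathrm{uo},\mathrm{uo})$ $(1,0)$, $zc,zd\in X(\mathrm{oo},\mathrm{oo})$ $(-1,2)$, $(1,0)$; $\delta(ya)=\lambda\,xa$, $\delta(yb)=\lambda\,xb$; $\delta(xa;U_1^{k+1})=U_1^{k+1}xa$; $\delta(ya;U_1^{k+1})=U_2^{k+1}ya$; $\delta(xb;U_2^{k+1})=U_1^{k+1}xb$; $\delta(yb;U_2^{k+1})=U_2^{k+1}yb$;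 $\delta(xb;\lambda,U_1^{k+1})=\delta(xb;U_2^{k+1},\lambda)=U_1^k\,xa$; $\delta(yb;\lambda,U_1^{k+1})=\delta(yb;U_2^{k+1},\lambda)=U_2^k\,ya$; on $zc,zd$ it is an ordinary bimodule with $zc\cdot U_1=(U_1+U_2)zc+U_1U_2\,zd$, $zd\cdot U_1=zc$, $zc\cdot U_2=U_1U_2\,zd$, $zd\cdot U_2=zc+(U_1+U_2)zd$. $\eta:\mathbb I\to X$, bidegree $(-1,2)$: $\mathbf I_{\mathrm{uu}}\mapsto0$, $\mathbf I_{\mathrm{ou}}\mapsto xa$, $\mathbf I_{\mathrm{uo}}\mapsto U_2\,yb$, $(\mathbf I_{\mathrm{uo}};\lambda)\mapsto ya$, $\mathbf I_{\mathrm{oo}}\mapsto zc+U_2\,zd$. $\varepsilon':X\to\mathbb I$, bidegree $(-1,0)$: $xa\mapsto U_1\mathbf I_{\mathrm{ou}}$, $(xb;\lambda)\mapsto\mathbf I_{\mathrm{ou}}$, $yb\mapsto\mathbf I_{\mathrm{uo}}$, $zc\mapsto U_1\mathbf I_{\mathrm{oo}}$, $zd\mapsto\mathbf I_{\mathrm{oo}}$. $P'$ is the mapping cone of $\eta:q^{-1}\mathbb I_{\mathcal A_{1,1}}\to X[1]$; $N'$ is the mapping cone of $\varepsilon':X[1]\to q\,\mathbb I_{\mathcal A_{1,1}}$. **Change of basis.** $\mathcal K$ (over $(\mathcal A^{\rm can}_{1,1},\mathcal A_{1,1})$): basis $\kappa_1\in\mathcal K(\varnothing,\mathrm{uu})$,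 $\kappa_2\in\mathcal K(A,\mathrm{ou})$, $\kappa_3\in\mathcal K(A,\mathrm{uo})$, $\kappa_4\in\mathcal K(B,\mathrm{uo})$, $\kappa_5\in\mathcal K(AB,\mathrm{oo})$; $\kappa_3$ of bidegree $(-1,0)$, others $(0,0)$; $\delta(\kappa_2;U_1^{k+1})=U_1^{k+1}\kappa_2$; $\delta(\kappa_3)=R_1\kappa_4$; $\delta(\kappa_3;\lambda)=\kappa_2$; $\delta(\kappa_4;U_2^{k+1})=U_2^{k+1}\kappa_4$; $\delta(\kappa_4;\lambda,U_1^{k+1})=L_1U_1^k\kappa_2$; $\delta(\kappa_5;U_1^kU_2^l)=U_1^kU_2^l\kappa_5$. $\mathcal L$ (over $(\mathcal A_{1,1},\mathcal A^{\rm can}_{1,1})$): basis $\lambda_1\in\mathcal L(\mathrm{uu},\varnothing)$, $\lambda_2\in\mathcal L(\mathrm{ou},A)$, $\lambda_3\in\mathcal L(\mathrm{ou},B)$, $\lambda_4\in\mathcal L(\mathrm{uo},B)$, $\lambda_5\in\mathcal L(\mathrm{oo},AB)$; $\lambda_3$ of bidegree $(-1,1)$, others $(0,0)$; $\delta(\lambda_2;U_1^{k+1})=U_1^{k+1}\lambda_2$; $\delta(\lambda_2;R_1U_1^k)=U_1^k\lambda_3$; $\delta(\lambda_3;L_1U_1^k)=U_1^{k+1}\lambda_2$; $\delta(\lambda_3;U_1^{k+1})=U_1^{k+1}\lambda_3$; $\delta(\lambda_4)=\lambda\,\lambda_3$; $\delta(\lambda_4;U_2^{k+1})=U_2^{k+1}\lambda_4$;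 $\delta(\lambda_5;U_1^kU_2^l)=U_1^kU_2^l\lambda_5$. **Ozsváth–Szabó bimodules** (over $(\mathcal A^{\rm can}_{1,1},\mathcal A^{\rm can}_{1,1})$). $P_{\rm OSz}$: basis $S_\varnothing\in P(\varnothing,\varnothing)$ and $S_A\in P(A,A)$ of bidegree $(-1,0)$, $W\in P(B,A)$ of bidegree $(0,0)$, $N_B\in P(B,B)$ and $N_{AB}\in P(AB,AB)$ of bidegree $(1,-1)$; $\delta(S_A)=R_1W$; $\delta(W;U_1^{k+1})=U_2^{k+1}W$; $\delta(W;R_1U_1^k)=U_2^{k+1}N_B$; $\delta(N_B;U_2^{k+1},L_1)=L_1U_1^kS_A$; $\delta(N_B;L_1U_1^k)=U_2^kW$; $\delta(N_B;U_1^{k+1})=U_2^{k+1}N_B$; $\delta(N_B;U_2^{k+1})=U_1^{k+1}N_B$; $\delta(N_{AB};U_1^kU_2^l)=U_1^lU_2^kN_{AB}$. $N_{\rm OSz}$: basis $S'_\varnothing\in N(\varnothing,\varnothing)$ and $S'_A\in N(A,A)$ of bidegree $(1,0)$, $W'\in N(B,A)$ of bidegree $(0,0)$, $N'_B\in N(B,B)$ and $N'_{AB}\in N(AB,AB)$ of bidegree $(-1,1)$; $\delta(W')=L_1S'_A$; $\delta(W';U_1^{k+1})=U_2^{k+1}W'$; $\delta(W';R_1U_1^k)=U_2^kN'_B$; $\delta(S'_A;R_1,U_2^{k+1})=R_1U_1^kN'_B$; $\delta(N'_B;L_1U_1^k)=U_2^{k+1}W'$; $\delta(N'_B;U_1^{k+1})=U_2^{k+1}N'_B$;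 $\delta(N'_B;U_2^{k+1})=U_1^{k+1}N'_B$; $\delta(N'_{AB};U_1^kU_2^l)=U_1^lU_2^kN'_{AB}$. (Compared with Ozsváth–Szabó's papers, positive and negative crossings are exchanged.) *)

theory Defs
  imports "HOL-Library.Poly_Mapping" "HOL-Library.Z2"
begin

section \<open>Vector spaces over the field with two elements\<close>

text \<open>
  \<open>'x vect\<close> is the \<open>\<F>\<^sub>2\<close>-vector space with basis \<open>'x\<close>. A bigraded vector space is given by a
  homogeneous basis, and a multilinear map by its values on basis elements.
\<close>

type_synonym 'x vect = "'x \<Rightarrow>\<^sub>0 bit"

definition gen :: "'x \<Rightarrow> 'x vect"
  where "gen x = Poly_Mapping.single x 1"

abbreviation tens :: "'b \<Rightarrow> 'm \<Rightarrow> ('b \<times> 'm) vect"  (infix \<open>\<otimes>\<close> 75)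
  where "b \<otimes> m \<equiv> gen (b, m)"

text \<open>The linear extension of a map given on the basis; nonzero coefficients are all equal to 1.\<close>

definition linext :: "('x \<Rightarrow> 'y vect) \<Rightarrow> 'x vect \<Rightarrow> 'y vect"
  where "linext T v = (\<Sum>x\<in>Poly_Mapping.keys v. T x)"


section \<open>Bigraded dg categories with a chosen basis\<close>

text \<open>
  The type \<open>'o\<close> is the set of objects and \<open>'a\<close> is the disjoint union of homogeneous bases of all
  the morphism spaces, containing the identity morphisms. A basis element \<open>a\<close> of
  \<open>A(T,S) = Hom\<^sub>A(S,T)\<close> has \<open>lob a = T\<close> and \<open>rob a = S\<close>, so that the product of \<open>a\<close> and \<open>b\<close> (the
  composition \<open>a \<circ> b\<close>) is defined if \<open>rob a = lob b\<close>.
\<close>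

record ('o, 'a) dgcat =
  lob :: "'a \<Rightarrow> 'o"
  rob :: "'a \<Rightarrow> 'o"
  idn :: "'o \<Rightarrow> 'a"
  mult :: "'a \<Rightarrow> 'a \<Rightarrow> 'a vect"
  bd :: "'a \<Rightarrow> 'a vect"
  qdeg :: "'a \<Rightarrow> int"
  hdeg :: "'a \<Rightarrow> int"

definition identities :: "('o, 'a) dgcat \<Rightarrow> 'a set"
  where "identities A = range (idn A)"

text \<open>
  The last two clauses say that sending the non-identity basis elements to 0 defines an
  augmentation over the subcategory \<open>I\<close> of identity morphisms. Signs are irrelevant.
\<close>

definition dg_category :: "('o, 'a) dgcat \<Rightarrow> bool" where
  "dg_category A \<longleftrightarrow>
     (\<forall>S. lob A (idn A S) = S \<and> rob A (idn A S) = S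
        \<and> qdeg A (idn A S) = 0 \<and> hdeg A (idn A S) = 0) \<and>
     (\<forall>a b. \<forall>c \<in> Poly_Mapping.keys (mult A a b).
        rob A a = lob A b \<and> lob A c = lob A a \<and> rob A c = rob A b
        \<and> qdeg A c = qdeg A a + qdeg A b \<and> hdeg A c = hdeg A a + hdeg A b) \<and>
     (\<forall>a. mult A (idn A (lob A a)) a = gen a \<and> mult A a (idn A (rob A a)) = gen a) \<and>
     (\<forall>a b c. linext (\<lambda>x. mult A x c) (mult A a b) = linext (mult A a) (mult A b c)) \<and>
     (\<forall>a. \<forall>c \<in> Poly_Mapping.keys (bd A a). lob A c = lob A a \<and> rob A c = rob A a
        \<and> qdeg A c = qdeg A a \<and> hdeg A c = hdeg A a + 1) \<and>
     (\<forall>a. linext (bd A) (bd A a) = 0) \<and>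
     (\<forall>a b. linext (bd A) (mult A a b)
        = linext (\<lambda>x. mult A x b) (bd A a) + linext (mult A a) (bd A b)) \<and>
     (\<forall>a b. a \<notin> identities A \<or> b \<notin> identities A \<longrightarrow>
        Poly_Mapping.keys (mult A a b) \<inter> identities A = {}) \<and>
     (\<forall>a. Poly_Mapping.keys (bd A a) \<inter> identities A = {})"


section \<open>DA bimodules\<close>

text \<open>
  An \<open>(I',I)\<close>-bimodule \<open>M\<close> with a homogeneous basis \<open>gens M\<close>, the basis element \<open>m\<close> lying in
  \<open>M(lft m, rgt m)\<close>, together with operations
  \<open>ops M m [a\<^sub>1, \<dots>, a\<^sub>n] = \<delta>\<^sup>1\<^bsub>n+1\<^esub>(m \<otimes> a\<^sub>1 \<otimes> \<dots> \<otimes> a\<^sub>n)\<close>. Here \<open>'l\<close>, \<open>'b\<close> are the objects and the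
  basis of \<open>A'\<close>, and \<open>'r\<close>, \<open>'a\<close> those of \<open>A\<close>.
\<close>

record ('l, 'r, 'b, 'a, 'm) da =
  gens :: "'m set"
  lft :: "'m \<Rightarrow> 'l"
  rgt :: "'m \<Rightarrow> 'r"
  qgr :: "'m \<Rightarrow> int"
  hgr :: "'m \<Rightarrow> int"
  ops :: "'m \<Rightarrow> 'a list \<Rightarrow> ('b \<times> 'm) vect"

fun composable :: "('o, 'a) dgcat \<Rightarrow> 'o \<Rightarrow> 'a list \<Rightarrow> bool" where
  "composable A S [] \<longleftrightarrow> True"
| "composable A S (a # as) \<longleftrightarrow> lob A a = S \<and> composable A (rob A a) as"

fun end_ob :: "('o, 'a) dgcat \<Rightarrow> 'o \<Rightarrow> 'a list \<Rightarrow> 'o" where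
  "end_ob A S [] = S"
| "end_ob A S (a # as) = end_ob A (rob A a) as"

text \<open>Bases of \<open>M \<otimes>\<^sub>I A \<otimes>\<^sub>I \<dots> \<otimes>\<^sub>I A\<close> and of \<open>M \<otimes>\<^sub>I A\<^sub>+ \<otimes>\<^sub>I \<dots> \<otimes>\<^sub>I A\<^sub>+\<close>, for all numbers of factors.\<close>

definition inputs :: "('r, 'a) dgcat \<Rightarrow> ('l, 'r, 'b, 'a, 'm) da \<Rightarrow> ('m \<times> 'a list) set"
  where "inputs A M = {(m, as). m \<in> gens M \<and> composable A (rgt M m) as}"

definition aug_inputs :: "('r, 'a) dgcat \<Rightarrow> ('l, 'r, 'b, 'a, 'm) da \<Rightarrow> ('m \<times> 'a list) set"
  where "aug_inputs A M = {(m, as) \<in> inputs A M. set as \<inter> identities A = {}}"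

text \<open>
  \<open>f\<close> restricted to \<open>D\<close> consists of \<open>(I',I)\<close>-bimodule maps
  \<open>M \<otimes> (A[1])\<^bsup>\<otimes>n\<^esup> \<rightarrow> A' \<otimes> N\<close> of bidegree \<open>(i,j)\<close>.
\<close>

definition maps_of_bidegree ::
  "('l, 'b) dgcat \<Rightarrow> ('r, 'a) dgcat \<Rightarrow> ('l, 'r, 'b, 'a, 'm) da \<Rightarrow> ('l, 'r, 'b, 'a, 'n) da \<Rightarrow>
   ('m \<times> 'a list) set \<Rightarrow> int \<Rightarrow> int \<Rightarrow> ('m \<Rightarrow> 'a list \<Rightarrow> ('b \<times> 'n) vect) \<Rightarrow> bool" where
  "maps_of_bidegree A' A M N D i j f \<longleftrightarrow>
     (\<forall>(m, as) \<in> D. \<forall>(b, n) \<in> Poly_Mapping.keys (f m as).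
        n \<in> gens N \<and> lob A' b = lft M m \<and> rob A' b = lft N n \<and> rgt N n = end_ob A (rgt M m) as \<and>
        qdeg A' b + qgr N n = qgr M m + (\<Sum>a\<leftarrow>as. qdeg A a) + i \<and>
        hdeg A' b + hgr N n = hgr M m + (\<Sum>a\<leftarrow>as. hdeg A a - 1) + j)"

text \<open>\<open>\<Sum> (\<mu>' \<otimes> id)(id \<otimes> g)(f \<otimes> id)\<close>, summed over all ways of distributing the inputs.\<close>

definition mor_comp :: "('l, 'b) dgcat \<Rightarrow> ('n \<Rightarrow> 'a list \<Rightarrow> ('b \<times> 'p) vect) \<Rightarrow>
    ('m \<Rightarrow> 'a list \<Rightarrow> ('b \<times> 'n) vect) \<Rightarrow> 'm \<Rightarrow> 'a list \<Rightarrow> ('b \<times> 'p) vect" where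
  "mor_comp A' g f m as = (\<Sum>j\<le>length as.
     linext (\<lambda>(b, n). linext (\<lambda>(b', p). linext (\<lambda>c. c \<otimes> p) (mult A' b b')) (g n (drop j as)))
       (f m (take j as)))"

text \<open>\<open>\<Sum>\<^sub>j f(id \<otimes> \<partial>\<^sub>j)\<close>, \<open>\<Sum>\<^sub>j f(id \<otimes> \<mu>\<^bsub>j,j+1\<^esub>)\<close> and \<open>(\<partial>' \<otimes> id) f\<close>.\<close>

definition pre_bd :: "('r, 'a) dgcat \<Rightarrow> ('m \<Rightarrow> 'a list \<Rightarrow> 'x vect) \<Rightarrow> 'm \<Rightarrow> 'a list \<Rightarrow> 'x vect" where
  "pre_bd A f m as = (\<Sum>j<length as. linext (\<lambda>c. f m (as[j := c])) (bd A (as ! j)))"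

definition pre_mult :: "('r, 'a) dgcat \<Rightarrow> ('m \<Rightarrow> 'a list \<Rightarrow> 'x vect) \<Rightarrow> 'm \<Rightarrow> 'a list \<Rightarrow> 'x vect" where
  "pre_mult A f m as = (\<Sum>j<length as - 1.
     linext (\<lambda>c. f m (take j as @ c # drop (j + 2) as)) (mult A (as ! j) (as ! Suc j)))"

definition post_bd :: "('l, 'b) dgcat \<Rightarrow> ('m \<Rightarrow> 'a list \<Rightarrow> ('b \<times> 'n) vect) \<Rightarrow>
    'm \<Rightarrow> 'a list \<Rightarrow> ('b \<times> 'n) vect" where
  "post_bd A' f m as = linext (\<lambda>(b, n). linext (\<lambda>c. c \<otimes> n) (bd A' b)) (f m as)"

text \<open>
  The operations have bidegree \<open>(0,0)\<close> as maps to \<open>A'[1] \<otimes> M\<close>, hence \<open>(0,1)\<close> as maps to \<open>A' \<otimes> M\<close>.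
\<close>

definition DA_bimodule ::
  "('l, 'b) dgcat \<Rightarrow> ('r, 'a) dgcat \<Rightarrow> ('l, 'r, 'b, 'a, 'm) da \<Rightarrow> bool" where
  "DA_bimodule A' A M \<longleftrightarrow>
     dg_category A' \<and> dg_category A \<and>
     maps_of_bidegree A' A M M (inputs A M) 0 1 (ops M) \<and>
     (\<forall>(m, as) \<in> inputs A M.
        mor_comp A' (ops M) (ops M) m as + pre_bd A (ops M) m as + pre_mult A (ops M) m as
          + post_bd A' (ops M) m as = 0) \<and>
     (\<forall>m \<in> gens M. ops M m [idn A (rgt M m)] = idn A' (lft M m) \<otimes> m) \<and>
     (\<forall>(m, as) \<in> inputs A M. length as \<ge> 2 \<and> set as \<inter> identities A \<noteq> {} \<longrightarrow> ops M m as = 0)"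


section \<open>Morphisms and homotopy equivalence\<close>

text \<open>Only the values of a morphism on \<open>aug_inputs\<close> are meaningful.\<close>

definition morphism ::
  "('l, 'b) dgcat \<Rightarrow> ('r, 'a) dgcat \<Rightarrow> ('l, 'r, 'b, 'a, 'm) da \<Rightarrow> ('l, 'r, 'b, 'a, 'n) da \<Rightarrow>
   int \<Rightarrow> int \<Rightarrow> ('m \<Rightarrow> 'a list \<Rightarrow> ('b \<times> 'n) vect) \<Rightarrow> bool" where
  "morphism A' A M N i j f \<longleftrightarrow> maps_of_bidegree A' A M N (aug_inputs A M) i j f"

definition mor_diff ::
  "('l, 'b) dgcat \<Rightarrow> ('r, 'a) dgcat \<Rightarrow> ('l, 'r, 'b, 'a, 'm) da \<Rightarrow> ('l, 'r, 'b, 'a, 'n) da \<Rightarrow>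
   ('m \<Rightarrow> 'a list \<Rightarrow> ('b \<times> 'n) vect) \<Rightarrow> 'm \<Rightarrow> 'a list \<Rightarrow> ('b \<times> 'n) vect" where
  "mor_diff A' A M N f m as =
     mor_comp A' (ops N) f m as + mor_comp A' f (ops M) m as
       + pre_bd A f m as + pre_mult A f m as + post_bd A' f m as"

definition mor_id :: "('l, 'b) dgcat \<Rightarrow> ('l, 'r, 'b, 'a, 'm) da \<Rightarrow>
    'm \<Rightarrow> 'a list \<Rightarrow> ('b \<times> 'm) vect" where
  "mor_id A' M m as = (if as = [] then idn A' (lft M m) \<otimes> m else 0)"

definition closed_morphism ::
  "('l, 'b) dgcat \<Rightarrow> ('r, 'a) dgcat \<Rightarrow> ('l, 'r, 'b, 'a, 'm) da \<Rightarrow> ('l, 'r, 'b, 'a, 'n) da \<Rightarrow>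
   int \<Rightarrow> int \<Rightarrow> ('m \<Rightarrow> 'a list \<Rightarrow> ('b \<times> 'n) vect) \<Rightarrow> bool" where
  "closed_morphism A' A M N i j f \<longleftrightarrow>
     morphism A' A M N i j f \<and> (\<forall>(m, as) \<in> aug_inputs A M. mor_diff A' A M N f m as = 0)"

definition homotopic ::
  "('l, 'b) dgcat \<Rightarrow> ('r, 'a) dgcat \<Rightarrow> ('l, 'r, 'b, 'a, 'm) da \<Rightarrow> ('l, 'r, 'b, 'a, 'n) da \<Rightarrow>
   ('m \<Rightarrow> 'a list \<Rightarrow> ('b \<times> 'n) vect) \<Rightarrow> ('m \<Rightarrow> 'a list \<Rightarrow> ('b \<times> 'n) vect) \<Rightarrow> bool" where
  "homotopic A' A M N f g \<longleftrightarrow>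
     (\<exists>h. morphism A' A M N 0 (-1) h \<and>
       (\<forall>(m, as) \<in> aug_inputs A M. f m as + g m as = mor_diff A' A M N h m as))"

definition homotopy_equivalent ::
  "('l, 'b) dgcat \<Rightarrow> ('r, 'a) dgcat \<Rightarrow> ('l, 'r, 'b, 'a, 'm) da \<Rightarrow> ('l, 'r, 'b, 'a, 'n) da \<Rightarrow> bool" where
  "homotopy_equivalent A' A M N \<longleftrightarrow>
     DA_bimodule A' A M \<and> DA_bimodule A' A N \<and>
     (\<exists>f g. closed_morphism A' A M N 0 0 f \<and> closed_morphism A' A N M 0 0 g \<and>
        homotopic A' A M M (mor_comp A' g f) (mor_id A' M) \<and>
        homotopic A' A N N (mor_comp A' f g) (mor_id A' N))"


section \<open>Shifts, mapping cones, box products, identity bimodules\<close>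

text \<open>\<open>shift i j M\<close> is \<open>q\<^sup>i M[j]\<close>.\<close>

definition shift :: "int \<Rightarrow> int \<Rightarrow> ('l, 'r, 'b, 'a, 'm) da \<Rightarrow> ('l, 'r, 'b, 'a, 'm) da" where
  "shift i j M = M\<lparr>qgr := (\<lambda>m. qgr M m + i), hgr := (\<lambda>m. hgr M m - j)\<rparr>"

text \<open>The mapping cone of \<open>f: M \<rightarrow> N\<close>; \<open>f\<close> is extended by zero to inputs containing an identity.\<close>

definition cone :: "('r, 'a) dgcat \<Rightarrow> ('l, 'r, 'b, 'a, 'm) da \<Rightarrow> ('l, 'r, 'b, 'a, 'n) da \<Rightarrow>
    ('m \<Rightarrow> 'a list \<Rightarrow> ('b \<times> 'n) vect) \<Rightarrow> ('l, 'r, 'b, 'a, 'm + 'n) da" where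
  "cone A M N f =
    \<lparr> gens = gens M <+> gens N,
      lft = case_sum (lft M) (lft N),
      rgt = case_sum (rgt M) (rgt N),
      qgr = case_sum (qgr M) (qgr N),
      hgr = case_sum (hgr M) (hgr N),
      ops = (\<lambda>x as. case x of
          Inl m \<Rightarrow> linext (\<lambda>(b, m'). b \<otimes> Inl m') (ops M m as)
            + (if set as \<inter> identities A = {} then linext (\<lambda>(b, n). b \<otimes> Inr n) (f m as) else 0)
        | Inr n \<Rightarrow> linext (\<lambda>(b, n'). b \<otimes> Inr n') (ops N n as)) \<rparr>"

text \<open>\<open>op_iter N j\<close> is \<open>\<delta>\<^bsup>j,N\<^esup>\<close>, the outputs being collected in a list of length \<open>j\<close>.\<close>

fun op_iter :: "('l, 'r, 'b, 'a, 'n) da \<Rightarrow> nat \<Rightarrow> 'n \<Rightarrow> 'a list \<Rightarrow> ('b list \<times> 'n) vect" where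
  "op_iter N 0 n as = (if as = [] then [] \<otimes> n else 0)"
| "op_iter N (Suc j) n as = (\<Sum>i\<le>length as.
     linext (\<lambda>(b, n'). linext (\<lambda>(bs, n''). (b # bs) \<otimes> n'') (op_iter N j n' (drop i as)))
       (ops N n (take i as)))"

text \<open>
  The sum over \<open>j\<close> is meaningful if only finitely many summands are nonzero, which is the case
  whenever the operations of \<open>M\<close> have boundedly many inputs only. Products associate to the left.
\<close>

definition box_product :: "('k, 'l, 'c, 'b, 'm) da \<Rightarrow> ('l, 'r, 'b, 'a, 'n) da \<Rightarrow>
    ('k, 'r, 'c, 'a, 'm \<times> 'n) da"  (infixl \<open>\<boxtimes>\<close> 70) where
  "M \<boxtimes> N =
    \<lparr> gens = {(m, n). m \<in> gens M \<and> n \<in> gens N \<and> rgt M m = lft N n},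
      lft = (\<lambda>(m, n). lft M m),
      rgt = (\<lambda>(m, n). rgt N n),
      qgr = (\<lambda>(m, n). qgr M m + qgr N n),
      hgr = (\<lambda>(m, n). hgr M m + hgr N n),
      ops = (\<lambda>(m, n) as. Sum_any (\<lambda>j.
        linext (\<lambda>(bs, n'). linext (\<lambda>(c, m'). c \<otimes> (m', n')) (ops M m bs)) (op_iter N j n as))) \<rparr>"

text \<open>The basis element \<open>\<I>\<^sub>S\<close> of the identity bimodule is represented by the object \<open>S\<close>.\<close>

definition id_bimod :: "('o, 'a) dgcat \<Rightarrow> ('o, 'o, 'a, 'a, 'o) da" where
  "id_bimod A =
    \<lparr> gens = UNIV, lft = (\<lambda>S. S), rgt = (\<lambda>S. S), qgr = (\<lambda>_. 0), hgr = (\<lambda>_. 0),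
      ops = (\<lambda>T as. case as of [a] \<Rightarrow> if lob A a = T then a \<otimes> rob A a else 0 | _ \<Rightarrow> 0) \<rparr>"

text \<open>Strictly unital extension of operations listed on non-identity inputs.\<close>

definition unital :: "('l, 'b) dgcat \<Rightarrow> ('r, 'a) dgcat \<Rightarrow> ('m \<Rightarrow> 'l) \<Rightarrow> ('m \<Rightarrow> 'r) \<Rightarrow>
    ('m \<Rightarrow> 'a list \<Rightarrow> ('b \<times> 'm) vect) \<Rightarrow> 'm \<Rightarrow> 'a list \<Rightarrow> ('b \<times> 'm) vect" where
  "unital A' A l r f m as =
     (if as = [idn A (r m)] then idn A' (l m) \<otimes> m
      else if set as \<inter> identities A \<noteq> {} then 0
      else f m as)"


section \<open>The algebras\<close>

subsection \<open>The algebra \<open>\<A>\<^bsub>1,1\<^esub>\<close>\<close>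

datatype ob = Ob_uu | Ob_ou | Ob_uo | Ob_oo

text \<open>
  \<open>E_uu\<close> is the identity of \<open>uu\<close>, \<open>U_ou k = U\<^sub>1\<^sup>k\<close>, \<open>U_uo k = U\<^sub>2\<^sup>k\<close>, \<open>U_oo k l = U\<^sub>1\<^sup>k U\<^sub>2\<^sup>l\<close>.
\<close>

datatype alg = E_uu | U_ou nat | U_uo nat | U_oo nat nat | Lam

fun alg_lob :: "alg \<Rightarrow> ob" where
  "alg_lob E_uu = Ob_uu"
| "alg_lob (U_ou k) = Ob_ou"
| "alg_lob (U_uo k) = Ob_uo"
| "alg_lob (U_oo k l) = Ob_oo"
| "alg_lob Lam = Ob_uo"

fun alg_rob :: "alg \<Rightarrow> ob" where
  "alg_rob E_uu = Ob_uu"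
| "alg_rob (U_ou k) = Ob_ou"
| "alg_rob (U_uo k) = Ob_uo"
| "alg_rob (U_oo k l) = Ob_oo"
| "alg_rob Lam = Ob_ou"

fun alg_idn :: "ob \<Rightarrow> alg" where
  "alg_idn Ob_uu = E_uu"
| "alg_idn Ob_ou = U_ou 0"
| "alg_idn Ob_uo = U_uo 0"
| "alg_idn Ob_oo = U_oo 0 0"

fun alg_mult :: "alg \<Rightarrow> alg \<Rightarrow> alg vect" where
  "alg_mult E_uu E_uu = gen E_uu"
| "alg_mult (U_ou k) (U_ou l) = gen (U_ou (k + l))"
| "alg_mult (U_uo k) (U_uo l) = gen (U_uo (k + l))"
| "alg_mult (U_oo k l) (U_oo k' l') = gen (U_oo (k + k') (l + l'))"
| "alg_mult (U_uo k) Lam = (if k = 0 then gen Lam else 0)"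
| "alg_mult Lam (U_ou k) = (if k = 0 then gen Lam else 0)"
| "alg_mult _ _ = 0"

fun alg_qdeg :: "alg \<Rightarrow> int" where
  "alg_qdeg E_uu = 0"
| "alg_qdeg (U_ou k) = - 2 * int k"
| "alg_qdeg (U_uo k) = - 2 * int k"
| "alg_qdeg (U_oo k l) = - 2 * (int k + int l)"
| "alg_qdeg Lam = 1"

fun alg_hdeg :: "alg \<Rightarrow> int" where
  "alg_hdeg E_uu = 0"
| "alg_hdeg (U_ou k) = 2 * int k"
| "alg_hdeg (U_uo k) = 2 * int k"
| "alg_hdeg (U_oo k l) = 2 * (int k + int l)"
| "alg_hdeg Lam = 0"

definition A11 :: "(ob, alg) dgcat" where
  "A11 = \<lparr> lob = alg_lob, rob = alg_rob, idn = alg_idn, mult = alg_mult, bd = (\<lambda>_. 0),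
           qdeg = alg_qdeg, hdeg = alg_hdeg \<rparr>"


subsection \<open>The algebra \<open>\<A>\<^bsub>1,1\<^esub>\<^sup>c\<^sup>a\<^sup>n\<close>\<close>

datatype cob = Ob_none | Ob_A | Ob_B | Ob_AB

text \<open>
  The part of \<open>\<A>\<^bsub>1,1\<^esub>\<^sup>c\<^sup>a\<^sup>n\<close> on the objects \<open>A\<close>, \<open>B\<close> is the path algebra of the quiver with arrows
  \<open>R\<^sub>1\<close>, \<open>L\<^sub>1\<close>, \<open>U\<^sub>2\<close> modulo the monomial relations \<open>R\<^sub>1U\<^sub>2 = 0\<close>, \<open>U\<^sub>2L\<^sub>1 = 0\<close>; its basis consists of the
  remaining paths. With \<open>U\<^sub>1 = R\<^sub>1L\<^sub>1\<close> at \<open>A\<close> and \<open>U\<^sub>1 = L\<^sub>1R\<^sub>1\<close> at \<open>B\<close> these are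
  \<open>C_A k = U\<^sub>1\<^sup>k\<close> at \<open>A\<close>, \<open>C_R k = R\<^sub>1U\<^sub>1\<^sup>k\<close>, \<open>C_L k = L\<^sub>1U\<^sub>1\<^sup>k\<close>, \<open>C_B1 k = U\<^sub>1\<^sup>k\<close> at \<open>B\<close> and, with a shift of
  the index in order not to list the identity of \<open>B\<close> twice, \<open>C_B2 k = U\<^sub>2\<^bsup>k+1\<^esup>\<close>. Furthermore,
  \<open>C_none\<close> is the identity of \<open>\<emptyset>\<close> and \<open>C_AB k l = U\<^sub>1\<^sup>kU\<^sub>2\<^sup>l\<close>.
\<close>

datatype can = C_none | C_A nat | C_R nat | C_L nat | C_B1 nat | C_B2 nat | C_AB nat nat

fun can_lob :: "can \<Rightarrow> cob" where
  "can_lob C_none = Ob_none"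
| "can_lob (C_A k) = Ob_A"
| "can_lob (C_R k) = Ob_A"
| "can_lob (C_L k) = Ob_B"
| "can_lob (C_B1 k) = Ob_B"
| "can_lob (C_B2 k) = Ob_B"
| "can_lob (C_AB k l) = Ob_AB"

fun can_rob :: "can \<Rightarrow> cob" where
  "can_rob C_none = Ob_none"
| "can_rob (C_A k) = Ob_A"
| "can_rob (C_R k) = Ob_B"
| "can_rob (C_L k) = Ob_A"
| "can_rob (C_B1 k) = Ob_B"
| "can_rob (C_B2 k) = Ob_B"
| "can_rob (C_AB k l) = Ob_AB"

fun can_idn :: "cob \<Rightarrow> can" where
  "can_idn Ob_none = C_none"
| "can_idn Ob_A = C_A 0"
| "can_idn Ob_B = C_B1 0"
| "can_idn Ob_AB = C_AB 0 0"

fun can_mult :: "can \<Rightarrow> can \<Rightarrow> can vect" where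
  "can_mult C_none C_none = gen C_none"
| "can_mult (C_A k) (C_A l) = gen (C_A (k + l))"
| "can_mult (C_A k) (C_R l) = gen (C_R (k + l))"
| "can_mult (C_R k) (C_B1 l) = gen (C_R (k + l))"
| "can_mult (C_R k) (C_L l) = gen (C_A (k + l + 1))"
| "can_mult (C_L k) (C_A l) = gen (C_L (k + l))"
| "can_mult (C_L k) (C_R l) = gen (C_B1 (k + l + 1))"
| "can_mult (C_B1 k) (C_L l) = gen (C_L (k + l))"
| "can_mult (C_B1 k) (C_B1 l) = gen (C_B1 (k + l))"
| "can_mult (C_B1 k) (C_B2 l) = (if k = 0 then gen (C_B2 l) else 0)"
| "can_mult (C_B2 k) (C_B1 l) = (if l = 0 then gen (C_B2 k) else 0)"
| "can_mult (C_B2 k) (C_B2 l) = gen (C_B2 (k + l + 1))"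
| "can_mult (C_AB k l) (C_AB k' l') = gen (C_AB (k + k') (l + l'))"
| "can_mult _ _ = 0"

fun can_hdeg :: "can \<Rightarrow> int" where
  "can_hdeg C_none = 0"
| "can_hdeg (C_A k) = 2 * int k"
| "can_hdeg (C_R k) = 2 * int k + 1"
| "can_hdeg (C_L k) = 2 * int k + 1"
| "can_hdeg (C_B1 k) = 2 * int k"
| "can_hdeg (C_B2 k) = 2 * (int k + 1)"
| "can_hdeg (C_AB k l) = 2 * (int k + int l)"

text \<open>All generators have bidegree \<open>(-n,n)\<close> for some \<open>n\<close>.\<close>

definition Acan :: "(cob, can) dgcat" where
  "Acan = \<lparr> lob = can_lob, rob = can_rob, idn = can_idn, mult = can_mult, bd = (\<lambda>_. 0),
            qdeg = (\<lambda>a. - can_hdeg a), hdeg = can_hdeg \<rparr>"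

text \<open>\<open>U\<^sub>2\<^sup>k\<close> at \<open>B\<close>\<close>

fun U2_B :: "nat \<Rightarrow> can" where
  "U2_B 0 = C_B1 0"
| "U2_B (Suc k) = C_B2 k"


section \<open>The crossing bimodules over \<open>\<A>\<^bsub>1,1\<^esub>\<close>\<close>

datatype xgen = Xa | Ya | Xb | Yb | Zc | Zd

fun X_lft :: "xgen \<Rightarrow> ob" where
  "X_lft Xa = Ob_ou" | "X_lft Ya = Ob_uo" | "X_lft Xb = Ob_ou" | "X_lft Yb = Ob_uo"
| "X_lft Zc = Ob_oo" | "X_lft Zd = Ob_oo"

fun X_rgt :: "xgen \<Rightarrow> ob" where
  "X_rgt Xa = Ob_ou" | "X_rgt Ya = Ob_ou" | "X_rgt Xb = Ob_uo" | "X_rgt Yb = Ob_uo"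
| "X_rgt Zc = Ob_oo" | "X_rgt Zd = Ob_oo"

fun X_qgr :: "xgen \<Rightarrow> int" where
  "X_qgr Xa = -1" | "X_qgr Ya = 0" | "X_qgr Xb = 0" | "X_qgr Yb = 1"
| "X_qgr Zc = -1" | "X_qgr Zd = 1"

fun X_hgr :: "xgen \<Rightarrow> int" where
  "X_hgr Xa = 2" | "X_hgr Ya = 1" | "X_hgr Xb = 1" | "X_hgr Yb = 0"
| "X_hgr Zc = 2" | "X_hgr Zd = 0"

text \<open>The right actions of \<open>U\<^sub>1\<close> and \<open>U\<^sub>2\<close> on \<open>\<F>\<^sub>2[U\<^sub>1,U\<^sub>2] zc \<oplus> \<F>\<^sub>2[U\<^sub>1,U\<^sub>2] zd\<close>\<close>

fun Z_U1 :: "alg \<times> xgen \<Rightarrow> (alg \<times> xgen) vect" where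
  "Z_U1 (U_oo i j, Zc) =
     U_oo (i + 1) j \<otimes> Zc + U_oo i (j + 1) \<otimes> Zc + U_oo (i + 1) (j + 1) \<otimes> Zd"
| "Z_U1 (U_oo i j, Zd) = U_oo i j \<otimes> Zc"
| "Z_U1 _ = 0"

fun Z_U2 :: "alg \<times> xgen \<Rightarrow> (alg \<times> xgen) vect" where
  "Z_U2 (U_oo i j, Zc) = U_oo (i + 1) (j + 1) \<otimes> Zd"
| "Z_U2 (U_oo i j, Zd) =
     U_oo i j \<otimes> Zc + U_oo (i + 1) j \<otimes> Zd + U_oo i (j + 1) \<otimes> Zd"
| "Z_U2 _ = 0"

definition Z_act :: "xgen \<Rightarrow> nat \<Rightarrow> nat \<Rightarrow> (alg \<times> xgen) vect" where
  "Z_act z k l = (linext Z_U2 ^^ l) ((linext Z_U1 ^^ k) (U_oo 0 0 \<otimes> z))"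

definition X_op :: "xgen \<Rightarrow> alg list \<Rightarrow> (alg \<times> xgen) vect" where
  "X_op m as = (case m of
      Xa \<Rightarrow> (case as of [U_ou (Suc k)] \<Rightarrow> U_ou (k + 1) \<otimes> Xa | _ \<Rightarrow> 0)
    | Ya \<Rightarrow> (case as of [] \<Rightarrow> Lam \<otimes> Xa
        | [U_ou (Suc k)] \<Rightarrow> U_uo (k + 1) \<otimes> Ya | _ \<Rightarrow> 0)
    | Xb \<Rightarrow> (case as of [U_uo (Suc k)] \<Rightarrow> U_ou (k + 1) \<otimes> Xb
        | [Lam, U_ou (Suc k)] \<Rightarrow> U_ou k \<otimes> Xa
        | [U_uo (Suc k), Lam] \<Rightarrow> U_ou k \<otimes> Xa | _ \<Rightarrow> 0)
    | Yb \<Rightarrow> (case as of [] \<Rightarrow> Lam \<otimes> Xb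
        | [U_uo (Suc k)] \<Rightarrow> U_uo (k + 1) \<otimes> Yb
        | [Lam, U_ou (Suc k)] \<Rightarrow> U_uo k \<otimes> Ya
        | [U_uo (Suc k), Lam] \<Rightarrow> U_uo k \<otimes> Ya | _ \<Rightarrow> 0)
    | _ \<Rightarrow> (case as of [U_oo k l] \<Rightarrow> Z_act m k l | _ \<Rightarrow> 0))"

definition X_bimod :: "(ob, ob, alg, alg, xgen) da" where
  "X_bimod = \<lparr> gens = UNIV, lft = X_lft, rgt = X_rgt, qgr = X_qgr, hgr = X_hgr,
               ops = unital A11 A11 X_lft X_rgt X_op \<rparr>"

definition eta :: "ob \<Rightarrow> alg list \<Rightarrow> (alg \<times> xgen) vect" where
  "eta S as = (case S of
      Ob_uu \<Rightarrow> 0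
    | Ob_ou \<Rightarrow> (case as of [] \<Rightarrow> U_ou 0 \<otimes> Xa | _ \<Rightarrow> 0)
    | Ob_uo \<Rightarrow> (case as of [] \<Rightarrow> U_uo 1 \<otimes> Yb | [Lam] \<Rightarrow> U_uo 0 \<otimes> Ya | _ \<Rightarrow> 0)
    | Ob_oo \<Rightarrow> (case as of [] \<Rightarrow> U_oo 0 0 \<otimes> Zc + U_oo 0 1 \<otimes> Zd | _ \<Rightarrow> 0))"

definition eps' :: "xgen \<Rightarrow> alg list \<Rightarrow> (alg \<times> ob) vect" where
  "eps' m as = (case m of
      Xa \<Rightarrow> (case as of [] \<Rightarrow> U_ou 1 \<otimes> Ob_ou | _ \<Rightarrow> 0)
    | Ya \<Rightarrow> 0
    | Xb \<Rightarrow> (case as of [Lam] \<Rightarrow> U_ou 0 \<otimes> Ob_ou | _ \<Rightarrow> 0)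
    | Yb \<Rightarrow> (case as of [] \<Rightarrow> U_uo 0 \<otimes> Ob_uo | _ \<Rightarrow> 0)
    | Zc \<Rightarrow> (case as of [] \<Rightarrow> U_oo 1 0 \<otimes> Ob_oo | _ \<Rightarrow> 0)
    | Zd \<Rightarrow> (case as of [] \<Rightarrow> U_oo 0 0 \<otimes> Ob_oo | _ \<Rightarrow> 0))"

definition P' :: "(ob, ob, alg, alg, ob + xgen) da" where
  "P' = cone A11 (shift (-1) 0 (id_bimod A11)) (shift 0 1 X_bimod) eta"

definition N' :: "(ob, ob, alg, alg, xgen + ob) da" where
  "N' = cone A11 (shift 0 1 X_bimod) (shift 1 0 (id_bimod A11)) eps'"


section \<open>The change-of-basis bimodules\<close>

datatype kgen = Kap1 | Kap2 | Kap3 | Kap4 | Kap5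

fun K_lft :: "kgen \<Rightarrow> cob" where
  "K_lft Kap1 = Ob_none" | "K_lft Kap2 = Ob_A" | "K_lft Kap3 = Ob_A" | "K_lft Kap4 = Ob_B"
| "K_lft Kap5 = Ob_AB"

fun K_rgt :: "kgen \<Rightarrow> ob" where
  "K_rgt Kap1 = Ob_uu" | "K_rgt Kap2 = Ob_ou" | "K_rgt Kap3 = Ob_uo" | "K_rgt Kap4 = Ob_uo"
| "K_rgt Kap5 = Ob_oo"

definition K_op :: "kgen \<Rightarrow> alg list \<Rightarrow> (can \<times> kgen) vect" where
  "K_op m as = (case m of
      Kap1 \<Rightarrow> 0
    | Kap2 \<Rightarrow> (case as of [U_ou (Suc k)] \<Rightarrow> C_A (k + 1) \<otimes> Kap2 | _ \<Rightarrow> 0)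
    | Kap3 \<Rightarrow> (case as of [] \<Rightarrow> C_R 0 \<otimes> Kap4 | [Lam] \<Rightarrow> C_A 0 \<otimes> Kap2 | _ \<Rightarrow> 0)
    | Kap4 \<Rightarrow> (case as of [U_uo (Suc k)] \<Rightarrow> U2_B (k + 1) \<otimes> Kap4
        | [Lam, U_ou (Suc k)] \<Rightarrow> C_L k \<otimes> Kap2 | _ \<Rightarrow> 0)
    | Kap5 \<Rightarrow> (case as of [U_oo k l] \<Rightarrow> C_AB k l \<otimes> Kap5 | _ \<Rightarrow> 0))"

definition K_bimod :: "(cob, ob, can, alg, kgen) da" where
  "K_bimod = \<lparr> gens = UNIV, lft = K_lft, rgt = K_rgt,
               qgr = (\<lambda>m. if m = Kap3 then -1 else 0), hgr = (\<lambda>_. 0),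
               ops = unital Acan A11 K_lft K_rgt K_op \<rparr>"

datatype lgen = Lam1 | Lam2 | Lam3 | Lam4 | Lam5

fun L_lft :: "lgen \<Rightarrow> ob" where
  "L_lft Lam1 = Ob_uu" | "L_lft Lam2 = Ob_ou" | "L_lft Lam3 = Ob_ou" | "L_lft Lam4 = Ob_uo"
| "L_lft Lam5 = Ob_oo"

fun L_rgt :: "lgen \<Rightarrow> cob" where
  "L_rgt Lam1 = Ob_none" | "L_rgt Lam2 = Ob_A" | "L_rgt Lam3 = Ob_B" | "L_rgt Lam4 = Ob_B"
| "L_rgt Lam5 = Ob_AB"

definition L_op :: "lgen \<Rightarrow> can list \<Rightarrow> (alg \<times> lgen) vect" where
  "L_op m as = (case m of
      Lam1 \<Rightarrow> 0
    | Lam2 \<Rightarrow> (case as of [C_A (Suc k)] \<Rightarrow> U_ou (k + 1) \<otimes> Lam2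
        | [C_R k] \<Rightarrow> U_ou k \<otimes> Lam3 | _ \<Rightarrow> 0)
    | Lam3 \<Rightarrow> (case as of [C_L k] \<Rightarrow> U_ou (k + 1) \<otimes> Lam2
        | [C_B1 (Suc k)] \<Rightarrow> U_ou (k + 1) \<otimes> Lam3 | _ \<Rightarrow> 0)
    | Lam4 \<Rightarrow> (case as of [] \<Rightarrow> Lam \<otimes> Lam3
        | [C_B2 k] \<Rightarrow> U_uo (k + 1) \<otimes> Lam4 | _ \<Rightarrow> 0)
    | Lam5 \<Rightarrow> (case as of [C_AB k l] \<Rightarrow> U_oo k l \<otimes> Lam5 | _ \<Rightarrow> 0))"

definition L_bimod :: "(ob, cob, alg, can, lgen) da" where
  "L_bimod = \<lparr> gens = UNIV, lft = L_lft, rgt = L_rgt,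
               qgr = (\<lambda>m. if m = Lam3 then -1 else 0), hgr = (\<lambda>m. if m = Lam3 then 1 else 0),
               ops = unital A11 Acan L_lft L_rgt L_op \<rparr>"


section \<open>The bimodules of Ozsvath and Szabo\<close>

text \<open>
  Both bimodules have generators of the same shape: \<open>S\<^sub>\<emptyset>\<close>, \<open>S\<^sub>A\<close>, \<open>W\<close>, \<open>N\<^sub>B\<close>, \<open>N\<^bsub>AB\<^esub>\<close> for the positive
  crossing, and their primed versions for the negative crossing.
\<close>

datatype osz_gen = S_none | S_A | W | N_B | N_AB

fun osz_lft :: "osz_gen \<Rightarrow> cob" where
  "osz_lft S_none = Ob_none" | "osz_lft S_A = Ob_A" | "osz_lft W = Ob_B" | "osz_lft N_B = Ob_B"
| "osz_lft N_AB = Ob_AB"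

fun osz_rgt :: "osz_gen \<Rightarrow> cob" where
  "osz_rgt S_none = Ob_none" | "osz_rgt S_A = Ob_A" | "osz_rgt W = Ob_A" | "osz_rgt N_B = Ob_B"
| "osz_rgt N_AB = Ob_AB"

fun POSz_qgr :: "osz_gen \<Rightarrow> int" where
  "POSz_qgr S_none = -1" | "POSz_qgr S_A = -1" | "POSz_qgr W = 0" | "POSz_qgr N_B = 1"
| "POSz_qgr N_AB = 1"

fun POSz_hgr :: "osz_gen \<Rightarrow> int" where
  "POSz_hgr S_none = 0" | "POSz_hgr S_A = 0" | "POSz_hgr W = 0" | "POSz_hgr N_B = -1"
| "POSz_hgr N_AB = -1"

definition POSz_op :: "osz_gen \<Rightarrow> can list \<Rightarrow> (can \<times> osz_gen) vect" where
  "POSz_op m as = (case m of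
      S_none \<Rightarrow> 0
    | S_A \<Rightarrow> (case as of [] \<Rightarrow> C_R 0 \<otimes> W | _ \<Rightarrow> 0)
    | W \<Rightarrow> (case as of [C_A (Suc k)] \<Rightarrow> U2_B (k + 1) \<otimes> W
        | [C_R k] \<Rightarrow> U2_B (k + 1) \<otimes> N_B | _ \<Rightarrow> 0)
    | N_B \<Rightarrow> (case as of [C_B2 k, C_L 0] \<Rightarrow> C_L k \<otimes> S_A
        | [C_L k] \<Rightarrow> U2_B k \<otimes> W
        | [C_B1 (Suc k)] \<Rightarrow> U2_B (k + 1) \<otimes> N_B
        | [C_B2 k] \<Rightarrow> C_B1 (k + 1) \<otimes> N_B | _ \<Rightarrow> 0)
    | N_AB \<Rightarrow> (case as of [C_AB k l] \<Rightarrow> C_AB l k \<otimes> N_AB | _ \<Rightarrow> 0))"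

definition P_OSz :: "(cob, cob, can, can, osz_gen) da" where
  "P_OSz = \<lparr> gens = UNIV, lft = osz_lft, rgt = osz_rgt, qgr = POSz_qgr, hgr = POSz_hgr,
             ops = unital Acan Acan osz_lft osz_rgt POSz_op \<rparr>"

fun NOSz_qgr :: "osz_gen \<Rightarrow> int" where
  "NOSz_qgr S_none = 1" | "NOSz_qgr S_A = 1" | "NOSz_qgr W = 0" | "NOSz_qgr N_B = -1"
| "NOSz_qgr N_AB = -1"

fun NOSz_hgr :: "osz_gen \<Rightarrow> int" where
  "NOSz_hgr S_none = 0" | "NOSz_hgr S_A = 0" | "NOSz_hgr W = 0" | "NOSz_hgr N_B = 1"
| "NOSz_hgr N_AB = 1"

definition NOSz_op :: "osz_gen \<Rightarrow> can list \<Rightarrow> (can \<times> osz_gen) vect" where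
  "NOSz_op m as = (case m of
      S_none \<Rightarrow> 0
    | S_A \<Rightarrow> (case as of [C_R 0, C_B2 k] \<Rightarrow> C_R k \<otimes> N_B | _ \<Rightarrow> 0)
    | W \<Rightarrow> (case as of [] \<Rightarrow> C_L 0 \<otimes> S_A
        | [C_A (Suc k)] \<Rightarrow> U2_B (k + 1) \<otimes> W
        | [C_R k] \<Rightarrow> U2_B k \<otimes> N_B | _ \<Rightarrow> 0)
    | N_B \<Rightarrow> (case as of [C_L k] \<Rightarrow> U2_B (k + 1) \<otimes> W
        | [C_B1 (Suc k)] \<Rightarrow> U2_B (k + 1) \<otimes> N_B
        | [C_B2 k] \<Rightarrow> C_B1 (k + 1) \<otimes> N_B | _ \<Rightarrow> 0)
    | N_AB \<Rightarrow> (case as of [C_AB k l] \<Rightarrow> C_AB l k \<otimes> N_AB | _ \<Rightarrow> 0))"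

definition N_OSz :: "(cob, cob, can, can, osz_gen) da" where
  "N_OSz = \<lparr> gens = UNIV, lft = osz_lft, rgt = osz_rgt, qgr = NOSz_qgr, hgr = NOSz_hgr,
             ops = unital Acan Acan osz_lft osz_rgt NOSz_op \<rparr>"

end

theory Submission
  imports Defs "HOL-Library.Product_Plus"
begin

text \<open>
  All four equivalences come from cancelling pairs of generators that are joined by an arrow \<open>y \<rightarrow> x\<close> of
  \<open>\<delta>\<^sup>1\<^sub>1\<close> whose coefficient is an identity. If \<open>h\<close> is the map \<open>x \<mapsto> y\<close>, and \<open>\<delta>'\<close> consists of all other
  operations, the homological perturbation lemma gives the operations
  \<open>\<Sum>\<^sub>n \<delta>'(h\<delta>')\<^sup>n\<close> on the remaining generators, together with the morphisms \<open>\<Sum>\<^sub>n (\<delta>'h)\<^sup>n\<close> and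
  \<open>\<Sum>\<^sub>n (h\<delta>')\<^sup>n\<close> and the homotopy \<open>\<Sum>\<^sub>n (h\<delta>')\<^sup>nh\<close>. All these sums are short, and their values
  are the explicit maps defined below.

  For \<open>\<K> \<boxtimes> P' \<boxtimes> \<L>\<close>, with 17 generators, six pairs cancel and the operations that remain are those of
  \<open>P\<^sub>O\<^sub>S\<^sub>z\<close>; the operation with two inputs, from \<open>N\<^sub>B\<close> to \<open>S\<^sub>A\<close>, is a zigzag through the pair formed by
  \<open>yb\<close> and \<open>xb\<close>, since no operation of \<open>\<K> \<boxtimes> P' \<boxtimes> \<L>\<close> has more than one input. For
  \<open>\<K> \<boxtimes> N' \<boxtimes> \<L>\<close> the result agrees with \<open>N\<^sub>O\<^sub>S\<^sub>z\<close> after a change of basis. In the other direction,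
  \<open>\<L> \<boxtimes> P\<^sub>O\<^sub>S\<^sub>z \<boxtimes> \<K>\<close> and \<open>P'\<close> both have ten generators; cancelling one pair in each of them leaves
  isomorphic bimodules. For \<open>\<L> \<boxtimes> N\<^sub>O\<^sub>S\<^sub>z \<boxtimes> \<K>\<close> and \<open>N'\<close>, two pairs cancel in each.

  At the objects \<open>oo\<close> and \<open>AB\<close>, everything is an ordinary bimodule over \<open>\<F>\<^sub>2[U\<^sub>1, U\<^sub>2]\<close>. In \<open>X\<close>, the
  right and left actions agree on \<open>w = zc + U\<^sub>2 zd\<close>, the image of \<open>\<eta>\<close>, and modulo \<open>w\<close> the right action
  on \<open>zd\<close> exchanges the two variables: \<open>zd \<cdot> p(U\<^sub>1,U\<^sub>2) = p(U\<^sub>2,U\<^sub>1) zd + \<beta>(p) w\<close>, where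
  \<open>\<beta>(p) = (p(U\<^sub>1,U\<^sub>2) - p(U\<^sub>2,U\<^sub>1)) / (U\<^sub>1 - U\<^sub>2)\<close> is the divided difference. The higher terms of the
  morphisms at these objects are given by \<open>\<beta>\<close>, and the equations follow from the product rule
  \<open>beta_add\<close> and from \<open>beta_sum\<close>.

  It remains to check the equations that define DA bimodules, closed morphisms and homotopies.
  Each map involved has a bounded number of inputs, so that the equations are trivial for long
  sequences of inputs, and strict unitality takes care of inputs that contain an identity
  (\<open>relation_with_identity\<close>). Hence \<open>DA_bimoduleI\<close>, \<open>closed_morphismI\<close> and \<open>homotopicI\<close> leave finitely
  many cases, each of them a family depending on the exponents of the inputs, and these are evaluated
  by rewriting.
\<close>

section \<open>Linear algebra over the field with two elements\<close>

lemma vect_double [simp]: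
  fixes v w :: "'x vect"
  shows "v + v = 0" and "v + (v + w) = w"
proof -
  have *: "v + v = 0" for v :: "'x vect"
    by (rule poly_mapping_eqI) (simp add: lookup_add)
  show "v + v = 0" by (rule *)
  show "v + (v + w) = w" by (simp add: * flip: add.assoc)
qed

lemma vect_eq_iff_add:
  fixes v w :: "'x vect"
  shows "v = w \<longleftrightarrow> v + w = 0"
  by (metis add.assoc add.right_neutral vect_double)

lemma keys_gen [simp]: "Poly_Mapping.keys (gen x) = {x}"
  by (simp add: gen_def)

lemma keys_bit_add:
  fixes u v :: "'x vect"
  shows "Poly_Mapping.keys (u + v) =
    (Poly_Mapping.keys u - Poly_Mapping.keys v) \<union> (Poly_Mapping.keys v - Poly_Mapping.keys u)"
  by (auto simp: in_keys_iff lookup_add)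

lemma linext_gen [simp]: "linext T (gen x) = T x"
  by (simp add: linext_def)

lemma linext_zero [simp]: "linext T 0 = 0"
  by (simp add: linext_def)

text \<open>
  As \<^const>\<open>linext\<close> sums over the support, which is a symmetric difference for a sum of vectors,
  additivity uses that the values lie in a space over \<open>\<F>\<^sub>2\<close>.
\<close>

lemma linext_add [simp]: "linext T (u + v) = linext T u + linext T v"
proof -
  let ?U = "Poly_Mapping.keys u" and ?V = "Poly_Mapping.keys v"
  have u: "sum T ?U = sum T (?U - ?V) + sum T (?U \<inter> ?V)"
    by (subst sum.Int_Diff[of _ _ ?V]) (auto simp: add.commute)
  have v: "sum T ?V = sum T (?V - ?U) + sum T (?U \<inter> ?V)"
    by (subst sum.Int_Diff[of _ _ ?U]) (auto simp: add.commute Int_commute)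
  have "sum T (Poly_Mapping.keys (u + v)) = sum T (?U - ?V) + sum T (?V - ?U)"
    unfolding keys_bit_add by (rule sum.union_disjoint) auto
  then show ?thesis
    unfolding linext_def u v by (simp add: ac_simps)
qed

lemma vect_induct [case_names zero add]:
  fixes v :: "'x vect"
  assumes "P 0" and "\<And>x v. P v \<Longrightarrow> P (gen x + v)"
  shows "P v"
proof (induction "card (Poly_Mapping.keys v)" arbitrary: v rule: less_induct)
  case less
  show ?case
  proof (cases "v = 0")
    case False
    then obtain x where x: "x \<in> Poly_Mapping.keys v"
      by (metis keys_eq_empty ex_in_conv)
    have "Poly_Mapping.keys (gen x + v) \<subset> Poly_Mapping.keys v"
      using x by (auto simp: keys_bit_add)
    then have "P (gen x + v)"
      by (intro less psubset_card_mono) simp_all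
    then have "P (gen x + (gen x + v))" by (rule assms(2))
    then show ?thesis by simp
  qed (use assms(1) in simp)
qed

lemma linext_fun_zero [simp]: "linext (\<lambda>x. 0) v = 0"
  by (simp add: linext_def)

lemma linext_case_zero [simp]: "linext (\<lambda>(x, y). 0) v = 0"
  by (simp add: case_prod_unfold)

lemma linext_fun_add: "linext (\<lambda>x. S x + T x) v = linext S v + linext T v"
  by (simp add: linext_def sum.distrib)

lemma linext_linext: "linext S (linext T v) = linext (\<lambda>x. linext S (T x)) v"
  by (induction v rule: vect_induct) auto

lemma linext_id [simp]: "linext gen v = v"
  by (induction v rule: vect_induct) auto

text \<open>Every basis element occurring in \<open>v\<close> satisfies \<open>Q\<close>.\<close>

definition supported :: "('x \<Rightarrow> bool) \<Rightarrow> 'x vect \<Rightarrow> bool"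
  where "supported Q v \<longleftrightarrow> (\<forall>x\<in>Poly_Mapping.keys v. Q x)"

lemma supported_zero [simp]: "supported Q 0"
  by (simp add: supported_def)

lemma supported_gen [simp]: "supported Q (gen x) \<longleftrightarrow> Q x"
  by (simp add: supported_def)

lemma supported_add [simp]: "supported Q u \<Longrightarrow> supported Q v \<Longrightarrow> supported Q (u + v)"
  by (auto simp: supported_def keys_bit_add)

lemma supported_sum: "(\<And>i. i \<in> I \<Longrightarrow> supported Q (v i)) \<Longrightarrow> supported Q (\<Sum>i\<in>I. v i)"
  by (induction I rule: infinite_finite_induct) auto

lemma supported_linext:
  assumes "supported Q v" and "\<And>x. Q x \<Longrightarrow> supported R (T x)"
  shows "supported R (linext T v)"
proof -
  have "supported R (sum T X)" if "finite X" and "\<And>x. x \<in> X \<Longrightarrow> Q x" for X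
    using that by (induction rule: finite_induct) (auto intro!: supported_add assms(2))
  from this[of "Poly_Mapping.keys v"] show ?thesis
    using assms(1) unfolding linext_def by (simp add: supported_def[of Q])
qed

section \<open>Evaluating compositions on explicit inputs\<close>

text \<open>Left multiplication by a basis element of \<open>A'\<close> on \<open>A' \<otimes> N\<close>\<close>

definition lmul :: "('l, 'b) dgcat \<Rightarrow> 'b \<Rightarrow> ('b \<times> 'p) vect \<Rightarrow> ('b \<times> 'p) vect" where
  "lmul A' b = linext (\<lambda>(b', p). linext (\<lambda>c. c \<otimes> p) (mult A' b b'))"

lemma lmul_simps [simp]:
  "lmul A' b 0 = 0"
  "lmul A' b (u + v) = lmul A' b u + lmul A' b v"
  "lmul A' b (b' \<otimes> p) = linext (\<lambda>c. c \<otimes> p) (mult A' b b')"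
  by (simp_all add: lmul_def)

text \<open>The map \<open>b \<otimes> n \<mapsto> b g(n; as)\<close>\<close>

definition apply_to :: "('l, 'b) dgcat \<Rightarrow> ('n \<Rightarrow> 'a list \<Rightarrow> ('b \<times> 'p) vect) \<Rightarrow> 'a list \<Rightarrow>
    ('b \<times> 'n) vect \<Rightarrow> ('b \<times> 'p) vect" where
  "apply_to A' g as = linext (\<lambda>(b, n). lmul A' b (g n as))"

lemma apply_to_simps [simp]:
  "apply_to A' g as 0 = 0"
  "apply_to A' g as (u + v) = apply_to A' g as u + apply_to A' g as v"
  "apply_to A' g as (b \<otimes> n) = lmul A' b (g n as)"
  by (simp_all add: apply_to_def)

text \<open>The sum in \<^const>\<open>mor_comp\<close>, over the splittings of \<open>pre @ as\<close> at or after the end of \<open>pre\<close>\<close>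

fun comp_from :: "('l, 'b) dgcat \<Rightarrow> ('n \<Rightarrow> 'a list \<Rightarrow> ('b \<times> 'p) vect) \<Rightarrow>
    ('m \<Rightarrow> 'a list \<Rightarrow> ('b \<times> 'n) vect) \<Rightarrow> 'm \<Rightarrow> 'a list \<Rightarrow> 'a list \<Rightarrow> ('b \<times> 'p) vect" where
  "comp_from A' g f m pre [] = apply_to A' g [] (f m pre)"
| "comp_from A' g f m pre (a # as) =
     apply_to A' g (a # as) (f m pre) + comp_from A' g f m (pre @ [a]) as"

lemma mor_comp_eq_sum:
  "mor_comp A' g f m as = (\<Sum>j\<le>length as. apply_to A' g (drop j as) (f m (take j as)))"
  by (simp add: mor_comp_def apply_to_def lmul_def)

lemma comp_from_eq_sum:
  "comp_from A' g f m pre as =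
    (\<Sum>j\<le>length as. apply_to A' g (drop j as) (f m (pre @ take j as)))"
proof (induction as arbitrary: pre)
  case (Cons a as)
  show ?case
    by (simp add: Cons sum.atMost_Suc_shift del: sum.atMost_Suc)
qed simp

lemma mor_comp_eq: "mor_comp A' g f m as = comp_from A' g f m [] as"
  by (simp add: mor_comp_eq_sum comp_from_eq_sum)

text \<open>The sum in \<^const>\<open>pre_mult\<close>, over the products of two neighbours in \<open>as\<close>\<close>

fun mult_from :: "('r, 'a) dgcat \<Rightarrow> ('m \<Rightarrow> 'a list \<Rightarrow> 'x vect) \<Rightarrow> 'm \<Rightarrow> 'a list \<Rightarrow> 'a list \<Rightarrow> 'x vect" where
  "mult_from A f m pre (a # b # as) =
     linext (\<lambda>c. f m (pre @ c # as)) (mult A a b) + mult_from A f m (pre @ [a]) (b # as)"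
| "mult_from A f m pre as = 0"

lemma mult_from_eq_sum:
  "mult_from A f m pre as = (\<Sum>j<length as - 1.
     linext (\<lambda>c. f m (pre @ take j as @ c # drop (j + 2) as)) (mult A (as ! j) (as ! Suc j)))"
proof (induction A f m pre as rule: mult_from.induct)
  case (1 A f m pre a b as)
  show ?case
    by (simp add: 1 sum.lessThan_Suc_shift del: sum.lessThan_Suc)
qed auto

lemma pre_mult_eq: "pre_mult A f m as = mult_from A f m [] as"
  by (simp add: pre_mult_def mult_from_eq_sum)

text \<open>The family \<open>f\<close> vanishes on more than \<open>p\<close> inputs.\<close>

definition max_inputs :: "nat \<Rightarrow> ('m \<Rightarrow> 'a list \<Rightarrow> 'x vect) \<Rightarrow> bool"
  where "max_inputs p f \<longleftrightarrow> (\<forall>m as. length as > p \<longrightarrow> f m as = 0)"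

lemma max_inputsD: "max_inputs p f \<Longrightarrow> length as > p \<Longrightarrow> f m as = 0"
  by (simp add: max_inputs_def)

lemma mor_comp_vanish:
  assumes "max_inputs p f" and "max_inputs q g" and "length as > p + q"
  shows "mor_comp A' g f m as = 0"
  unfolding mor_comp_eq_sum
proof (rule sum.neutral, intro ballI)
  fix j
  show "apply_to A' g (drop j as) (f m (take j as)) = 0"
  proof (cases "j > p")
    case True
    then show ?thesis
      using assms by (simp add: max_inputsD)
  next
    case False
    then have "g n (drop j as) = 0" for n
      using assms by (simp add: max_inputsD)
    then show ?thesis
      by (simp add: apply_to_def case_prod_unfold)
  qed
qed

lemma pre_mult_vanish:
  assumes "max_inputs p f" and "length as > Suc p"
  shows "pre_mult A f m as = 0"
  unfolding pre_mult_def
  by (rule sum.neutral)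
    (use assms in \<open>auto simp: linext_def intro!: sum.neutral max_inputsD[OF assms(1)]\<close>)

section \<open>Evaluating box products\<close>

text \<open>
  \<open>box_from M N j m bs n as\<close> collects the contributions to \<open>ops (M \<boxtimes> N) (m, n)\<close> in which the inputs
  \<open>bs\<close> have already been passed on to \<open>M\<close>, and \<open>j\<close> further operations of \<open>N\<close> have to consume \<open>as\<close>;
  in \<open>box_split\<close> the next operation of \<open>N\<close> consumes \<open>pre\<close> and an initial segment of \<open>as\<close>.
\<close>

fun box_from :: "('k, 'l, 'c, 'b, 'm) da \<Rightarrow> ('l, 'r, 'b, 'a, 'n) da \<Rightarrow> nat \<Rightarrow> 'm \<Rightarrow> 'b list \<Rightarrow>
    'n \<Rightarrow> 'a list \<Rightarrow> ('c \<times> ('m \<times> 'n)) vect" where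
  "box_from M N 0 m bs n as =
     (if as = [] then linext (\<lambda>(c, m'). c \<otimes> (m', n)) (ops M m bs) else 0)"
| "box_from M N (Suc j) m bs n as = (\<Sum>i\<le>length as.
     linext (\<lambda>(b, n'). box_from M N j m (bs @ [b]) n' (drop i as)) (ops N n (take i as)))"

fun box_split :: "('k, 'l, 'c, 'b, 'm) da \<Rightarrow> ('l, 'r, 'b, 'a, 'n) da \<Rightarrow> nat \<Rightarrow> 'm \<Rightarrow> 'b list \<Rightarrow>
    'n \<Rightarrow> 'a list \<Rightarrow> 'a list \<Rightarrow> ('c \<times> ('m \<times> 'n)) vect" where
  "box_split M N j m bs n pre [] =
     linext (\<lambda>(b, n'). box_from M N j m (bs @ [b]) n' []) (ops N n pre)"
| "box_split M N j m bs n pre (a # as) =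
     linext (\<lambda>(b, n'). box_from M N j m (bs @ [b]) n' (a # as)) (ops N n pre)
       + box_split M N j m bs n (pre @ [a]) as"

lemma box_split_eq_sum:
  "box_split M N j m bs n pre as = (\<Sum>i\<le>length as.
     linext (\<lambda>(b, n'). box_from M N j m (bs @ [b]) n' (drop i as)) (ops N n (pre @ take i as)))"
proof (induction as arbitrary: pre)
  case (Cons a as)
  show ?case
    by (simp add: Cons sum.atMost_Suc_shift del: sum.atMost_Suc)
qed simp

lemma box_from_Suc: "box_from M N (Suc j) m bs n as = box_split M N j m bs n [] as"
  by (simp add: box_split_eq_sum)

lemma linext_sum: "linext T (\<Sum>i\<in>I. v i) = (\<Sum>i\<in>I. linext T (v i))"
  by (induction I rule: infinite_finite_induct) auto

lemma box_from_eq: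
  "box_from M N j m bs n as =
    linext (\<lambda>(bs', n'). linext (\<lambda>(c, m'). c \<otimes> (m', n')) (ops M m (bs @ bs'))) (op_iter N j n as)"
proof (induction j arbitrary: bs n as)
  case (Suc j)
  show ?case
    by (simp add: linext_sum linext_linext Suc case_prod_unfold)
qed simp

lemma length_op_iter:
  "supported (\<lambda>(bs, n'). length bs = j) (op_iter N j n as)"
proof (induction j arbitrary: n as)
  case (Suc j)
  have "supported (\<lambda>(bs, n'). length bs = Suc j)
      (linext (\<lambda>(b, n'). linext (\<lambda>(bs, n''). (b # bs) \<otimes> n'') (op_iter N j n' as')) v)" for v as'
    by (rule supported_linext[where Q = "\<lambda>_. True"])
      (auto simp: supported_def[of "\<lambda>_. True"] intro!: supported_linext[OF Suc])
  then show ?case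
    by (simp add: supported_sum)
qed simp

text \<open>The operations of a box product, if those of the left factor have at most \<open>p\<close> inputs\<close>

lemma ops_box_product:
  assumes "max_inputs p (ops M)"
  shows "ops (M \<boxtimes> N) (m, n) as = (\<Sum>j\<le>p. box_from M N j m [] n as)"
proof -
  have *: "box_from M N j m [] n as = 0" if "j > p" for j
  proof -
    have "length bs = j" if "(bs, n') \<in> Poly_Mapping.keys (op_iter N j n as)" for bs n'
      using that length_op_iter[of j N n as] by (auto simp: supported_def)
    then show ?thesis
      using \<open>j > p\<close> max_inputsD[OF assms]
      by (auto simp: box_from_eq linext_def[of _ "op_iter N j n as"] intro!: sum.neutral)
  qed
  have "ops (M \<boxtimes> N) (m, n) as = Sum_any (\<lambda>j. box_from M N j m [] n as)"
    by (simp add: box_product_def box_from_eq)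
  also have "\<dots> = (\<Sum>j\<le>p. box_from M N j m [] n as)"
    by (rule Sum_any.expand_superset) (use * not_le_imp_less in auto)
  finally show ?thesis .
qed

section \<open>Reduction of the axioms to finitely many input shapes\<close>

lemma composable_append:
  "composable A S (xs @ ys) \<longleftrightarrow> composable A S xs \<and> composable A (end_ob A S xs) ys"
  by (induction xs arbitrary: S) auto

lemma end_ob_append: "end_ob A S (xs @ ys) = end_ob A (end_ob A S xs) ys"
  by (induction xs arbitrary: S) auto

lemma apply_to_cong:
  assumes "\<And>b n. (b, n) \<in> Poly_Mapping.keys v \<Longrightarrow> g n as = g' n as'"
  shows "apply_to A' g as v = apply_to A' g' as' v"
  unfolding apply_to_def linext_def by (rule sum.cong) (use assms in auto)

lemma apply_to_unit:
  assumes "dg_category A'" and "\<And>b n. (b, n) \<in> Poly_Mapping.keys v \<Longrightarrow> g n as = idn A' (rob A' b) \<otimes> n"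
  shows "apply_to A' g as v = v"
proof -
  have "lmul A' b (g n as) = b \<otimes> n" if "(b, n) \<in> Poly_Mapping.keys v" for b n
    using assms that by (simp add: dg_category_def)
  then have "apply_to A' g as v = linext gen v"
    unfolding apply_to_def linext_def by (intro sum.cong) auto
  then show ?thesis by simp
qed

lemma sum_delta_plus:
  fixes X Y :: "'x vect"
  shows "finite I \<Longrightarrow> (\<Sum>j\<in>I. (if j = a \<and> P then X else 0) + (if j = b \<and> Q then Y else 0))
    = (if a \<in> I \<and> P then X else 0) + (if b \<in> I \<and> Q then Y else 0)"
  by (cases P; cases Q) (simp_all add: sum.distrib)

text \<open>
  Let the inputs be \<open>pre, e, post\<close> with an identity \<open>e\<close>. By strict unitality, all terms of the structure
  relation vanish in which \<open>e\<close> is one of several inputs of an operation. The other terms arise from the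
  two products of \<open>e\<close> with a neighbour and, if \<open>pre\<close> or \<open>post\<close> is empty, from an operation with \<open>e\<close> as
  its only input. Each of them equals \<open>\<delta>(m; pre, post)\<close>, and there are exactly two.
\<close>

lemma relation_with_identity:
  assumes "dg_category A'" "dg_category A"
    and deg: "maps_of_bidegree A' A M M (inputs A M) 0 1 (ops M)"
    and unit: "\<And>m. m \<in> gens M \<Longrightarrow> ops M m [idn A (rgt M m)] = idn A' (lft M m) \<otimes> m"
    and strict: "\<And>m as. (m, as) \<in> inputs A M \<Longrightarrow> length as \<ge> 2 \<Longrightarrow> set as \<inter> identities A \<noteq> {}
      \<Longrightarrow> ops M m as = 0"
    and as: "(m, as) \<in> inputs A M" "set as \<inter> identities A \<noteq> {}"
  shows "mor_comp A' (ops M) (ops M) m as + pre_mult A (ops M) m as = 0"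
proof -
  have unit_A: "mult A (idn A (lob A a)) a = gen a" "mult A a (idn A (rob A a)) = gen a" for a
    using assms(2) by (auto simp: dg_category_def)
  obtain pre e post where e: "as = pre @ e # post" "e \<in> identities A"
    using as(2) by (auto dest!: split_list)
  let ?T = "end_ob A (rgt M m) pre" and ?X = "ops M m (pre @ post)"
  have m: "m \<in> gens M" and comp: "composable A (rgt M m) pre" "composable A ?T (e # post)"
    using as(1) by (auto simp: inputs_def e composable_append)
  have id_ob: "lob A (idn A S) = S" "rob A (idn A S) = S" for S
    using assms(2) by (auto simp: dg_category_def)
  have eT: "e = idn A ?T" "rob A e = ?T"
    using e(2) comp(2) id_ob by (auto simp: identities_def)
  have in_pre: "(m, pre) \<in> inputs A M"
    using m comp by (simp add: inputs_def)
  have out: "n \<in> gens M \<and> lft M n = rob A' b \<and> rgt M n = end_ob A (rgt M m) xs"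
    if "(b, n) \<in> Poly_Mapping.keys (ops M m xs)" "(m, xs) \<in> inputs A M" for b n xs
    using deg that by (fastforce simp: maps_of_bidegree_def)
  have "apply_to A' (ops M) (drop j as) (ops M m (take j as)) =
      (if j = length pre \<and> post = [] then ?X else 0) + (if j = 1 \<and> pre = [] then ?X else 0)"
    if j: "j \<le> length as" for j
  proof (cases "j \<le> length pre")
    case True
    have in_j: "(m, take j as) \<in> inputs A M" and comp_j: "composable A (end_ob A (rgt M m) (take j as)) (drop j as)"
      using as(1) composable_append[of A "rgt M m" "take j as" "drop j as"] by (auto simp: inputs_def)
    show ?thesis
    proof (cases "j = length pre \<and> post = []")
      case True
      have "apply_to A' (ops M) [e] (ops M m pre) = ops M m pre"
        by (rule apply_to_unit[OF assms(1)]) (use out[OF _ in_pre] unit eT in \<open>metis\<close>)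
      then show ?thesis using True by (auto simp: e)
    next
      case False
      then have "length (drop j as) \<ge> 2" and "e \<in> set (drop j as)"
        using \<open>j \<le> length pre\<close> by (cases post; auto simp: e)+
      then have "ops M n (drop j as) = 0" if "(b, n) \<in> Poly_Mapping.keys (ops M m (take j as))" for b n
        using out[OF that in_j] comp_j e(2) by (intro strict) (auto simp: inputs_def)
      then have "apply_to A' (ops M) (drop j as) (ops M m (take j as)) =
          apply_to A' (\<lambda>_ _. 0) [] (ops M m (take j as))"
        by (rule apply_to_cong)
      then show ?thesis
        using False \<open>j \<le> length pre\<close> by (auto simp: apply_to_def case_prod_unfold)
    qed
  next
    case False
    have in_j: "(m, take j as) \<in> inputs A M"
      using as(1) composable_append[of A "rgt M m" "take j as" "drop j as"] by (auto simp: inputs_def)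
    show ?thesis
    proof (cases "pre = [] \<and> j = 1")
      case True
      then have "ops M m (take j as) = idn A' (lft M m) \<otimes> m"
        using unit[OF m] eT by (simp add: e)
      moreover have "lmul A' (idn A' (lft M m)) ?X = ?X"
      proof -
        have "linext (\<lambda>(b', p). linext (\<lambda>c. c \<otimes> p) (mult A' (idn A' (lft M m)) b')) ?X = linext gen ?X"
          unfolding linext_def[of _ ?X]
        proof (rule sum.cong, goal_cases)
          case (2 x)
          have "(m, post) \<in> inputs A M"
            using True comp eT m by (simp add: inputs_def)
          then have "lob A' (fst x) = lft M m"
            using deg 2 True by (fastforce simp: maps_of_bidegree_def)
          then have "mult A' (idn A' (lft M m)) (fst x) = gen (fst x)"
            using assms(1) by (metis dg_category_def)
          then show ?case
            by (simp add: case_prod_unfold)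
        qed simp
        then show ?thesis by (simp add: lmul_def)
      qed
      ultimately show ?thesis
        using True by (simp add: e)
    next
      case F: False
      have "e \<in> set (take j as)" "length (take j as) \<ge> 2"
        using False F j by (cases pre; auto simp: e take_Cons')+
      then have "ops M m (take j as) = 0"
        using in_j e(2) by (intro strict) auto
      then show ?thesis
        using F False by auto
    qed
  qed
  then have "mor_comp A' (ops M) (ops M) m as =
      (\<Sum>j\<le>length as. (if j = length pre \<and> post = [] then ?X else 0) + (if j = 1 \<and> pre = [] then ?X else 0))"
    unfolding mor_comp_eq_sum by (intro sum.cong) auto
  also have "\<dots> = (if post = [] then ?X else 0) + (if pre = [] then ?X else 0)"
    by (subst sum_delta_plus) (auto simp: e)
  finally have 1: "mor_comp A' (ops M) (ops M) m as = \<dots>" .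
  have "linext (\<lambda>c. ops M m (take j as @ c # drop (j + 2) as)) (mult A (as ! j) (as ! Suc j)) =
      (if Suc j = length pre \<and> True then ?X else 0) + (if j = length pre \<and> True then ?X else 0)"
    if j: "j < length as - 1" for j
  proof -
    consider "Suc j = length pre" | "j = length pre" | "Suc j \<noteq> length pre" "j \<noteq> length pre"
      by blast
    then show ?thesis
    proof cases
      case 1
      then obtain xs a where pre: "pre = xs @ [a]" "length xs = j"
        by (metis length_Suc_conv_rev)
      have "mult A a e = gen a"
        using unit_A(2)[of a] eT by (simp add: pre end_ob_append)
      then show ?thesis
        using pre by (simp add: e nth_append)
    next
      case 2
      then obtain a ys where post: "post = a # ys"
        using j by (cases post) (auto simp: e)
      have "mult A e a = gen a"
        using unit_A(1)[of a] comp(2) eT by (simp add: post)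
      then show ?thesis
        using 2 by (simp add: e post nth_append)
    next
      case 3
      have "ops M m (take j as @ c # drop (j + 2) as) = 0"
        if "c \<in> Poly_Mapping.keys (mult A (as ! j) (as ! Suc j))" for c
      proof (rule strict)
        have 4: "as = take j as @ as ! j # as ! Suc j # drop (j + 2) as"
          using j id_take_nth_drop[of j as] Cons_nth_drop_Suc[of "Suc j" as] by simp
        have 5: "rob A (as ! j) = lob A (as ! Suc j)" "lob A c = lob A (as ! j)" "rob A c = rob A (as ! Suc j)"
          using assms(2) that by (auto simp: dg_category_def)
        show "(m, take j as @ c # drop (j + 2) as) \<in> inputs A M"
          using as(1) 5 by (subst (asm) 4) (auto simp: inputs_def composable_append)
        have "Suc j < length pre \<or> j > length pre"
          using 3 by linarith
        then have "e \<in> set (take j as @ drop (j + 2) as)"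
          by (auto simp: e take_Cons')
        then show "set (take j as @ c # drop (j + 2) as) \<inter> identities A \<noteq> {}"
          using e(2) by auto
        show "2 \<le> length (take j as @ c # drop (j + 2) as)"
          using j 3 by (auto simp: e)
      qed
      then show ?thesis
        using 3 by (auto simp: linext_def intro!: sum.neutral)
    qed
  qed
  then have "pre_mult A (ops M) m as = (\<Sum>j<length as - 1.
      (if Suc j = length pre \<and> True then ?X else 0) + (if j = length pre \<and> True then ?X else 0))"
    unfolding pre_mult_def by (intro sum.cong) auto
  also have "\<dots> = (\<Sum>j<length as - 1. (if j = length pre - 1 \<and> pre \<noteq> [] then ?X else 0) +
      (if j = length pre \<and> True then ?X else 0))"
    by (intro sum.cong refl arg_cong2[where f = "(+)"]) (auto simp: Suc_diff_Suc)
  also have "\<dots> = (if pre \<noteq> [] then ?X else 0) + (if post \<noteq> [] then ?X else 0)"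
    by (subst sum_delta_plus) (cases pre; auto simp: e)+
  finally show ?thesis
    unfolding 1 by auto
qed

text \<open>
  Two forms of "for all composable inputs" that can be unfolded letter by letter once the objects and
  the basis of \<open>A\<close> are known: \<open>all_inputs\<close> bounds the number of inputs by \<open>n\<close> and excludes identities;
  in \<open>all_composable\<close>, \<open>n\<close> has no meaning and only counts how many letters remain to be unfolded.
\<close>

definition all_inputs :: "('o, 'a) dgcat \<Rightarrow> 'o \<Rightarrow> nat \<Rightarrow> ('a list \<Rightarrow> bool) \<Rightarrow> bool" where
  "all_inputs A S n Q \<longleftrightarrow>
     (\<forall>as. length as \<le> n \<and> composable A S as \<and> set as \<inter> identities A = {} \<longrightarrow> Q as)"

definition all_composable :: "('o, 'a) dgcat \<Rightarrow> 'o \<Rightarrow> nat \<Rightarrow> ('a list \<Rightarrow> bool) \<Rightarrow> bool" where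
  "all_composable A S n Q \<longleftrightarrow> (\<forall>as. composable A S as \<longrightarrow> Q as)"

lemma all_inputs_0 [simp]: "all_inputs A S 0 Q \<longleftrightarrow> Q []"
  by (auto simp: all_inputs_def)

lemma all_inputs_Suc:
  "all_inputs A S (Suc n) Q \<longleftrightarrow>
    Q [] \<and> (\<forall>a. lob A a = S \<and> a \<notin> identities A \<longrightarrow> all_inputs A (rob A a) n (\<lambda>as. Q (a # as)))"
proof
  assume *: "all_inputs A S (Suc n) Q"
  show "Q [] \<and> (\<forall>a. lob A a = S \<and> a \<notin> identities A \<longrightarrow> all_inputs A (rob A a) n (\<lambda>as. Q (a # as)))"
    using * unfolding all_inputs_def by auto
next
  assume *: "Q [] \<and> (\<forall>a. lob A a = S \<and> a \<notin> identities A \<longrightarrow> all_inputs A (rob A a) n (\<lambda>as. Q (a # as)))"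
  show "all_inputs A S (Suc n) Q"
    unfolding all_inputs_def
  proof (intro allI impI)
    fix as assume as: "length as \<le> Suc n \<and> composable A S as \<and> set as \<inter> identities A = {}"
    then show "Q as"
      using * by (cases as) (auto simp: all_inputs_def)
  qed
qed

lemma all_composable_Suc:
  "all_composable A S (Suc n) Q \<longleftrightarrow>
    Q [] \<and> (\<forall>a. lob A a = S \<longrightarrow> all_composable A (rob A a) n (\<lambda>as. Q (a # as)))"
proof
  assume *: "all_composable A S (Suc n) Q"
  show "Q [] \<and> (\<forall>a. lob A a = S \<longrightarrow> all_composable A (rob A a) n (\<lambda>as. Q (a # as)))"
    using * unfolding all_composable_def by auto
next
  assume *: "Q [] \<and> (\<forall>a. lob A a = S \<longrightarrow> all_composable A (rob A a) n (\<lambda>as. Q (a # as)))"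
  show "all_composable A S (Suc n) Q"
    unfolding all_composable_def
  proof (intro allI impI)
    fix as assume "composable A S as"
    then show "Q as"
      using * by (cases as) (auto simp: all_composable_def)
  qed
qed

lemma all_composable_0: "all_composable A S 0 Q \<longleftrightarrow> (\<forall>as. composable A S as \<longrightarrow> Q as)"
  by (simp add: all_composable_def)

lemma all_composableD: "all_composable A S n Q \<Longrightarrow> composable A S as \<Longrightarrow> Q as"
  by (simp add: all_composable_def)

lemma all_inputsD:
  "all_inputs A (rgt M m) n Q \<Longrightarrow> (m, as) \<in> aug_inputs A M \<Longrightarrow> length as \<le> n \<Longrightarrow> Q as"
  by (simp add: all_inputs_def aug_inputs_def inputs_def)

text \<open>
  The condition in \<^const>\<open>maps_of_bidegree\<close> on a single value \<open>v = f(m; as)\<close>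
\<close>

definition homogeneous :: "('l, 'b) dgcat \<Rightarrow> ('r, 'a) dgcat \<Rightarrow> ('l, 'r, 'b, 'a, 'm) da \<Rightarrow>
    ('l, 'r, 'b, 'a, 'n) da \<Rightarrow> int \<Rightarrow> int \<Rightarrow> 'm \<Rightarrow> 'a list \<Rightarrow> ('b \<times> 'n) vect \<Rightarrow> bool" where
  "homogeneous A' A M N i j m as = supported (\<lambda>(b, n).
      n \<in> gens N \<and> lob A' b = lft M m \<and> rob A' b = lft N n \<and> rgt N n = end_ob A (rgt M m) as \<and>
      qdeg A' b + qgr N n = qgr M m + (\<Sum>a\<leftarrow>as. qdeg A a) + i \<and>
      hdeg A' b + hgr N n = hgr M m + (\<Sum>a\<leftarrow>as. hdeg A a - 1) + j)"

lemma homogeneous_simps [simp]: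
  "homogeneous A' A M N i j m as 0"
  "homogeneous A' A M N i j m as u \<Longrightarrow> homogeneous A' A M N i j m as v
    \<Longrightarrow> homogeneous A' A M N i j m as (u + v)"
  "homogeneous A' A M N i j m as (b \<otimes> n) \<longleftrightarrow>
      n \<in> gens N \<and> lob A' b = lft M m \<and> rob A' b = lft N n \<and> rgt N n = end_ob A (rgt M m) as \<and>
      qdeg A' b + qgr N n = qgr M m + (\<Sum>a\<leftarrow>as. qdeg A a) + i \<and>
      hdeg A' b + hgr N n = hgr M m + (\<Sum>a\<leftarrow>as. hdeg A a - 1) + j"
  by (simp_all add: homogeneous_def)

lemma maps_of_bidegree_iff:
  "maps_of_bidegree A' A M N D i j f \<longleftrightarrow> (\<forall>(m, as)\<in>D. homogeneous A' A M N i j m as (f m as))"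
  by (simp add: maps_of_bidegree_def homogeneous_def supported_def)

definition homogeneous_up_to :: "('l, 'b) dgcat \<Rightarrow> ('r, 'a) dgcat \<Rightarrow> ('l, 'r, 'b, 'a, 'm) da \<Rightarrow>
    ('l, 'r, 'b, 'a, 'n) da \<Rightarrow> int \<Rightarrow> int \<Rightarrow> nat \<Rightarrow> ('m \<Rightarrow> 'a list \<Rightarrow> ('b \<times> 'n) vect) \<Rightarrow> bool" where
  "homogeneous_up_to A' A M N i j r f \<longleftrightarrow>
     (\<forall>m\<in>gens M. all_inputs A (rgt M m) r (\<lambda>as. homogeneous A' A M N i j m as (f m as)))"

text \<open>
  The structure relation of \<open>M\<close>, the equation \<open>d(f) = 0\<close>, and the equation \<open>g f + id = d(h)\<close>, for at
  most \<open>r\<close> inputs, if both algebras have zero differential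
\<close>

definition relation_up_to :: "('l, 'b) dgcat \<Rightarrow> ('r, 'a) dgcat \<Rightarrow> ('l, 'r, 'b, 'a, 'm) da \<Rightarrow> nat \<Rightarrow> bool" where
  "relation_up_to A' A M r \<longleftrightarrow> (\<forall>m\<in>gens M. all_inputs A (rgt M m) r
     (\<lambda>as. comp_from A' (ops M) (ops M) m [] as + mult_from A (ops M) m [] as = 0))"

definition closed_up_to :: "('l, 'b) dgcat \<Rightarrow> ('r, 'a) dgcat \<Rightarrow> ('l, 'r, 'b, 'a, 'm) da \<Rightarrow>
    ('l, 'r, 'b, 'a, 'n) da \<Rightarrow> nat \<Rightarrow> ('m \<Rightarrow> 'a list \<Rightarrow> ('b \<times> 'n) vect) \<Rightarrow> bool" where
  "closed_up_to A' A M N r f \<longleftrightarrow> (\<forall>m\<in>gens M. all_inputs A (rgt M m) r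
     (\<lambda>as. comp_from A' (ops N) f m [] as + comp_from A' f (ops M) m [] as + mult_from A f m [] as = 0))"

definition homotopy_up_to :: "('l, 'b) dgcat \<Rightarrow> ('r, 'a) dgcat \<Rightarrow> ('l, 'r, 'b, 'a, 'm) da \<Rightarrow> nat \<Rightarrow>
    ('n \<Rightarrow> 'a list \<Rightarrow> ('b \<times> 'm) vect) \<Rightarrow> ('m \<Rightarrow> 'a list \<Rightarrow> ('b \<times> 'n) vect) \<Rightarrow>
    ('m \<Rightarrow> 'a list \<Rightarrow> ('b \<times> 'm) vect) \<Rightarrow> bool" where
  "homotopy_up_to A' A M r g f h \<longleftrightarrow> (\<forall>m\<in>gens M. all_inputs A (rgt M m) r
     (\<lambda>as. comp_from A' g f m [] as + mor_id A' M m as + comp_from A' (ops M) h m [] as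
       + comp_from A' h (ops M) m [] as + mult_from A h m [] as = 0))"

text \<open>
  The conditions in \<^const>\<open>DA_bimodule\<close> on inputs that contain an identity
\<close>

definition strictly_unital :: "('l, 'b) dgcat \<Rightarrow> ('r, 'a) dgcat \<Rightarrow> ('l, 'r, 'b, 'a, 'm) da \<Rightarrow> bool" where
  "strictly_unital A' A M \<longleftrightarrow>
     (\<forall>m\<in>gens M. ops M m [idn A (rgt M m)] = idn A' (lft M m) \<otimes> m) \<and>
     (\<forall>m\<in>gens M. all_composable A (rgt M m) 4
       (\<lambda>as. length as \<ge> 2 \<longrightarrow> set as \<inter> identities A \<noteq> {} \<longrightarrow> ops M m as = 0))"

lemma morphismI:
  assumes "max_inputs p f" and "homogeneous_up_to A' A M N i j p f"
  shows "morphism A' A M N i j f"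
  unfolding morphism_def maps_of_bidegree_iff
proof clarify
  fix m as assume as: "(m, as) \<in> aug_inputs A M"
  then have "all_inputs A (rgt M m) p (\<lambda>as. homogeneous A' A M N i j m as (f m as))"
    using assms(2) by (simp add: homogeneous_up_to_def aug_inputs_def inputs_def)
  then show "homogeneous A' A M N i j m as (f m as)"
    using all_inputsD[OF _ as] max_inputsD[OF assms(1), of as m] by (cases "length as \<le> p") auto
qed

lemma mor_diff_vanish:
  assumes "bd A' = (\<lambda>_. 0)" "bd A = (\<lambda>_. 0)"
    and "max_inputs p f" "max_inputs q (ops M)" "max_inputs q' (ops N)"
    and "p + q \<le> r" "p + q' \<le> r" "p < r" "length as > r"
  shows "mor_diff A' A M N f m as = 0"
proof -
  have "mor_comp A' (ops N) f m as = 0"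
    by (rule mor_comp_vanish[of p f q']) (use assms in auto)
  moreover have "mor_comp A' f (ops M) m as = 0"
    by (rule mor_comp_vanish[of q _ p f]) (use assms in auto)
  moreover have "pre_mult A f m as = 0"
    by (rule pre_mult_vanish[of p]) (use assms in auto)
  ultimately show ?thesis
    by (simp add: mor_diff_def pre_bd_def post_bd_def assms)
qed

lemma mor_diff_eq:
  assumes "bd A' = (\<lambda>_. 0)" "bd A = (\<lambda>_. 0)"
  shows "mor_diff A' A M N f m as =
    comp_from A' (ops N) f m [] as + comp_from A' f (ops M) m [] as + mult_from A f m [] as"
  by (simp add: mor_diff_def pre_bd_def post_bd_def assms mor_comp_eq pre_mult_eq)

lemma closed_morphismI:
  assumes bd: "bd A' = (\<lambda>_. 0)" "bd A = (\<lambda>_. 0)"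
    and bounds: "max_inputs p f" "max_inputs q (ops M)" "max_inputs q' (ops N)"
      "p + q \<le> r" "p + q' \<le> r" "p < r"
    and "homogeneous_up_to A' A M N i j p f" and closed: "closed_up_to A' A M N r f"
  shows "closed_morphism A' A M N i j f"
  unfolding closed_morphism_def
proof (intro conjI)
  show "morphism A' A M N i j f"
    using assms by (intro morphismI) auto
  show "\<forall>(m, as)\<in>aug_inputs A M. mor_diff A' A M N f m as = 0"
  proof clarify
    fix m as assume as: "(m, as) \<in> aug_inputs A M"
    then have "all_inputs A (rgt M m) r (\<lambda>as. mor_diff A' A M N f m as = 0)"
      using closed by (simp add: closed_up_to_def aug_inputs_def inputs_def mor_diff_eq bd)
    then show "mor_diff A' A M N f m as = 0"
      using all_inputsD[OF _ as] mor_diff_vanish[OF bd bounds] by (cases "length as \<le> r") auto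
  qed
qed

lemma homotopicI:
  assumes bd: "bd A' = (\<lambda>_. 0)" "bd A = (\<lambda>_. 0)"
    and "max_inputs s f" "max_inputs t g" "s + t \<le> r"
    and bounds: "max_inputs p h" "max_inputs q (ops M)" "p + q \<le> r" "p < r"
    and "homogeneous_up_to A' A M M 0 (-1) p h" and homotopy: "homotopy_up_to A' A M r g f h"
  shows "homotopic A' A M M (mor_comp A' g f) (mor_id A' M)"
  unfolding homotopic_def
proof (intro exI conjI)
  show "morphism A' A M M 0 (-1) h"
    using assms by (intro morphismI) auto
  show "\<forall>(m, as)\<in>aug_inputs A M. mor_comp A' g f m as + mor_id A' M m as = mor_diff A' A M M h m as"
  proof clarify
    fix m as assume as: "(m, as) \<in> aug_inputs A M"
    then have "all_inputs A (rgt M m) r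
        (\<lambda>as. mor_comp A' g f m as + mor_id A' M m as = mor_diff A' A M M h m as)"
      using homotopy by (subst vect_eq_iff_add)
        (simp add: homotopy_up_to_def aug_inputs_def inputs_def mor_diff_eq mor_comp_eq bd add.assoc)
    moreover have "mor_comp A' g f m as + mor_id A' M m as = mor_diff A' A M M h m as" if "length as > r"
    proof -
      have "mor_comp A' g f m as = 0"
        by (rule mor_comp_vanish[of s f t g]) (use assms that in auto)
      moreover have "mor_id A' M m as = 0"
        using that by (auto simp: mor_id_def)
      ultimately show ?thesis
        using mor_diff_vanish[OF bd bounds(1,2,2,3,3,4) that] by simp
    qed
    ultimately show "mor_comp A' g f m as + mor_id A' M m as = mor_diff A' A M M h m as"
      using all_inputsD[OF _ as] by (cases "length as \<le> r") auto
  qed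
qed

lemma DA_bimoduleI:
  assumes cat: "dg_category A'" "dg_category A"
    and bd: "bd A' = (\<lambda>_. 0)" "bd A = (\<lambda>_. 0)"
    and p: "max_inputs p (ops M)" "p > 0"
    and "strictly_unital A' A M"
    and deg: "homogeneous_up_to A' A M M 0 1 p (ops M)"
    and rel: "relation_up_to A' A M (p + p)"
  shows "DA_bimodule A' A M"
proof -
  have unit: "ops M m [idn A (rgt M m)] = idn A' (lft M m) \<otimes> m" if "m \<in> gens M" for m
    using assms(7) that by (simp add: strictly_unital_def)
  have strict: "ops M m as = 0" if "(m, as) \<in> inputs A M" "length as \<ge> 2" "set as \<inter> identities A \<noteq> {}" for m as
    using assms(7) that by (simp add: strictly_unital_def all_composable_def inputs_def)
  have id_ob: "lob A' (idn A' S) = S" "rob A' (idn A' S) = S"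
      "qdeg A' (idn A' S) = 0" "hdeg A' (idn A' S) = 0" for S
    using cat by (auto simp: dg_category_def)
  have id_ob': "lob A (idn A S) = S" "rob A (idn A S) = S"
      "qdeg A (idn A S) = 0" "hdeg A (idn A S) = 0" for S
    using cat by (auto simp: dg_category_def)
  have deg': "homogeneous A' A M M 0 1 m as (ops M m as)" if as: "(m, as) \<in> inputs A M" for m as
  proof -
    have m: "m \<in> gens M"
      using as by (simp add: inputs_def)
    consider "(m, as) \<in> aug_inputs A M" "length as \<le> p" | "length as > p"
      | "set as \<inter> identities A \<noteq> {}" "length as \<ge> 2" | "length as = 1" "set as \<inter> identities A \<noteq> {}"
    proof (cases "set as \<inter> identities A = {}")
      case True
      then show ?thesis
        using that(1,2) as by (cases "length as \<le> p") (auto simp: aug_inputs_def)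
    next
      case False
      then have "length as \<noteq> 0" by auto
      then show ?thesis
        using that(3,4) False by linarith
    qed
    then show ?thesis
    proof cases
      case 1
      then show ?thesis
        using all_inputsD[OF bspec[OF deg[unfolded homogeneous_up_to_def] m]] by blast
    next
      case 4
      then obtain S where "as = [idn A S]"
        by (cases as) (auto simp: identities_def)
      then have "as = [idn A (rgt M m)]"
        using as by (simp add: inputs_def id_ob')
      then show ?thesis
        using m by (simp add: unit id_ob id_ob')
    qed (use p(2) max_inputsD[OF p(1), of as m] strict[OF as] in auto)
  qed
  then have maps: "maps_of_bidegree A' A M M (inputs A M) 0 1 (ops M)"
    by (auto simp: maps_of_bidegree_iff)
  have "mor_comp A' (ops M) (ops M) m as + pre_mult A (ops M) m as = 0" if as: "(m, as) \<in> inputs A M" for m as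
  proof -
    have m: "m \<in> gens M"
      using as by (simp add: inputs_def)
    consider "(m, as) \<in> aug_inputs A M" "length as \<le> p + p" | "length as > p + p" | "set as \<inter> identities A \<noteq> {}"
      using as by (force simp: aug_inputs_def)
    then show ?thesis
    proof cases
      case 1
      then show ?thesis
        using all_inputsD[OF bspec[OF rel[unfolded relation_up_to_def] m]] by (simp add: mor_comp_eq pre_mult_eq)
    next
      case 2
      have "mor_comp A' (ops M) (ops M) m as = 0"
        by (rule mor_comp_vanish[where p = p and q = p]) (use p 2 in auto)
      moreover have "pre_mult A (ops M) m as = 0"
        by (rule pre_mult_vanish[where p = p]) (use p 2 in auto)
      ultimately show ?thesis by simp
    next
      case 3
      show ?thesis
        by (rule relation_with_identity[OF cat maps]) (use unit strict as 3 in auto)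
    qed
  qed
  moreover have "\<forall>(m, as)\<in>inputs A M. 2 \<le> length as \<and> set as \<inter> identities A \<noteq> {} \<longrightarrow> ops M m as = 0"
    using strict by blast
  ultimately show ?thesis
    using cat maps unit by (auto simp: DA_bimodule_def pre_bd_def post_bd_def bd)
qed

section \<open>The two algebras\<close>

lemma A11_simps [simp]:
  "lob A11 = alg_lob" "rob A11 = alg_rob" "idn A11 = alg_idn" "mult A11 = alg_mult"
  "bd A11 = (\<lambda>_. 0)" "qdeg A11 = alg_qdeg" "hdeg A11 = alg_hdeg"
  by (simp_all add: A11_def)

lemma Acan_simps [simp]:
  "lob Acan = can_lob" "rob Acan = can_rob" "idn Acan = can_idn" "mult Acan = can_mult"
  "bd Acan = (\<lambda>_. 0)" "qdeg Acan = (\<lambda>a. - can_hdeg a)" "hdeg Acan = can_hdeg"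
  by (simp_all add: Acan_def)

lemma identities_A11: "identities A11 = {E_uu, U_ou 0, U_uo 0, U_oo 0 0}"
proof -
  have "(UNIV :: ob set) = {Ob_uu, Ob_ou, Ob_uo, Ob_oo}"
    by (auto intro: ob.exhaust)
  then show ?thesis
    unfolding identities_def A11_simps by (metis (no_types, lifting) alg_idn.simps image_empty image_insert)
qed

lemma identities_Acan: "identities Acan = {C_none, C_A 0, C_B1 0, C_AB 0 0}"
proof -
  have "(UNIV :: cob set) = {Ob_none, Ob_A, Ob_B, Ob_AB}"
    by (auto intro: cob.exhaust)
  then show ?thesis
    unfolding identities_def Acan_simps by (metis (no_types, lifting) can_idn.simps image_empty image_insert)
qed

lemma dg_category_A11: "dg_category A11"
proof -
  have "Poly_Mapping.keys (alg_mult a b) \<subseteq> {c. alg_rob a = alg_lob b \<and> alg_lob c = alg_lob a \<and> alg_rob c = alg_rob b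
        \<and> alg_qdeg c = alg_qdeg a + alg_qdeg b \<and> alg_hdeg c = alg_hdeg a + alg_hdeg b \<and>
        (a \<notin> identities A11 \<or> b \<notin> identities A11 \<longrightarrow> c \<notin> identities A11)}" for a b
    by (cases a; cases b) (auto simp: identities_A11)
  moreover have "linext (\<lambda>x. alg_mult x c) (alg_mult a b) = linext (alg_mult a) (alg_mult b c)" for a b c
    by (cases a; cases b; cases c) (auto simp: add.assoc)
  moreover have "alg_mult (alg_idn (alg_lob a)) a = gen a \<and> alg_mult a (alg_idn (alg_rob a)) = gen a" for a
    by (cases a) auto
  moreover have "alg_lob (alg_idn S) = S \<and> alg_rob (alg_idn S) = S \<and> alg_qdeg (alg_idn S) = 0 \<and> alg_hdeg (alg_idn S) = 0" for S
    by (cases S) auto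
  ultimately show ?thesis
    unfolding dg_category_def by (simp add: subset_iff) blast
qed

lemma dg_category_Acan: "dg_category Acan"
proof -
  have "Poly_Mapping.keys (can_mult a b) \<subseteq> {c. can_rob a = can_lob b \<and> can_lob c = can_lob a \<and> can_rob c = can_rob b
        \<and> can_hdeg c = can_hdeg a + can_hdeg b \<and>
        (a \<notin> identities Acan \<or> b \<notin> identities Acan \<longrightarrow> c \<notin> identities Acan)}" for a b
    by (cases a; cases b) (auto simp: identities_Acan)
  moreover have "linext (\<lambda>x. can_mult x c) (can_mult a b) = linext (can_mult a) (can_mult b c)" for a b c
    by (cases a; cases b; cases c) (auto simp: add.assoc)
  moreover have "can_mult (can_idn (can_lob a)) a = gen a \<and> can_mult a (can_idn (can_rob a)) = gen a" for a
    by (cases a) auto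
  moreover have "can_lob (can_idn S) = S \<and> can_rob (can_idn S) = S \<and> can_hdeg (can_idn S) = 0" for S
    by (cases S) auto
  ultimately show ?thesis
    unfolding dg_category_def by (simp add: subset_iff) blast
qed

lemma all_inputs_A11 [simp]:
  "all_inputs A11 Ob_uu (Suc n) Q \<longleftrightarrow> Q []"
  "all_inputs A11 Ob_ou (Suc n) Q \<longleftrightarrow> Q [] \<and> (\<forall>k. all_inputs A11 Ob_ou n (\<lambda>as. Q (U_ou (Suc k) # as)))"
  "all_inputs A11 Ob_uo (Suc n) Q \<longleftrightarrow> Q [] \<and> (\<forall>k. all_inputs A11 Ob_uo n (\<lambda>as. Q (U_uo (Suc k) # as)))
     \<and> all_inputs A11 Ob_ou n (\<lambda>as. Q (Lam # as))"
  "all_inputs A11 Ob_oo (Suc n) Q \<longleftrightarrow>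
     Q [] \<and> (\<forall>k l. (k, l) \<noteq> (0, 0) \<longrightarrow> all_inputs A11 Ob_oo n (\<lambda>as. Q (U_oo k l # as)))"
proof -
  have a: "(\<forall>a. alg_lob a = S \<and> a \<notin> identities A11 \<longrightarrow> P a) \<longleftrightarrow> (case S of Ob_uu \<Rightarrow> True
    | Ob_ou \<Rightarrow> (\<forall>k. P (U_ou (Suc k))) | Ob_uo \<Rightarrow> (\<forall>k. P (U_uo (Suc k))) \<and> P Lam
    | Ob_oo \<Rightarrow> (\<forall>k l. (k, l) \<noteq> (0, 0) \<longrightarrow> P (U_oo k l)))" for P S
  proof (intro iffI)
    assume "case S of Ob_uu \<Rightarrow> True
      | Ob_ou \<Rightarrow> (\<forall>k. P (U_ou (Suc k))) | Ob_uo \<Rightarrow> (\<forall>k. P (U_uo (Suc k))) \<and> P Lam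
      | Ob_oo \<Rightarrow> (\<forall>k l. (k, l) \<noteq> (0, 0) \<longrightarrow> P (U_oo k l))"
    then show "\<forall>a. alg_lob a = S \<and> a \<notin> identities A11 \<longrightarrow> P a"
      by (intro allI impI, rename_tac a, case_tac a) (auto simp: identities_A11 gr0_conv_Suc)
  qed (cases S; auto simp: identities_A11)
  show "all_inputs A11 Ob_uu (Suc n) Q \<longleftrightarrow> Q []"
    "all_inputs A11 Ob_ou (Suc n) Q \<longleftrightarrow> Q [] \<and> (\<forall>k. all_inputs A11 Ob_ou n (\<lambda>as. Q (U_ou (Suc k) # as)))"
    "all_inputs A11 Ob_uo (Suc n) Q \<longleftrightarrow> Q [] \<and> (\<forall>k. all_inputs A11 Ob_uo n (\<lambda>as. Q (U_uo (Suc k) # as)))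
       \<and> all_inputs A11 Ob_ou n (\<lambda>as. Q (Lam # as))"
    "all_inputs A11 Ob_oo (Suc n) Q \<longleftrightarrow>
       Q [] \<and> (\<forall>k l. (k, l) \<noteq> (0, 0) \<longrightarrow> all_inputs A11 Ob_oo n (\<lambda>as. Q (U_oo k l # as)))"
    unfolding all_inputs_Suc A11_simps a by simp_all
qed

lemma all_inputs_Acan [simp]:
  "all_inputs Acan Ob_none (Suc n) Q \<longleftrightarrow> Q []"
  "all_inputs Acan Ob_A (Suc n) Q \<longleftrightarrow> Q [] \<and> (\<forall>k. all_inputs Acan Ob_A n (\<lambda>as. Q (C_A (Suc k) # as)))
     \<and> (\<forall>k. all_inputs Acan Ob_B n (\<lambda>as. Q (C_R k # as)))"
  "all_inputs Acan Ob_B (Suc n) Q \<longleftrightarrow> Q [] \<and> (\<forall>k. all_inputs Acan Ob_A n (\<lambda>as. Q (C_L k # as)))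
     \<and> (\<forall>k. all_inputs Acan Ob_B n (\<lambda>as. Q (C_B1 (Suc k) # as)))
     \<and> (\<forall>k. all_inputs Acan Ob_B n (\<lambda>as. Q (C_B2 k # as)))"
  "all_inputs Acan Ob_AB (Suc n) Q \<longleftrightarrow>
     Q [] \<and> (\<forall>k l. (k, l) \<noteq> (0, 0) \<longrightarrow> all_inputs Acan Ob_AB n (\<lambda>as. Q (C_AB k l # as)))"
proof -
  have a: "(\<forall>a. can_lob a = S \<and> a \<notin> identities Acan \<longrightarrow> P a) \<longleftrightarrow> (case S of Ob_none \<Rightarrow> True
    | Ob_A \<Rightarrow> (\<forall>k. P (C_A (Suc k))) \<and> (\<forall>k. P (C_R k))
    | Ob_B \<Rightarrow> (\<forall>k. P (C_L k)) \<and> (\<forall>k. P (C_B1 (Suc k))) \<and> (\<forall>k. P (C_B2 k))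
    | Ob_AB \<Rightarrow> (\<forall>k l. (k, l) \<noteq> (0, 0) \<longrightarrow> P (C_AB k l)))" for P S
  proof (intro iffI)
    assume "case S of Ob_none \<Rightarrow> True
    | Ob_A \<Rightarrow> (\<forall>k. P (C_A (Suc k))) \<and> (\<forall>k. P (C_R k))
    | Ob_B \<Rightarrow> (\<forall>k. P (C_L k)) \<and> (\<forall>k. P (C_B1 (Suc k))) \<and> (\<forall>k. P (C_B2 k))
    | Ob_AB \<Rightarrow> (\<forall>k l. (k, l) \<noteq> (0, 0) \<longrightarrow> P (C_AB k l))"
    then show "\<forall>a. can_lob a = S \<and> a \<notin> identities Acan \<longrightarrow> P a"
      by (intro allI impI, rename_tac a, case_tac a) (auto simp: identities_Acan gr0_conv_Suc)
  qed (cases S; auto simp: identities_Acan)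
  show "all_inputs Acan Ob_none (Suc n) Q \<longleftrightarrow> Q []"
  "all_inputs Acan Ob_A (Suc n) Q \<longleftrightarrow> Q [] \<and> (\<forall>k. all_inputs Acan Ob_A n (\<lambda>as. Q (C_A (Suc k) # as)))
     \<and> (\<forall>k. all_inputs Acan Ob_B n (\<lambda>as. Q (C_R k # as)))"
  "all_inputs Acan Ob_B (Suc n) Q \<longleftrightarrow> Q [] \<and> (\<forall>k. all_inputs Acan Ob_A n (\<lambda>as. Q (C_L k # as)))
     \<and> (\<forall>k. all_inputs Acan Ob_B n (\<lambda>as. Q (C_B1 (Suc k) # as)))
     \<and> (\<forall>k. all_inputs Acan Ob_B n (\<lambda>as. Q (C_B2 k # as)))"
  "all_inputs Acan Ob_AB (Suc n) Q \<longleftrightarrow>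
     Q [] \<and> (\<forall>k l. (k, l) \<noteq> (0, 0) \<longrightarrow> all_inputs Acan Ob_AB n (\<lambda>as. Q (C_AB k l # as)))"
    unfolding all_inputs_Suc Acan_simps a by simp_all
qed

lemma all_alg: "(\<forall>a. P a) \<longleftrightarrow> P E_uu \<and> P Lam \<and> (\<forall>k. P (U_ou k)) \<and> (\<forall>k. P (U_uo k)) \<and> (\<forall>k l. P (U_oo k l))"
  by (metis alg.exhaust)

lemma all_can: "(\<forall>a. P a) \<longleftrightarrow> P C_none \<and> (\<forall>k. P (C_A k)) \<and> (\<forall>k. P (C_R k)) \<and> (\<forall>k. P (C_L k))
    \<and> (\<forall>k. P (C_B1 k)) \<and> (\<forall>k. P (C_B2 k)) \<and> (\<forall>k l. P (C_AB k l))"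
  by (metis can.exhaust)

lemma all_composable_A11:
  "all_composable A11 Ob_uu (Suc n) Q \<longleftrightarrow> Q [] \<and> all_composable A11 Ob_uu n (\<lambda>as. Q (E_uu # as))"
  "all_composable A11 Ob_ou (Suc n) Q \<longleftrightarrow> Q [] \<and> (\<forall>k. all_composable A11 Ob_ou n (\<lambda>as. Q (U_ou k # as)))"
  "all_composable A11 Ob_uo (Suc n) Q \<longleftrightarrow> Q [] \<and> (\<forall>k. all_composable A11 Ob_uo n (\<lambda>as. Q (U_uo k # as)))
     \<and> all_composable A11 Ob_ou n (\<lambda>as. Q (Lam # as))"
  "all_composable A11 Ob_oo (Suc n) Q \<longleftrightarrow>
     Q [] \<and> (\<forall>k l. all_composable A11 Ob_oo n (\<lambda>as. Q (U_oo k l # as)))"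
  by (simp_all add: all_composable_Suc all_alg conj_commute)

lemma all_composable_Acan:
  "all_composable Acan Ob_none (Suc n) Q \<longleftrightarrow> Q [] \<and> all_composable Acan Ob_none n (\<lambda>as. Q (C_none # as))"
  "all_composable Acan Ob_A (Suc n) Q \<longleftrightarrow> Q [] \<and> (\<forall>k. all_composable Acan Ob_A n (\<lambda>as. Q (C_A k # as)))
     \<and> (\<forall>k. all_composable Acan Ob_B n (\<lambda>as. Q (C_R k # as)))"
  "all_composable Acan Ob_B (Suc n) Q \<longleftrightarrow> Q [] \<and> (\<forall>k. all_composable Acan Ob_A n (\<lambda>as. Q (C_L k # as)))
     \<and> (\<forall>k. all_composable Acan Ob_B n (\<lambda>as. Q (C_B1 k # as)))
     \<and> (\<forall>k. all_composable Acan Ob_B n (\<lambda>as. Q (C_B2 k # as)))"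
  "all_composable Acan Ob_AB (Suc n) Q \<longleftrightarrow>
     Q [] \<and> (\<forall>k l. all_composable Acan Ob_AB n (\<lambda>as. Q (C_AB k l # as)))"
  by (simp_all add: all_composable_Suc all_can)

section \<open>Polynomials\<close>

text \<open>
  The ring \<open>\<F>\<^sub>2[U\<^sub>1, U\<^sub>2]\<close>; it acts on the parts of the bimodules at the objects \<open>oo\<close> and \<open>AB\<close>.
\<close>

type_synonym poly2 = "(nat \<times> nat) vect"

definition X1 :: poly2 where "X1 = gen (1, 0)"
definition X2 :: poly2 where "X2 = gen (0, 1)"

lemma two_poly2 [simp]: "(2 :: poly2) = 0"
  by (metis one_add_one vect_double(1))

lemma gen_eq_monomial: "gen (i, j) = X1 ^ i * X2 ^ j"
proof -
  have *: "gen (i, j) * gen (k, l) = gen (i + k, j + l)" for i j k l :: nat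
    by (simp add: gen_def mult_single)
  have 1: "gen (0, 0) = (1 :: poly2)"
    by (simp add: gen_def flip: zero_prod_def)
  have "X1 ^ i = gen (i, 0)"
    by (induction i) (simp_all add: 1 X1_def *)
  moreover have "X2 ^ j = gen (0, j)"
    by (induction j) (simp_all add: 1 X2_def *)
  ultimately show ?thesis
    by (simp add: *)
qed

lemma poly2_induct [case_names zero add]:
  fixes p :: poly2
  assumes "P 0" and "\<And>i j p. P p \<Longrightarrow> P (X1 ^ i * X2 ^ j + p)"
  shows "P p"
  using assms(1)
proof (induction p rule: vect_induct)
  case (add x v)
  then show ?case
    using assms(2) by (cases x) (simp add: gen_eq_monomial)
qed

text \<open>\<open>polv c n p\<close> is \<open>p \<otimes> n\<close>, where the basis element \<open>c i j\<close> is the monomial \<open>U\<^sub>1\<^sup>iU\<^sub>2\<^sup>j\<close>.\<close>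

definition polv :: "(nat \<Rightarrow> nat \<Rightarrow> 'b) \<Rightarrow> 'n \<Rightarrow> poly2 \<Rightarrow> ('b \<times> 'n) vect" where
  "polv c n p = linext (\<lambda>(i, j). c i j \<otimes> n) p"

lemma polv_zero [simp]: "polv c n 0 = 0"
  and polv_add: "polv c n (p + q) = polv c n p + polv c n q"
  by (simp_all add: polv_def)

lemma polv_monomial: "polv c n (X1 ^ i * X2 ^ j) = c i j \<otimes> n"
  by (simp add: polv_def flip: gen_eq_monomial)

lemma linext_polv: "linext T (polv c n p) = linext (\<lambda>(i, j). T (c i j, n)) p"
  by (simp add: polv_def linext_linext case_prod_unfold)

lemma linext_polv_case [simp]:
  "linext (\<lambda>(b, n'). F b n') (polv c n p) = linext (\<lambda>(i, j). F (c i j) n) p"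
  by (simp add: linext_polv)

lemma linext_case_polv [simp]: "linext (\<lambda>(i, j). c i j \<otimes> n) p = polv c n p"
  by (simp add: polv_def)

text \<open>The basis elements \<open>c i j\<close> multiply like the monomials \<open>U\<^sub>1\<^sup>iU\<^sub>2\<^sup>j\<close>.\<close>

definition monomial_basis :: "('o, 'b) dgcat \<Rightarrow> (nat \<Rightarrow> nat \<Rightarrow> 'b) \<Rightarrow> bool" where
  "monomial_basis A c \<longleftrightarrow> (\<forall>i j k l. mult A (c i j) (c k l) = gen (c (i + k) (j + l)))"

lemma monomial_basis [simp]: "monomial_basis A11 U_oo" "monomial_basis Acan C_AB"
  by (simp_all add: monomial_basis_def)

lemma lmul_polv [simp]:
  assumes "monomial_basis A c"
  shows "lmul A (c i j) (polv c n p) = polv c n (X1 ^ i * X2 ^ j * p)"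
proof (induction p rule: poly2_induct)
  case (add k l p)
  have "X1 ^ i * X2 ^ j * (X1 ^ k * X2 ^ l) = X1 ^ (i + k) * X2 ^ (j + l)"
    by (simp add: power_add ac_simps)
  then show ?case
    using add assms unfolding distrib_left polv_add
    by (simp add: polv_monomial monomial_basis_def)
qed simp

text \<open>Left multiplication of \<open>v\<close> by the polynomial \<open>p\<close>\<close>

definition pact :: "('o, 'b) dgcat \<Rightarrow> (nat \<Rightarrow> nat \<Rightarrow> 'b) \<Rightarrow> poly2 \<Rightarrow> ('b \<times> 'n) vect \<Rightarrow> ('b \<times> 'n) vect" where
  "pact A c p v = linext (\<lambda>(i, j). lmul A (c i j) v) p"

lemma pact_simps [simp]:
  "pact A c p 0 = 0"
  "pact A c p (u + v) = pact A c p u + pact A c p v"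
  by (simp_all add: pact_def case_prod_unfold linext_fun_add)

lemma pact_polv [simp]:
  assumes "monomial_basis A c"
  shows "pact A c p (polv c n q) = polv c n (p * q)"
proof (induction p rule: poly2_induct)
  case (add i j p)
  then show ?case
    by (simp add: distrib_right polv_add pact_def lmul_polv[OF assms] flip: gen_eq_monomial)
qed (simp add: pact_def)

lemma apply_to_polv [simp]: "apply_to A g as (polv c n p) = pact A c p (g n as)"
  by (simp add: apply_to_def linext_polv pact_def)

text \<open>\<open>beta k l\<close> is the divided difference \<open>(U\<^sub>1\<^sup>kU\<^sub>2\<^sup>l - U\<^sub>1\<^sup>lU\<^sub>2\<^sup>k) / (U\<^sub>1 - U\<^sub>2)\<close>.\<close>

fun beta :: "nat \<Rightarrow> nat \<Rightarrow> poly2" where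
  "beta 0 0 = 0"
| "beta 0 (Suc l) = X2 ^ l + X1 * beta 0 l"
| "beta (Suc k) l = X1 ^ k * X2 ^ l + X2 * beta k l"

lemma beta_sum: "X1 * beta k l = X2 * beta k l + (X1 ^ k * X2 ^ l + X1 ^ l * X2 ^ k)"
proof (induction k l rule: beta.induct)
  case (2 l)
  have "X1 * beta 0 (Suc l) = X1 * X2 ^ l + X1 * (X1 * beta 0 l)"
    by (simp add: algebra_simps)
  also have "\<dots> = X2 * beta 0 (Suc l) + (X1 ^ 0 * X2 ^ Suc l + X1 ^ Suc l * X2 ^ 0)"
    unfolding 2 by (simp add: algebra_simps)
  finally show ?case .
next
  case (3 k l)
  have "X1 * beta (Suc k) l = X1 * (X1 ^ k * X2 ^ l) + X2 * (X1 * beta k l)"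
    by (simp add: algebra_simps)
  also have "\<dots> = X2 * beta (Suc k) l + (X1 ^ Suc k * X2 ^ l + X1 ^ l * X2 ^ Suc k)"
    unfolding 3 by (simp add: algebra_simps)
  finally show ?case .
qed simp

lemma beta_Suc_right: "beta k (Suc l) = X1 ^ k * X2 ^ l + X1 * beta k l"
  by (induction k) (simp_all add: algebra_simps)

lemma beta_add:
  "beta (k + k') (l + l') = beta k l * (X1 ^ k' * X2 ^ l') + X1 ^ l * X2 ^ k * beta k' l'"
proof (induction k l rule: beta.induct)
  case (2 l)
  then show ?case
    by (simp add: beta_Suc_right algebra_simps power_add)
next
  case (3 k l)
  then show ?case
    by (simp add: algebra_simps power_add)
qed simp

text \<open>
  The right action on \<open>zd\<close> and \<open>zc\<close>: on the multiples of \<open>w = zc + U\<^sub>2 zd\<close>, the right and left actions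
  agree; modulo these multiples, the right action of \<open>U\<^sub>1\<close> and \<open>U\<^sub>2\<close> on \<open>zd\<close> is the left action of \<open>U\<^sub>2\<close>
  and \<open>U\<^sub>1\<close>.
\<close>

lemma linext_Z_polv:
  "linext Z_U1 (polv U_oo Zc p) = polv U_oo Zc ((X1 + X2) * p) + polv U_oo Zd (X1 * X2 * p)"
  "linext Z_U1 (polv U_oo Zd p) = polv U_oo Zc p"
  "linext Z_U2 (polv U_oo Zc p) = polv U_oo Zd (X1 * X2 * p)"
  "linext Z_U2 (polv U_oo Zd p) = polv U_oo Zc p + polv U_oo Zd ((X1 + X2) * p)"
proof -
  have *: "polv U_oo n (X1 * (X1 ^ i * X2 ^ j)) = U_oo (Suc i) j \<otimes> n"
    "polv U_oo n (X2 * (X1 ^ i * X2 ^ j)) = U_oo i (Suc j) \<otimes> n"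
    "polv U_oo n (X1 * (X2 * (X1 ^ i * X2 ^ j))) = U_oo (Suc i) (Suc j) \<otimes> n" for i j n
    by (simp_all add: ac_simps flip: polv_monomial)
  show "linext Z_U1 (polv U_oo Zc p) = polv U_oo Zc ((X1 + X2) * p) + polv U_oo Zd (X1 * X2 * p)"
  "linext Z_U1 (polv U_oo Zd p) = polv U_oo Zc p"
  "linext Z_U2 (polv U_oo Zc p) = polv U_oo Zd (X1 * X2 * p)"
  "linext Z_U2 (polv U_oo Zd p) = polv U_oo Zc p + polv U_oo Zd ((X1 + X2) * p)"
    by (induction p rule: poly2_induct)
      (auto simp: polv_monomial distrib_left distrib_right mult.assoc * polv_add add_ac)
qed

lemma Z_act_Zd_aux:
  "(linext Z_U2 ^^ l) ((linext Z_U1 ^^ k) (polv U_oo Zd p)) =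
    polv U_oo Zc (p * beta k l) + polv U_oo Zd (p * (X1 ^ l * X2 ^ k + X2 * beta k l))"
proof -
  have "(linext Z_U1 ^^ k) (polv U_oo Zd p) =
      polv U_oo Zc (p * beta k 0) + polv U_oo Zd (p * (X2 ^ k + X2 * beta k 0))" for k
  proof (induction k)
    case (Suc k)
    have *: "X1 * (p * beta k 0) = p * (X2 * beta k 0 + (X1 ^ k + X2 ^ k))"
      unfolding mult.left_commute[of X1 p] beta_sum by simp
    have ***: "X1 * (X2 * (p * beta k 0)) = X2 * (p * (X2 * beta k 0 + (X1 ^ k + X2 ^ k)))"
      unfolding mult.left_commute[of X1 X2] * ..
    show ?case
      by (simp add: Suc linext_Z_polv distrib_right mult.assoc *)
        (simp add: algebra_simps polv_add *** )
  qed simp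
  then have v: "\<And>k. (linext Z_U1 ^^ k) (polv U_oo Zd p) = polv U_oo Zc (p * beta k 0)
      + polv U_oo Zd (p * (X1 ^ 0 * X2 ^ k + X2 * beta k 0))"
    by simp
  show ?thesis
    unfolding v
  proof (induction l)
    case (Suc l)
    have *: "X1 * (p * beta k l) = p * (X2 * beta k l + (X1 ^ k * X2 ^ l + X1 ^ l * X2 ^ k))"
      unfolding mult.left_commute[of X1 p] beta_sum by simp
    have **: "X1 * beta k l = (X2 * beta k l + (X1 ^ k * X2 ^ l + X1 ^ l * X2 ^ k))"
      by (rule beta_sum)
    have ***: "X1 * (X2 * (p * beta k l)) = X2 * (p * (X2 * beta k l + (X1 ^ k * X2 ^ l + X1 ^ l * X2 ^ k)))"
      unfolding mult.left_commute[of X1 X2] * ..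
    show ?case
      unfolding funpow.simps o_def Suc
      by (simp add: linext_Z_polv beta_Suc_right distrib_right mult.assoc ** * )
        (simp add: algebra_simps polv_add *** )
  qed simp
qed

lemma Z_act_Zd:
  "Z_act Zd k l = polv U_oo Zc (beta k l) + polv U_oo Zd (X1 ^ l * X2 ^ k + X2 * beta k l)"
  using Z_act_Zd_aux[of l k 1] polv_monomial[of U_oo Zd 0 0] by (simp add: Z_act_def)

lemma Z_act_Zc:
  "Z_act Zc k l = polv U_oo Zc (X1 ^ k * X2 ^ l + X2 * beta k l)
    + polv U_oo Zd (X2 * (X1 ^ k * X2 ^ l + X1 ^ l * X2 ^ k + X2 * beta k l))"
proof -
  have "U_oo 0 0 \<otimes> Zc = linext Z_U1 (U_oo 0 0 \<otimes> Zd)"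
    by simp
  then have "Z_act Zc k l = Z_act Zd (Suc k) l"
    by (simp add: Z_act_def flip: funpow_swap1 del: linext_gen)
  then show ?thesis
    by (simp add: Z_act_Zd) (simp add: algebra_simps polv_add)
qed

section \<open>The operations of the given bimodules\<close>

lemma polv_1: "c 0 0 \<otimes> n = polv c n 1"
  using polv_monomial[of c n 0 0] by simp

text \<open>
  In the following tables the listed values include those on identities, and they cover all inputs. At
  the objects \<open>oo\<close> and \<open>AB\<close>, values are written in terms of \<^const>\<open>polv\<close>.
\<close>

lemma ops_K:
  "ops K_bimod Kap1 as = (case as of [E_uu] \<Rightarrow> C_none \<otimes> Kap1 | _ \<Rightarrow> 0)"
  "ops K_bimod Kap2 as = (case as of [U_ou k] \<Rightarrow> C_A k \<otimes> Kap2 | _ \<Rightarrow> 0)"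
  "ops K_bimod Kap3 as = (case as of [] \<Rightarrow> C_R 0 \<otimes> Kap4 | [Lam] \<Rightarrow> C_A 0 \<otimes> Kap2
     | [U_uo k] \<Rightarrow> (case k of 0 \<Rightarrow> C_A 0 \<otimes> Kap3 | Suc j \<Rightarrow> 0) | _ \<Rightarrow> 0)"
  "ops K_bimod Kap4 as = (case as of [U_uo k] \<Rightarrow> (case k of 0 \<Rightarrow> C_B1 0 \<otimes> Kap4 | Suc j \<Rightarrow> C_B2 j \<otimes> Kap4)
     | [Lam, U_ou k] \<Rightarrow> (case k of 0 \<Rightarrow> 0 | Suc j \<Rightarrow> C_L j \<otimes> Kap2) | _ \<Rightarrow> 0)"
  "ops K_bimod Kap5 as = (case as of [U_oo k l] \<Rightarrow> C_AB k l \<otimes> Kap5 | _ \<Rightarrow> 0)"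
  by (auto simp: K_bimod_def unital_def K_op_def identities_A11 split: list.splits alg.splits nat.splits)

lemma ops_L:
  "ops L_bimod Lam1 as = (case as of [C_none] \<Rightarrow> E_uu \<otimes> Lam1 | _ \<Rightarrow> 0)"
  "ops L_bimod Lam2 as = (case as of [C_A k] \<Rightarrow> U_ou k \<otimes> Lam2 | [C_R k] \<Rightarrow> U_ou k \<otimes> Lam3 | _ \<Rightarrow> 0)"
  "ops L_bimod Lam3 as = (case as of [C_L k] \<Rightarrow> U_ou (Suc k) \<otimes> Lam2 | [C_B1 k] \<Rightarrow> U_ou k \<otimes> Lam3 | _ \<Rightarrow> 0)"
  "ops L_bimod Lam4 as = (case as of [] \<Rightarrow> Lam \<otimes> Lam3
     | [C_B1 k] \<Rightarrow> (case k of 0 \<Rightarrow> U_uo 0 \<otimes> Lam4 | Suc j \<Rightarrow> 0)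
     | [C_B2 k] \<Rightarrow> U_uo (Suc k) \<otimes> Lam4 | _ \<Rightarrow> 0)"
  "ops L_bimod Lam5 as = (case as of [C_AB k l] \<Rightarrow> U_oo k l \<otimes> Lam5 | _ \<Rightarrow> 0)"
  by (auto simp: L_bimod_def unital_def L_op_def identities_Acan split: list.splits can.splits nat.splits)

lemma ops_POSz:
  "ops P_OSz S_none as = (case as of [C_none] \<Rightarrow> C_none \<otimes> S_none | _ \<Rightarrow> 0)"
  "ops P_OSz S_A as = (case as of [] \<Rightarrow> C_R 0 \<otimes> W
     | [C_A k] \<Rightarrow> (case k of 0 \<Rightarrow> C_A 0 \<otimes> S_A | Suc j \<Rightarrow> 0) | _ \<Rightarrow> 0)"
  "ops P_OSz W as = (case as of [C_A k] \<Rightarrow> (case k of 0 \<Rightarrow> C_B1 0 \<otimes> W | Suc j \<Rightarrow> C_B2 j \<otimes> W)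
     | [C_R k] \<Rightarrow> C_B2 k \<otimes> N_B | _ \<Rightarrow> 0)"
  "ops P_OSz N_B as = (case as of [C_B2 k, C_L l] \<Rightarrow> (case l of 0 \<Rightarrow> C_L k \<otimes> S_A | Suc _ \<Rightarrow> 0)
     | [C_L k] \<Rightarrow> (case k of 0 \<Rightarrow> C_B1 0 \<otimes> W | Suc j \<Rightarrow> C_B2 j \<otimes> W)
     | [C_B1 k] \<Rightarrow> (case k of 0 \<Rightarrow> C_B1 0 \<otimes> N_B | Suc j \<Rightarrow> C_B2 j \<otimes> N_B)
     | [C_B2 k] \<Rightarrow> C_B1 (Suc k) \<otimes> N_B | _ \<Rightarrow> 0)"
  "ops P_OSz N_AB as = (case as of [C_AB k l] \<Rightarrow> polv C_AB N_AB (X1 ^ l * X2 ^ k) | _ \<Rightarrow> 0)"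
  by (auto simp: P_OSz_def unital_def POSz_op_def identities_Acan polv_monomial polv_1
      split: list.splits can.splits nat.splits)

lemma ops_NOSz:
  "ops N_OSz S_none as = (case as of [C_none] \<Rightarrow> C_none \<otimes> S_none | _ \<Rightarrow> 0)"
  "ops N_OSz S_A as = (case as of [C_A k] \<Rightarrow> (case k of 0 \<Rightarrow> C_A 0 \<otimes> S_A | Suc j \<Rightarrow> 0)
     | [C_R k, C_B2 l] \<Rightarrow> (case k of 0 \<Rightarrow> C_R l \<otimes> N_B | Suc j \<Rightarrow> 0) | _ \<Rightarrow> 0)"
  "ops N_OSz W as = (case as of [] \<Rightarrow> C_L 0 \<otimes> S_A
     | [C_A k] \<Rightarrow> (case k of 0 \<Rightarrow> C_B1 0 \<otimes> W | Suc j \<Rightarrow> C_B2 j \<otimes> W)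
     | [C_R k] \<Rightarrow> (case k of 0 \<Rightarrow> C_B1 0 \<otimes> N_B | Suc j \<Rightarrow> C_B2 j \<otimes> N_B) | _ \<Rightarrow> 0)"
  "ops N_OSz N_B as = (case as of [C_L k] \<Rightarrow> C_B2 k \<otimes> W
     | [C_B1 k] \<Rightarrow> (case k of 0 \<Rightarrow> C_B1 0 \<otimes> N_B | Suc j \<Rightarrow> C_B2 j \<otimes> N_B)
     | [C_B2 k] \<Rightarrow> C_B1 (Suc k) \<otimes> N_B | _ \<Rightarrow> 0)"
  "ops N_OSz N_AB as = (case as of [C_AB k l] \<Rightarrow> polv C_AB N_AB (X1 ^ l * X2 ^ k) | _ \<Rightarrow> 0)"
  by (auto simp: N_OSz_def unital_def NOSz_op_def identities_Acan polv_monomial polv_1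
      split: list.splits can.splits nat.splits)

lemma ops_X:
  "ops X_bimod Xa as = (case as of [U_ou k] \<Rightarrow> U_ou k \<otimes> Xa | _ \<Rightarrow> 0)"
  "ops X_bimod Ya as = (case as of [] \<Rightarrow> Lam \<otimes> Xa | [U_ou k] \<Rightarrow> U_uo k \<otimes> Ya | _ \<Rightarrow> 0)"
  "ops X_bimod Xb as = (case as of [U_uo k] \<Rightarrow> U_ou k \<otimes> Xb
     | [Lam, U_ou k] \<Rightarrow> (case k of 0 \<Rightarrow> 0 | Suc j \<Rightarrow> U_ou j \<otimes> Xa)
     | [U_uo k, Lam] \<Rightarrow> (case k of 0 \<Rightarrow> 0 | Suc j \<Rightarrow> U_ou j \<otimes> Xa) | _ \<Rightarrow> 0)"
  "ops X_bimod Yb as = (case as of [] \<Rightarrow> Lam \<otimes> Xb | [U_uo k] \<Rightarrow> U_uo k \<otimes> Yb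
     | [Lam, U_ou k] \<Rightarrow> (case k of 0 \<Rightarrow> 0 | Suc j \<Rightarrow> U_uo j \<otimes> Ya)
     | [U_uo k, Lam] \<Rightarrow> (case k of 0 \<Rightarrow> 0 | Suc j \<Rightarrow> U_uo j \<otimes> Ya) | _ \<Rightarrow> 0)"
  "ops X_bimod Zc as = (case as of [U_oo k l] \<Rightarrow> polv U_oo Zc (X1 ^ k * X2 ^ l + X2 * beta k l)
    + polv U_oo Zd (X2 * (X1 ^ k * X2 ^ l + X1 ^ l * X2 ^ k + X2 * beta k l)) | _ \<Rightarrow> 0)"
  "ops X_bimod Zd as = (case as of [U_oo k l] \<Rightarrow>
     polv U_oo Zc (beta k l) + polv U_oo Zd (X1 ^ l * X2 ^ k + X2 * beta k l) | _ \<Rightarrow> 0)"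
  by (auto simp: X_bimod_def unital_def X_op_def identities_A11 Z_act_Zc Z_act_Zd polv_1
      split: list.splits alg.splits nat.splits)

lemma ops_P':
  "ops P' (Inl Ob_uu) as = (case as of [E_uu] \<Rightarrow> E_uu \<otimes> Inl Ob_uu | _ \<Rightarrow> 0)"
  "ops P' (Inl Ob_ou) as = (case as of [] \<Rightarrow> U_ou 0 \<otimes> Inr Xa | [U_ou k] \<Rightarrow> U_ou k \<otimes> Inl Ob_ou | _ \<Rightarrow> 0)"
  "ops P' (Inl Ob_uo) as = (case as of [] \<Rightarrow> U_uo 1 \<otimes> Inr Yb | [U_uo k] \<Rightarrow> U_uo k \<otimes> Inl Ob_uo
     | [Lam] \<Rightarrow> Lam \<otimes> Inl Ob_ou + U_uo 0 \<otimes> Inr Ya | _ \<Rightarrow> 0)"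
  "ops P' (Inl Ob_oo) as = (case as of [] \<Rightarrow> polv U_oo (Inr Zc) 1 + polv U_oo (Inr Zd) X2
     | [U_oo k l] \<Rightarrow> polv U_oo (Inl Ob_oo) (X1 ^ k * X2 ^ l) | _ \<Rightarrow> 0)"
  "ops P' (Inr x) as = linext (\<lambda>(b, n). b \<otimes> Inr n) (ops X_bimod x as)"
  by (auto simp: P'_def cone_def shift_def id_bimod_def eta_def identities_A11 polv_monomial polv_1
      polv_monomial[of U_oo _ 0 1, simplified]
      split: list.splits alg.splits)

lemma ops_N':
  "ops N' (Inr Ob_uu) as = (case as of [E_uu] \<Rightarrow> E_uu \<otimes> Inr Ob_uu | _ \<Rightarrow> 0)"
  "ops N' (Inr Ob_ou) as = (case as of [U_ou k] \<Rightarrow> U_ou k \<otimes> Inr Ob_ou | _ \<Rightarrow> 0)"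
  "ops N' (Inr Ob_uo) as = (case as of [U_uo k] \<Rightarrow> U_uo k \<otimes> Inr Ob_uo | [Lam] \<Rightarrow> Lam \<otimes> Inr Ob_ou | _ \<Rightarrow> 0)"
  "ops N' (Inr Ob_oo) as = (case as of [U_oo k l] \<Rightarrow> polv U_oo (Inr Ob_oo) (X1 ^ k * X2 ^ l) | _ \<Rightarrow> 0)"
  "ops N' (Inl Xa) as = linext (\<lambda>(b, n). b \<otimes> Inl n) (ops X_bimod Xa as)
     + (case as of [] \<Rightarrow> U_ou 1 \<otimes> Inr Ob_ou | _ \<Rightarrow> 0)"
  "ops N' (Inl Ya) as = linext (\<lambda>(b, n). b \<otimes> Inl n) (ops X_bimod Ya as)"
  "ops N' (Inl Xb) as = linext (\<lambda>(b, n). b \<otimes> Inl n) (ops X_bimod Xb as)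
     + (case as of [Lam] \<Rightarrow> U_ou 0 \<otimes> Inr Ob_ou | _ \<Rightarrow> 0)"
  "ops N' (Inl Yb) as = linext (\<lambda>(b, n). b \<otimes> Inl n) (ops X_bimod Yb as)
     + (case as of [] \<Rightarrow> U_uo 0 \<otimes> Inr Ob_uo | _ \<Rightarrow> 0)"
  "ops N' (Inl Zc) as = linext (\<lambda>(b, n). b \<otimes> Inl n) (ops X_bimod Zc as)
     + (case as of [] \<Rightarrow> polv U_oo (Inr Ob_oo) X1 | _ \<Rightarrow> 0)"
  "ops N' (Inl Zd) as = linext (\<lambda>(b, n). b \<otimes> Inl n) (ops X_bimod Zd as)
     + (case as of [] \<Rightarrow> polv U_oo (Inr Ob_oo) 1 | _ \<Rightarrow> 0)"
  by (auto simp: N'_def cone_def shift_def id_bimod_def eps'_def identities_A11 polv_monomial polv_1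
      polv_monomial[of U_oo _ 1 0, simplified]
      split: list.splits alg.splits)

section \<open>Bounds for the number of inputs\<close>

lemma max_inputs_K: "max_inputs 2 (ops K_bimod)"
  unfolding max_inputs_def by (intro allI, case_tac m) (auto simp: ops_K split: list.split alg.split)

lemma max_inputs_L: "max_inputs 1 (ops L_bimod)"
  unfolding max_inputs_def by (intro allI, case_tac m) (auto simp: ops_L split: list.split can.split)

lemma max_inputs_X: "max_inputs 2 (ops X_bimod)"
  unfolding max_inputs_def by (intro allI, case_tac m) (auto simp: ops_X split: list.split alg.split)

lemma max_inputs_POSz: "max_inputs 2 (ops P_OSz)"
  unfolding max_inputs_def by (intro allI, case_tac m) (auto simp: ops_POSz split: list.split can.split)

lemma max_inputs_NOSz: "max_inputs 2 (ops N_OSz)"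
  unfolding max_inputs_def by (intro allI, case_tac m) (auto simp: ops_NOSz split: list.split can.split)

lemma max_inputs_P': "max_inputs 2 (ops P')"
  unfolding max_inputs_def
proof (intro allI impI)
  fix m :: "ob + xgen" and as :: "alg list"
  assume "length as > 2"
  then show "ops P' m as = 0"
  proof (cases m)
    case (Inl S)
    then show ?thesis
      using \<open>length as > 2\<close> by (cases S) (auto simp: ops_P' split: list.split alg.split)
  qed (simp add: ops_P' max_inputsD[OF max_inputs_X])
qed

lemma max_inputs_N': "max_inputs 2 (ops N')"
  unfolding max_inputs_def
proof (intro allI impI)
  fix m :: "xgen + ob" and as :: "alg list"
  assume *: "length as > 2"
  then show "ops N' m as = 0"
  proof (cases m)
    case (Inl x)
    then show ?thesis
      using * max_inputsD[OF max_inputs_X *]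
      by (cases x) (auto simp: ops_N' split: list.split alg.split)
  next
    case (Inr S)
    then show ?thesis
      using * by (cases S) (auto simp: ops_N' split: list.split alg.split)
  qed
qed

text \<open>
  Once \<open>pre\<close> has reached the maximal number of inputs, the next operation of \<open>N\<close> consumes exactly \<open>pre\<close>,
  and the unfolding of \<^const>\<open>box_split\<close> along the remaining inputs stops.
\<close>

lemma box_split_last:
  assumes "max_inputs p (ops N)"
  shows "length pre \<ge> p \<Longrightarrow> box_split M N j m bs n pre as =
    linext (\<lambda>(b, n'). box_from M N j m (bs @ [b]) n' as) (ops N n pre)"
proof -
  have *: "box_split M N j m bs n pre as = 0" if "length pre > p" for pre as
    using that by (induction as arbitrary: pre) (auto simp: max_inputsD[OF assms])
  show "length pre \<ge> p \<Longrightarrow> box_split M N j m bs n pre as =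
    linext (\<lambda>(b, n'). box_from M N j m (bs @ [b]) n' as) (ops N n pre)"
    by (cases as) (auto simp: *)
qed

lemmas box_split_last_given [simp] =
  box_split_last[OF max_inputs_K] box_split_last[OF max_inputs_L]
  box_split_last[OF max_inputs_P'] box_split_last[OF max_inputs_N']
  box_split_last[OF max_inputs_POSz] box_split_last[OF max_inputs_NOSz]

lemmas box_eval = box_from_Suc sum.atMost_Suc eval_nat_numeral

\<comment> \<open>The sum over the splittings of the inputs is evaluated through \<open>box_split\<close> instead.\<close>
declare box_from.simps(2) [simp del]

text \<open>\<open>F (k - 1)\<close> if \<open>k > 0\<close>, and 0 if \<open>k = 0\<close>\<close>

abbreviation pred_case :: "nat \<Rightarrow> (nat \<Rightarrow> 'x vect) \<Rightarrow> 'x vect"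
  where "pred_case k F \<equiv> (case k of 0 \<Rightarrow> 0 | Suc j \<Rightarrow> F j)"

lemma U2_B_case: "U2_B k = (case k of 0 \<Rightarrow> C_B1 0 | Suc j \<Rightarrow> C_B2 j)"
  by (cases k) auto

lemma ops_K_box: "ops (K_bimod \<boxtimes> N) (m, n) as = (\<Sum>j\<le>2. box_from K_bimod N j m [] n as)"
  by (rule ops_box_product) (rule max_inputs_K)

lemma ops_L_box: "ops (L_bimod \<boxtimes> N) (m, n) as = (\<Sum>j\<le>1. box_from L_bimod N j m [] n as)"
  by (rule ops_box_product) (rule max_inputs_L)

section \<open>The operations of the box products\<close>

abbreviation "KP \<equiv> K_bimod \<boxtimes> P'"
abbreviation "KN \<equiv> K_bimod \<boxtimes> N'"
abbreviation "LP \<equiv> L_bimod \<boxtimes> P_OSz"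
abbreviation "LN \<equiv> L_bimod \<boxtimes> N_OSz"
abbreviation "KPL \<equiv> K_bimod \<boxtimes> P' \<boxtimes> L_bimod"
abbreviation "KNL \<equiv> K_bimod \<boxtimes> N' \<boxtimes> L_bimod"
abbreviation "LPK \<equiv> L_bimod \<boxtimes> P_OSz \<boxtimes> K_bimod"
abbreviation "LNK \<equiv> L_bimod \<boxtimes> N_OSz \<boxtimes> K_bimod"

lemmas shapes = all_composable_A11 all_composable_Acan all_composable_0

text \<open>
  Operations of \<open>\<K> \<boxtimes> P'\<close> on composable inputs. An operation of \<open>\<K>\<close> uses at most two operations of \<open>P'\<close>
  with at most two inputs each, hence the unfolding of four inputs.
\<close>

lemma ops_KP:
  "all_composable A11 Ob_uu 4 (\<lambda>as. ops KP (Kap1, Inl Ob_uu) as =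
     (case as of [E_uu] \<Rightarrow> C_none \<otimes> (Kap1, Inl Ob_uu) | _ \<Rightarrow> 0))"
  "all_composable A11 Ob_ou 4 (\<lambda>as. ops KP (Kap2, Inl Ob_ou) as = (case as of
       [] \<Rightarrow> C_A 0 \<otimes> (Kap2, Inr Xa)
     | [U_ou k] \<Rightarrow> C_A k \<otimes> (Kap2, Inl Ob_ou) | _ \<Rightarrow> 0))"
  "all_composable A11 Ob_ou 4 (\<lambda>as. ops KP (Kap2, Inr Xa) as = (case as of
       [U_ou k] \<Rightarrow> C_A k \<otimes> (Kap2, Inr Xa) | _ \<Rightarrow> 0))"
  "all_composable A11 Ob_uo 4 (\<lambda>as. ops KP (Kap2, Inr Xb) as = (case as of
       [U_uo k] \<Rightarrow> C_A k \<otimes> (Kap2, Inr Xb)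
     | [U_uo k, Lam] \<Rightarrow> pred_case k (\<lambda>j. C_A j \<otimes> (Kap2, Inr Xa))
     | [Lam, U_ou k] \<Rightarrow> pred_case k (\<lambda>j. C_A j \<otimes> (Kap2, Inr Xa)) | _ \<Rightarrow> 0))"
  "all_composable A11 Ob_uo 4 (\<lambda>as. ops KP (Kap3, Inl Ob_uo) as = (case as of
       [] \<Rightarrow> C_R 0 \<otimes> (Kap4, Inl Ob_uo)
     | [U_uo k] \<Rightarrow> (case k of 0 \<Rightarrow> C_A 0 \<otimes> (Kap3, Inl Ob_uo) | Suc j \<Rightarrow> 0)
     | [Lam] \<Rightarrow> C_A 0 \<otimes> (Kap2, Inl Ob_ou) + C_A 0 \<otimes> (Kap3, Inr Ya) | _ \<Rightarrow> 0))"
  "all_composable A11 Ob_ou 4 (\<lambda>as. ops KP (Kap3, Inr Ya) as = (case as of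
       [] \<Rightarrow> C_A 0 \<otimes> (Kap2, Inr Xa) + C_R 0 \<otimes> (Kap4, Inr Ya)
     | [U_ou k] \<Rightarrow> (case k of 0 \<Rightarrow> C_A 0 \<otimes> (Kap3, Inr Ya) | Suc j \<Rightarrow> 0) | _ \<Rightarrow> 0))"
  "all_composable A11 Ob_uo 4 (\<lambda>as. ops KP (Kap3, Inr Yb) as = (case as of
       [] \<Rightarrow> C_A 0 \<otimes> (Kap2, Inr Xb) + C_R 0 \<otimes> (Kap4, Inr Yb)
     | [U_uo k] \<Rightarrow> (case k of 0 \<Rightarrow> C_A 0 \<otimes> (Kap3, Inr Yb) | Suc j \<Rightarrow> 0)
     | [U_uo k, Lam] \<Rightarrow> (if k = 1 then C_A 0 \<otimes> (Kap3, Inr Ya) else 0)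
     | [Lam, U_ou k] \<Rightarrow> (if k = 1 then C_A 0 \<otimes> (Kap3, Inr Ya) else 0) | _ \<Rightarrow> 0))"
  "all_composable A11 Ob_uo 4 (\<lambda>as. ops KP (Kap4, Inl Ob_uo) as = (case as of
       [] \<Rightarrow> C_B2 0 \<otimes> (Kap4, Inr Yb)
     | [U_uo k] \<Rightarrow> U2_B k \<otimes> (Kap4, Inl Ob_uo) | [Lam] \<Rightarrow> C_B1 0 \<otimes> (Kap4, Inr Ya)
     | [Lam, U_ou k] \<Rightarrow> pred_case k (\<lambda>j. C_L j \<otimes> (Kap2, Inl Ob_ou)) | _ \<Rightarrow> 0))"
  "all_composable A11 Ob_ou 4 (\<lambda>as. ops KP (Kap4, Inr Ya) as = (case as of
       [U_ou k] \<Rightarrow> U2_B k \<otimes> (Kap4, Inr Ya) + pred_case k (\<lambda>j. C_L j \<otimes> (Kap2, Inr Xa)) | _ \<Rightarrow> 0))"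
  "all_composable A11 Ob_uo 4 (\<lambda>as. ops KP (Kap4, Inr Yb) as = (case as of
       [U_uo k] \<Rightarrow> U2_B k \<otimes> (Kap4, Inr Yb) + pred_case k (\<lambda>j. C_L j \<otimes> (Kap2, Inr Xb))
     | [U_uo k, Lam] \<Rightarrow> pred_case k (\<lambda>i. U2_B i \<otimes> (Kap4, Inr Ya) + pred_case i (\<lambda>j. C_L j \<otimes> (Kap2, Inr Xa)))
     | [Lam, U_ou k] \<Rightarrow> pred_case k (\<lambda>i. U2_B i \<otimes> (Kap4, Inr Ya) + pred_case i (\<lambda>j. C_L j \<otimes> (Kap2, Inr Xa)))
     | _ \<Rightarrow> 0))"
  "all_composable A11 Ob_oo 4 (\<lambda>as. ops KP (Kap5, Inl Ob_oo) as = (case as of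
       [] \<Rightarrow> polv C_AB (Kap5, Inr Zc) 1 + polv C_AB (Kap5, Inr Zd) X2
     | [U_oo k l] \<Rightarrow> polv C_AB (Kap5, Inl Ob_oo) (X1 ^ k * X2 ^ l) | _ \<Rightarrow> 0))"
  "all_composable A11 Ob_oo 4 (\<lambda>as. ops KP (Kap5, Inr Zc) as = (case as of [U_oo k l] \<Rightarrow>
       polv C_AB (Kap5, Inr Zc) (X1 ^ k * X2 ^ l + X2 * beta k l)
       + polv C_AB (Kap5, Inr Zd) (X2 * (X1 ^ k * X2 ^ l + X1 ^ l * X2 ^ k + X2 * beta k l)) | _ \<Rightarrow> 0))"
  "all_composable A11 Ob_oo 4 (\<lambda>as. ops KP (Kap5, Inr Zd) as = (case as of [U_oo k l] \<Rightarrow>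
       polv C_AB (Kap5, Inr Zc) (beta k l)
       + polv C_AB (Kap5, Inr Zd) (X1 ^ l * X2 ^ k + X2 * beta k l) | _ \<Rightarrow> 0))"
  by (simp_all add: shapes eval_nat_numeral ops_K_box box_eval ops_K ops_P' ops_X U2_B_case polv_add algebra_simps
        split: nat.split)

section \<open>Operations and objects\<close>

text \<open>
  The operations vanish on inputs that are not composable, and their values lie in the summand of
  \<open>A' \<otimes> M\<close> prescribed by the objects. This is required for all elements of the type \<open>'m\<close>, generators
  or not.
\<close>

definition typed :: "('l, 'b) dgcat \<Rightarrow> ('r, 'a) dgcat \<Rightarrow> ('l, 'r, 'b, 'a, 'm) da \<Rightarrow> bool" where
  "typed A' A M \<longleftrightarrow> (\<forall>m as. (\<not> composable A (rgt M m) as \<longrightarrow> ops M m as = 0) \<and>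
     supported (\<lambda>(b, n). lob A' b = lft M m \<and> rob A' b = lft M n \<and> rgt M n = end_ob A (rgt M m) as)
       (ops M m as))"

lemma objects [simp]:
  "lft K_bimod = K_lft" "rgt K_bimod = K_rgt" "lft L_bimod = L_lft" "rgt L_bimod = L_rgt"
  "lft P_OSz = osz_lft" "rgt P_OSz = osz_rgt" "lft N_OSz = osz_lft" "rgt N_OSz = osz_rgt"
  "lft X_bimod = X_lft" "rgt X_bimod = X_rgt"
  by (simp_all add: K_bimod_def L_bimod_def P_OSz_def N_OSz_def X_bimod_def)

lemma supported_polv [simp]: "(\<And>i j. Q (c i j, n)) \<Longrightarrow> supported Q (polv c n p)"
  unfolding polv_def by (rule supported_linext[where Q = "\<lambda>_. True"]) (auto simp: supported_def[of "\<lambda>_. True"])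

lemma typedI:
  assumes "\<And>m as. ops M m as \<noteq> 0 \<Longrightarrow> composable A (rgt M m) as"
    and "\<And>m as. supported (\<lambda>(b, n). lob A' b = lft M m \<and> rob A' b = lft M n \<and> rgt M n = end_ob A (rgt M m) as)
       (ops M m as)"
  shows "typed A' A M"
  using assms by (auto simp: typed_def)

lemma typed_K: "typed Acan A11 K_bimod"
proof (rule typedI)
  show "ops K_bimod m as \<noteq> 0 \<Longrightarrow> composable A11 (rgt K_bimod m) as" for m as
    by (cases m) (auto simp: ops_K split: list.splits alg.splits)
  show "supported (\<lambda>(b, n). lob Acan b = lft K_bimod m \<and> rob Acan b = lft K_bimod n
      \<and> rgt K_bimod n = end_ob A11 (rgt K_bimod m) as) (ops K_bimod m as)" for m as
    by (cases m) (auto simp: ops_K split: list.split alg.split nat.split)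
qed

lemma typed_L: "typed A11 Acan L_bimod"
proof (rule typedI)
  show "ops L_bimod m as \<noteq> 0 \<Longrightarrow> composable Acan (rgt L_bimod m) as" for m as
    by (cases m) (auto simp: ops_L split: list.splits can.splits)
  show "supported (\<lambda>(b, n). lob A11 b = lft L_bimod m \<and> rob A11 b = lft L_bimod n
      \<and> rgt L_bimod n = end_ob Acan (rgt L_bimod m) as) (ops L_bimod m as)" for m as
    by (cases m) (auto simp: ops_L split: list.split can.split nat.split)
qed

lemma typed_POSz: "typed Acan Acan P_OSz"
proof (rule typedI)
  show "ops P_OSz m as \<noteq> 0 \<Longrightarrow> composable Acan (rgt P_OSz m) as" for m as
    by (cases m) (auto simp: ops_POSz split: list.splits can.splits)
  show "supported (\<lambda>(b, n). lob Acan b = lft P_OSz m \<and> rob Acan b = lft P_OSz n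
      \<and> rgt P_OSz n = end_ob Acan (rgt P_OSz m) as) (ops P_OSz m as)" for m as
    by (cases m) (auto simp: ops_POSz split: list.split can.split nat.split)
qed

lemma typed_NOSz: "typed Acan Acan N_OSz"
proof (rule typedI)
  show "ops N_OSz m as \<noteq> 0 \<Longrightarrow> composable Acan (rgt N_OSz m) as" for m as
    by (cases m) (auto simp: ops_NOSz split: list.splits can.splits)
  show "supported (\<lambda>(b, n). lob Acan b = lft N_OSz m \<and> rob Acan b = lft N_OSz n
      \<and> rgt N_OSz n = end_ob Acan (rgt N_OSz m) as) (ops N_OSz m as)" for m as
    by (cases m) (auto simp: ops_NOSz split: list.split can.split nat.split)
qed

lemma objects_P' [simp]:
  "lft P' (Inl S) = S" "rgt P' (Inl S) = S" "lft P' (Inr x) = X_lft x" "rgt P' (Inr x) = X_rgt x"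
  by (simp_all add: P'_def cone_def shift_def id_bimod_def X_bimod_def)

lemma objects_N' [simp]:
  "lft N' (Inr S) = S" "rgt N' (Inr S) = S" "lft N' (Inl x) = X_lft x" "rgt N' (Inl x) = X_rgt x"
  by (simp_all add: N'_def cone_def shift_def id_bimod_def X_bimod_def)

lemma typed_X: "typed A11 A11 X_bimod"
proof (rule typedI)
  show "ops X_bimod m as \<noteq> 0 \<Longrightarrow> composable A11 (rgt X_bimod m) as" for m as
    by (cases m) (auto simp: ops_X split: list.splits alg.splits)
  show "supported (\<lambda>(b, n). lob A11 b = lft X_bimod m \<and> rob A11 b = lft X_bimod n
      \<and> rgt X_bimod n = end_ob A11 (rgt X_bimod m) as) (ops X_bimod m as)" for m as
    by (cases m) (auto simp: ops_X split: list.split alg.split nat.split)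
qed

lemma typed_P': "typed A11 A11 P'"
proof (rule typedI)
  show "ops P' m as \<noteq> 0 \<Longrightarrow> composable A11 (rgt P' m) as" for m as
  proof (cases m)
    case (Inl S)
    then show "ops P' m as \<noteq> 0 \<Longrightarrow> composable A11 (rgt P' m) as"
      by (cases S) (auto simp: ops_P' split: list.splits alg.splits)
  next
    case (Inr x)
    have "\<not> composable A11 (X_rgt x) as \<Longrightarrow> ops X_bimod x as = 0"
      using typed_X by (simp add: typed_def)
    then show "ops P' m as \<noteq> 0 \<Longrightarrow> composable A11 (rgt P' m) as"
      using Inr by (cases "composable A11 (X_rgt x) as") (simp_all add: ops_P')
  qed
  show "supported (\<lambda>(b, n). lob A11 b = lft P' m \<and> rob A11 b = lft P' n
      \<and> rgt P' n = end_ob A11 (rgt P' m) as) (ops P' m as)" for m as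
  proof (cases m)
    case (Inl S)
    then show ?thesis
      by (cases S) (auto simp: ops_P' split: list.split alg.split)
  next
    case (Inr x)
    show ?thesis
      unfolding Inr ops_P'
      by (rule supported_linext[OF conjunct2[OF spec[OF spec[OF typed_X[unfolded typed_def]]]]]) auto
  qed
qed

lemma ops_N'_Inl:
  "ops N' (Inl x) as = linext (\<lambda>(b, n). b \<otimes> Inl n) (ops X_bimod x as) +
    (if set as \<inter> identities A11 = {} then linext (\<lambda>(b, n). b \<otimes> Inr n) (eps' x as) else 0)"
  by (simp add: N'_def cone_def shift_def)

lemma typed_N': "typed A11 A11 N'"
proof (rule typedI)
  show "ops N' m as \<noteq> 0 \<Longrightarrow> composable A11 (rgt N' m) as" for m as
  proof (cases m)
    case (Inr S)
    then show "ops N' m as \<noteq> 0 \<Longrightarrow> composable A11 (rgt N' m) as"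
      by (cases S) (auto simp: ops_N' split: list.splits alg.splits)
  next
    case (Inl x)
    have "eps' x as \<noteq> 0 \<Longrightarrow> composable A11 (X_rgt x) as"
      by (cases x) (auto simp: eps'_def split: list.splits alg.splits)
    moreover have "\<not> composable A11 (X_rgt x) as \<Longrightarrow> ops X_bimod x as = 0"
      using typed_X by (simp add: typed_def)
    ultimately show "ops N' m as \<noteq> 0 \<Longrightarrow> composable A11 (rgt N' m) as"
      using Inl by (cases "composable A11 (X_rgt x) as"; cases "eps' x as = 0") (simp_all add: ops_N'_Inl split: if_splits)
  qed
  show "supported (\<lambda>(b, n). lob A11 b = lft N' m \<and> rob A11 b = lft N' n
      \<and> rgt N' n = end_ob A11 (rgt N' m) as) (ops N' m as)" for m as
  proof (cases m)
    case (Inr S)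
    then show ?thesis
      by (cases S) (auto simp: ops_N' split: list.split alg.split)
  next
    case (Inl x)
    have "supported (\<lambda>(b, n). lob A11 b = X_lft x \<and> rob A11 b = n \<and> n = end_ob A11 (X_rgt x) as) (eps' x as)"
      by (cases x) (auto simp: eps'_def split: list.split alg.split)
    then show ?thesis
      unfolding Inl ops_N'_Inl
      by (intro supported_add supported_linext[OF conjunct2[OF spec[OF spec[OF typed_X[unfolded typed_def]]]]])
        (auto elim!: supported_linext)
  qed
qed

lemma op_iter_typed:
  assumes "typed A' A N"
  shows "\<not> composable A (rgt N n) as \<Longrightarrow> op_iter N j n as = 0"
    and "supported (\<lambda>(bs, n'). length bs = j \<and> composable A' (lft N n) bs
      \<and> lft N n' = end_ob A' (lft N n) bs \<and> rgt N n' = end_ob A (rgt N n) as) (op_iter N j n as)"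
proof -
  have "(\<not> composable A (rgt N n) as \<longrightarrow> op_iter N j n as = 0) \<and>
    supported (\<lambda>(bs, n'). length bs = j \<and> composable A' (lft N n) bs
      \<and> lft N n' = end_ob A' (lft N n) bs \<and> rgt N n' = end_ob A (rgt N n) as) (op_iter N j n as)"
  proof (induction j arbitrary: n as)
    case (Suc j)
    have N: "\<not> composable A (rgt N n) as \<Longrightarrow> ops N n as = 0"
      "(b, n') \<in> Poly_Mapping.keys (ops N n as) \<Longrightarrow> lob A' b = lft N n \<and> rob A' b = lft N n' \<and> rgt N n' = end_ob A (rgt N n) as"
      for n n' as b
      using assms by (fastforce simp: typed_def supported_def)+
    let ?T = "\<lambda>i. linext (\<lambda>(b, n'). linext (\<lambda>(bs, n''). (b # bs) \<otimes> n'') (op_iter N j n' (drop i as))) (ops N n (take i as))"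
    have "?T i = 0" if "\<not> composable A (rgt N n) as" for i
    proof (cases "composable A (rgt N n) (take i as)")
      case True
      then have "\<not> composable A (end_ob A (rgt N n) (take i as)) (drop i as)"
        using that composable_append[of A "rgt N n" "take i as" "drop i as"] by simp
      then have "op_iter N j n' (drop i as) = 0" if "(b, n') \<in> Poly_Mapping.keys (ops N n (take i as))" for b n'
        using N(2)[OF that] Suc by simp
      then show ?thesis
        by (auto simp: linext_def[of _ "ops N n (take i as)"] intro!: sum.neutral)
    qed (simp add: N(1))
    moreover have "supported (\<lambda>(bs, n'). length bs = Suc j \<and> composable A' (lft N n) bs
      \<and> lft N n' = end_ob A' (lft N n) bs \<and> rgt N n' = end_ob A (rgt N n) as) (?T i)" for i
    proof (rule supported_linext[where Q = "\<lambda>(b, n'). lob A' b = lft N n \<and> rob A' b = lft N n'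
        \<and> rgt N n' = end_ob A (rgt N n) (take i as)"])
      fix x assume x: "case x of (b, n') \<Rightarrow> lob A' b = lft N n \<and> rob A' b = lft N n' \<and> rgt N n' = end_ob A (rgt N n) (take i as)"
      obtain b n' where [simp]: "x = (b, n')" by force
      have "end_ob A (rgt N n) as = end_ob A (rgt N n') (drop i as)"
        using x end_ob_append[of A "rgt N n" "take i as" "drop i as"] by simp
      then show "supported (\<lambda>(bs, n'). length bs = Suc j \<and> composable A' (lft N n) bs
          \<and> lft N n' = end_ob A' (lft N n) bs \<and> rgt N n' = end_ob A (rgt N n) as)
        (case x of (b, n') \<Rightarrow> linext (\<lambda>(bs, n''). (b # bs) \<otimes> n'') (op_iter N j n' (drop i as)))"
        using x by (auto intro!: supported_linext[OF conjunct2[OF Suc]])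
    qed (use assms in \<open>auto simp: typed_def\<close>)
    ultimately show ?case
      by (simp add: supported_sum)
  qed simp
  then show "\<not> composable A (rgt N n) as \<Longrightarrow> op_iter N j n as = 0"
    and "supported (\<lambda>(bs, n'). length bs = j \<and> composable A' (lft N n) bs
      \<and> lft N n' = end_ob A' (lft N n) bs \<and> rgt N n' = end_ob A (rgt N n) as) (op_iter N j n as)"
    by auto
qed

lemma typed_box:
  fixes M :: "('k, 'l, 'c, 'b, 'm) da" and N :: "('l, 'r, 'b, 'a, 'n) da"
  assumes M: "typed A'' A' M" and N: "typed A' A N"
  shows "typed A'' A (M \<boxtimes> N)"
  unfolding typed_def
proof (intro allI conjI impI)
  fix x :: "'m \<times> 'n" and as
  obtain m n where [simp]: "x = (m, n)" by force
  show "ops (M \<boxtimes> N) x as = 0" if "\<not> composable A (rgt (M \<boxtimes> N) x) as"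
    using that op_iter_typed(1)[OF N] by (simp add: box_product_def)
  have "supported (\<lambda>(c, m', n'). lob A'' c = lft M m \<and> rob A'' c = lft M m' \<and> rgt N n' = end_ob A (rgt N n) as)
      (linext (\<lambda>(bs, n'). linext (\<lambda>(c, m'). c \<otimes> (m', n')) (ops M m bs)) (op_iter N j n as))" for j
  proof (rule supported_linext[OF op_iter_typed(2)[OF N]], clarsimp, rule supported_linext)
    fix bs
    show "supported (\<lambda>(c, m'). lob A'' c = lft M m \<and> rob A'' c = lft M m') (ops M m bs)"
      using M by (fastforce simp: typed_def supported_def)
  qed auto
  then show "supported (\<lambda>(c, y). lob A'' c = lft (M \<boxtimes> N) x \<and> rob A'' c = lft (M \<boxtimes> N) y
      \<and> rgt (M \<boxtimes> N) y = end_ob A (rgt (M \<boxtimes> N) x) as) (ops (M \<boxtimes> N) x as)"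
    by (simp add: box_product_def Sum_any.expand_set case_prod_unfold supported_sum)
qed

lemma box_simps [simp]:
  "gens (M \<boxtimes> N) = {(m, n). m \<in> gens M \<and> n \<in> gens N \<and> rgt M m = lft N n}"
  "lft (M \<boxtimes> N) (m, n) = lft M m" "rgt (M \<boxtimes> N) (m, n) = rgt N n"
  "qgr (M \<boxtimes> N) (m, n) = qgr M m + qgr N n" "hgr (M \<boxtimes> N) (m, n) = hgr M m + hgr N n"
  by (simp_all add: box_product_def)

text \<open>
  Elements of the type \<open>'m\<close> outside of \<open>gens M\<close>, such as pairs \<open>(m, n)\<close> with \<open>rgt M m \<noteq> lft N n\<close> in a box
  product, have no operations with inputs. So bounds for the number of inputs need to be verified on
  generators only.
\<close>

definition proper :: "('l, 'r, 'b, 'a, 'm) da \<Rightarrow> bool" where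
  "proper M \<longleftrightarrow> (\<forall>m as. m \<notin> gens M \<longrightarrow> as \<noteq> [] \<longrightarrow> ops M m as = 0)"

lemma proper_box:
  fixes M :: "('k, 'l, 'c, 'b, 'm) da" and N :: "('l, 'r, 'b, 'a, 'n) da"
  assumes M: "typed A'' A' M" "proper M" and N: "typed A' A N" "gens N = UNIV"
  shows "proper (M \<boxtimes> N)"
  unfolding proper_def
proof (intro allI impI)
  fix x :: "'m \<times> 'n" and as :: "'a list"
  assume x: "x \<notin> gens (M \<boxtimes> N)" and "as \<noteq> []"
  obtain m n where [simp]: "x = (m, n)" by force
  have "linext (\<lambda>(bs, n'). linext (\<lambda>(c, m'). c \<otimes> (m', n')) (ops M m bs)) (op_iter N j n as) = 0" for j
  proof (cases j)
    case 0
    then show ?thesis using \<open>as \<noteq> []\<close> by simp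
  next
    case (Suc i)
    have "ops M m bs = 0" if "(bs, n') \<in> Poly_Mapping.keys (op_iter N j n as)" for bs n'
    proof -
      have bs: "length bs = j" "composable A' (lft N n) bs"
        using op_iter_typed(2)[OF N(1), of j n as] that by (auto simp: supported_def)
      show ?thesis
      proof (cases "m \<in> gens M")
        case True
        then have "\<not> composable A' (rgt M m) bs"
          using Suc bs x N(2) by (cases bs) auto
        then show ?thesis
          using M(1) by (simp add: typed_def)
      next
        case False
        then show ?thesis
          using M(2) Suc bs by (cases bs) (auto simp: proper_def)
      qed
    qed
    then show ?thesis
      by (auto simp: linext_def[of _ "op_iter N j n as"] intro!: sum.neutral)
  qed
  then show "ops (M \<boxtimes> N) x as = 0"
    by (simp add: box_product_def)
qed

lemma max_inputsI:
  assumes "typed A' A M" "proper M"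
    and "\<forall>m\<in>gens M. \<forall>as. composable A (rgt M m) as \<longrightarrow> length as > p \<longrightarrow> ops M m as = 0"
  shows "max_inputs p (ops M)"
  unfolding max_inputs_def
proof (intro allI impI)
  fix m and as :: "'d list" assume "length as > p"
  moreover from this have "as \<noteq> []" by auto
  ultimately show "ops M m as = 0"
    using assms by (cases "m \<in> gens M \<and> composable A (rgt M m) as") (auto simp: typed_def proper_def)
qed

lemma gens_given [simp]:
  "gens K_bimod = UNIV" "gens L_bimod = UNIV" "gens P_OSz = UNIV" "gens N_OSz = UNIV"
  "gens P' = UNIV" "gens N' = UNIV"
  by (simp_all add: K_bimod_def L_bimod_def P_OSz_def N_OSz_def P'_def N'_def cone_def shift_def
      id_bimod_def X_bimod_def)

lemma proper_given: "proper K_bimod" "proper L_bimod"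
  by (simp_all add: proper_def)

section \<open>Further box products\<close>

lemma ops_KN:
  "all_composable A11 Ob_uu 4 (\<lambda>as. ops KN (Kap1, Inr Ob_uu) as =
     (case as of [E_uu] \<Rightarrow> C_none \<otimes> (Kap1, Inr Ob_uu) | _ \<Rightarrow> 0))"
  "all_composable A11 Ob_ou 4 (\<lambda>as. ops KN (Kap2, Inr Ob_ou) as = (case as of
       [U_ou k] \<Rightarrow> C_A k \<otimes> (Kap2, Inr Ob_ou) | _ \<Rightarrow> 0))"
  "all_composable A11 Ob_ou 4 (\<lambda>as. ops KN (Kap2, Inl Xa) as = (case as of
       [] \<Rightarrow> C_A 1 \<otimes> (Kap2, Inr Ob_ou) | [U_ou k] \<Rightarrow> C_A k \<otimes> (Kap2, Inl Xa) | _ \<Rightarrow> 0))"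
  "all_composable A11 Ob_uo 4 (\<lambda>as. ops KN (Kap2, Inl Xb) as = (case as of
       [U_uo k] \<Rightarrow> C_A k \<otimes> (Kap2, Inl Xb)
     | [Lam] \<Rightarrow> C_A 0 \<otimes> (Kap2, Inr Ob_ou)
     | [U_uo k, Lam] \<Rightarrow> pred_case k (\<lambda>j. C_A j \<otimes> (Kap2, Inl Xa))
     | [Lam, U_ou k] \<Rightarrow> pred_case k (\<lambda>j. C_A j \<otimes> (Kap2, Inl Xa)) | _ \<Rightarrow> 0))"
  "all_composable A11 Ob_uo 4 (\<lambda>as. ops KN (Kap3, Inr Ob_uo) as = (case as of
       [] \<Rightarrow> C_R 0 \<otimes> (Kap4, Inr Ob_uo)
     | [U_uo k] \<Rightarrow> (case k of 0 \<Rightarrow> C_A 0 \<otimes> (Kap3, Inr Ob_uo) | Suc j \<Rightarrow> 0)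
     | [Lam] \<Rightarrow> C_A 0 \<otimes> (Kap2, Inr Ob_ou) | _ \<Rightarrow> 0))"
  "all_composable A11 Ob_ou 4 (\<lambda>as. ops KN (Kap3, Inl Ya) as = (case as of
       [] \<Rightarrow> C_A 0 \<otimes> (Kap2, Inl Xa) + C_R 0 \<otimes> (Kap4, Inl Ya)
     | [U_ou k] \<Rightarrow> (case k of 0 \<Rightarrow> C_A 0 \<otimes> (Kap3, Inl Ya) | Suc j \<Rightarrow> 0) | _ \<Rightarrow> 0))"
  "all_composable A11 Ob_uo 4 (\<lambda>as. ops KN (Kap3, Inl Yb) as = (case as of
       [] \<Rightarrow> C_A 0 \<otimes> (Kap2, Inl Xb) + C_A 0 \<otimes> (Kap3, Inr Ob_uo) + C_R 0 \<otimes> (Kap4, Inl Yb)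
     | [U_uo k] \<Rightarrow> (case k of 0 \<Rightarrow> C_A 0 \<otimes> (Kap3, Inl Yb) | Suc j \<Rightarrow> 0)
     | [U_uo k, Lam] \<Rightarrow> (if k = 1 then C_A 0 \<otimes> (Kap3, Inl Ya) else 0)
     | [Lam, U_ou k] \<Rightarrow> (if k = 1 then C_A 0 \<otimes> (Kap3, Inl Ya) else 0) | _ \<Rightarrow> 0))"
  "all_composable A11 Ob_uo 4 (\<lambda>as. ops KN (Kap4, Inr Ob_uo) as = (case as of
       [U_uo k] \<Rightarrow> U2_B k \<otimes> (Kap4, Inr Ob_uo)
     | [Lam, U_ou k] \<Rightarrow> pred_case k (\<lambda>j. C_L j \<otimes> (Kap2, Inr Ob_ou)) | _ \<Rightarrow> 0))"
  "all_composable A11 Ob_ou 4 (\<lambda>as. ops KN (Kap4, Inl Ya) as = (case as of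
       [] \<Rightarrow> C_L 0 \<otimes> (Kap2, Inr Ob_ou)
     | [U_ou k] \<Rightarrow> U2_B k \<otimes> (Kap4, Inl Ya) + pred_case k (\<lambda>j. C_L j \<otimes> (Kap2, Inl Xa)) | _ \<Rightarrow> 0))"
  "all_composable A11 Ob_uo 4 (\<lambda>as. ops KN (Kap4, Inl Yb) as = (case as of
       [] \<Rightarrow> C_B1 0 \<otimes> (Kap4, Inr Ob_uo)
     | [U_uo k] \<Rightarrow> U2_B k \<otimes> (Kap4, Inl Yb) + pred_case k (\<lambda>j. C_L j \<otimes> (Kap2, Inl Xb))
     | [U_uo k, Lam] \<Rightarrow> pred_case k (\<lambda>i. U2_B i \<otimes> (Kap4, Inl Ya) + pred_case i (\<lambda>j. C_L j \<otimes> (Kap2, Inl Xa)))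
     | [Lam, U_ou k] \<Rightarrow> pred_case k (\<lambda>i. U2_B i \<otimes> (Kap4, Inl Ya) + pred_case i (\<lambda>j. C_L j \<otimes> (Kap2, Inl Xa)))
     | _ \<Rightarrow> 0))"
  "all_composable A11 Ob_oo 4 (\<lambda>as. ops KN (Kap5, Inr Ob_oo) as = (case as of
       [U_oo k l] \<Rightarrow> polv C_AB (Kap5, Inr Ob_oo) (X1 ^ k * X2 ^ l) | _ \<Rightarrow> 0))"
  "all_composable A11 Ob_oo 4 (\<lambda>as. ops KN (Kap5, Inl Zc) as = (case as of
       [] \<Rightarrow> polv C_AB (Kap5, Inr Ob_oo) X1
     | [U_oo k l] \<Rightarrow> polv C_AB (Kap5, Inl Zc) (X1 ^ k * X2 ^ l + X2 * beta k l)
       + polv C_AB (Kap5, Inl Zd) (X2 * (X1 ^ k * X2 ^ l + X1 ^ l * X2 ^ k + X2 * beta k l)) | _ \<Rightarrow> 0))"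
  "all_composable A11 Ob_oo 4 (\<lambda>as. ops KN (Kap5, Inl Zd) as = (case as of
       [] \<Rightarrow> polv C_AB (Kap5, Inr Ob_oo) 1
     | [U_oo k l] \<Rightarrow> polv C_AB (Kap5, Inl Zc) (beta k l)
       + polv C_AB (Kap5, Inl Zd) (X1 ^ l * X2 ^ k + X2 * beta k l) | _ \<Rightarrow> 0))"
  by (simp_all add: shapes eval_nat_numeral ops_K_box box_eval ops_K ops_N' ops_X U2_B_case polv_add algebra_simps
        split: nat.split)

lemma all_obxgen:
  "(\<forall>m :: ob + xgen. P m) \<longleftrightarrow> P (Inl Ob_uu) \<and> P (Inl Ob_ou) \<and> P (Inl Ob_uo) \<and> P (Inl Ob_oo) \<and>
     P (Inr Xa) \<and> P (Inr Ya) \<and> P (Inr Xb) \<and> P (Inr Yb) \<and> P (Inr Zc) \<and> P (Inr Zd)"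
proof -
  have ob: "(\<forall>S. Q S) \<longleftrightarrow> Q Ob_uu \<and> Q Ob_ou \<and> Q Ob_uo \<and> Q Ob_oo" for Q
    by (metis ob.exhaust)
  have x: "(\<forall>S. Q S) \<longleftrightarrow> Q Xa \<and> Q Ya \<and> Q Xb \<and> Q Yb \<and> Q Zc \<and> Q Zd" for Q
    by (metis xgen.exhaust)
  show ?thesis
    unfolding split_sum_all ob x by simp
qed

lemma all_xgenob:
  "(\<forall>m :: xgen + ob. P m) \<longleftrightarrow> P (Inr Ob_uu) \<and> P (Inr Ob_ou) \<and> P (Inr Ob_uo) \<and> P (Inr Ob_oo) \<and>
     P (Inl Xa) \<and> P (Inl Ya) \<and> P (Inl Xb) \<and> P (Inl Yb) \<and> P (Inl Zc) \<and> P (Inl Zd)"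
proof -
  have ob: "(\<forall>S. Q S) \<longleftrightarrow> Q Ob_uu \<and> Q Ob_ou \<and> Q Ob_uo \<and> Q Ob_oo" for Q
    by (metis ob.exhaust)
  have x: "(\<forall>S. Q S) \<longleftrightarrow> Q Xa \<and> Q Ya \<and> Q Xb \<and> Q Yb \<and> Q Zc \<and> Q Zd" for Q
    by (metis xgen.exhaust)
  show ?thesis
    unfolding split_sum_all ob x by auto
qed

lemma all_kgen: "(\<forall>m. P m) \<longleftrightarrow> P Kap1 \<and> P Kap2 \<and> P Kap3 \<and> P Kap4 \<and> P Kap5"
  by (metis kgen.exhaust)

lemma all_lgen: "(\<forall>m. P m) \<longleftrightarrow> P Lam1 \<and> P Lam2 \<and> P Lam3 \<and> P Lam4 \<and> P Lam5"
  by (metis lgen.exhaust)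

lemma all_osz: "(\<forall>m. P m) \<longleftrightarrow> P S_none \<and> P S_A \<and> P W \<and> P N_B \<and> P N_AB"
  by (metis osz_gen.exhaust)

lemmas ops_KP_rules = ops_KP[THEN all_composableD]
lemmas ops_KN_rules = ops_KN[THEN all_composableD]

lemma Ball_box:
  "(\<forall>x\<in>gens (M \<boxtimes> N). Q x) \<longleftrightarrow> (\<forall>m\<in>gens M. \<forall>n\<in>gens N. rgt M m = lft N n \<longrightarrow> Q (m, n))"
  by auto

lemmas typed_KP = typed_box[OF typed_K typed_P'] and typed_KN = typed_box[OF typed_K typed_N']
  and typed_LP = typed_box[OF typed_L typed_POSz] and typed_LN = typed_box[OF typed_L typed_NOSz]

lemma proper_box_given:
  "proper KP" "proper KN" "proper LP" "proper LN"
  using proper_box[OF typed_K proper_given(1) typed_P'] proper_box[OF typed_K proper_given(1) typed_N']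
    proper_box[OF typed_L proper_given(2) typed_POSz] proper_box[OF typed_L proper_given(2) typed_NOSz]
  by simp_all

lemma all_UNIV: "(\<forall>x\<in>UNIV. Q x) \<longleftrightarrow> (\<forall>x. Q x)"
  by simp

lemma max_inputs_KP: "max_inputs 2 (ops KP)"
  by (rule max_inputsI[OF typed_KP proper_box_given(1)], unfold Ball_box gens_given all_UNIV all_kgen all_obxgen)
    (simp add: ops_KP_rules split: list.split alg.split)

lemma max_inputs_KN: "max_inputs 2 (ops KN)"
  by (rule max_inputsI[OF typed_KN proper_box_given(2)], unfold Ball_box gens_given all_UNIV all_kgen all_xgenob)
    (simp add: ops_KN_rules split: list.split alg.split)

lemma ops_KP_box:
  "ops (KP \<boxtimes> N) (m, n) as = (\<Sum>j\<le>2. box_from KP N j m [] n as)"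
  by (rule ops_box_product) (rule max_inputs_KP)

text \<open>
  No operation of \<open>\<K> \<boxtimes> P' \<boxtimes> \<L>\<close> has more than one input, although \<open>\<K>\<close> and \<open>P'\<close> have operations with two:
  all of these involve \<open>\<lambda>\<close>, which \<open>\<L>\<close> outputs without input. The same holds for \<open>N'\<close>.
\<close>

lemma ops_KPL:
  "all_composable Acan Ob_none 2 (\<lambda>as. ops KPL ((Kap1, Inl Ob_uu), Lam1) as = (case as of
       [C_none] \<Rightarrow> C_none \<otimes> ((Kap1, Inl Ob_uu), Lam1) | _ \<Rightarrow> 0))"
  "all_composable Acan Ob_A 2 (\<lambda>as. ops KPL ((Kap2, Inl Ob_ou), Lam2) as = (case as of
       [] \<Rightarrow> C_A 0 \<otimes> ((Kap2, Inr Xa), Lam2)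
     | [C_A k] \<Rightarrow> C_A k \<otimes> ((Kap2, Inl Ob_ou), Lam2)
     | [C_R k] \<Rightarrow> C_A k \<otimes> ((Kap2, Inl Ob_ou), Lam3) | _ \<Rightarrow> 0))"
  "all_composable Acan Ob_B 2 (\<lambda>as. ops KPL ((Kap2, Inl Ob_ou), Lam3) as = (case as of
       [] \<Rightarrow> C_A 0 \<otimes> ((Kap2, Inr Xa), Lam3)
     | [C_L k] \<Rightarrow> C_A (Suc k) \<otimes> ((Kap2, Inl Ob_ou), Lam2)
     | [C_B1 k] \<Rightarrow> C_A k \<otimes> ((Kap2, Inl Ob_ou), Lam3) | _ \<Rightarrow> 0))"
  "all_composable Acan Ob_A 2 (\<lambda>as. ops KPL ((Kap2, Inr Xa), Lam2) as = (case as of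
       [C_A k] \<Rightarrow> C_A k \<otimes> ((Kap2, Inr Xa), Lam2)
     | [C_R k] \<Rightarrow> C_A k \<otimes> ((Kap2, Inr Xa), Lam3) | _ \<Rightarrow> 0))"
  "all_composable Acan Ob_B 2 (\<lambda>as. ops KPL ((Kap2, Inr Xa), Lam3) as = (case as of
       [C_L k] \<Rightarrow> C_A (Suc k) \<otimes> ((Kap2, Inr Xa), Lam2)
     | [C_B1 k] \<Rightarrow> C_A k \<otimes> ((Kap2, Inr Xa), Lam3) | _ \<Rightarrow> 0))"
  "all_composable Acan Ob_B 2 (\<lambda>as. ops KPL ((Kap2, Inr Xb), Lam4) as = (case as of
       [C_L k] \<Rightarrow> C_A k \<otimes> ((Kap2, Inr Xa), Lam2)
     | [C_B1 k] \<Rightarrow> (case k of 0 \<Rightarrow> C_A 0 \<otimes> ((Kap2, Inr Xb), Lam4) | Suc j \<Rightarrow> C_A j \<otimes> ((Kap2, Inr Xa), Lam3))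
     | [C_B2 k] \<Rightarrow> C_A k \<otimes> ((Kap2, Inr Xa), Lam3) + C_A (Suc k) \<otimes> ((Kap2, Inr Xb), Lam4) | _ \<Rightarrow> 0))"
  "all_composable Acan Ob_B 2 (\<lambda>as. ops KPL ((Kap3, Inl Ob_uo), Lam4) as = (case as of
       [] \<Rightarrow> C_A 0 \<otimes> ((Kap2, Inl Ob_ou), Lam3) + C_A 0 \<otimes> ((Kap3, Inr Ya), Lam3) + C_R 0 \<otimes> ((Kap4, Inl Ob_uo), Lam4)
     | [C_B1 k] \<Rightarrow> (case k of 0 \<Rightarrow> C_A 0 \<otimes> ((Kap3, Inl Ob_uo), Lam4) | Suc j \<Rightarrow> 0) | _ \<Rightarrow> 0))"
  "all_composable Acan Ob_A 2 (\<lambda>as. ops KPL ((Kap3, Inr Ya), Lam2) as = (case as of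
       [] \<Rightarrow> C_A 0 \<otimes> ((Kap2, Inr Xa), Lam2) + C_R 0 \<otimes> ((Kap4, Inr Ya), Lam2)
     | [C_A k] \<Rightarrow> (if k = 0 then C_A 0 \<otimes> ((Kap3, Inr Ya), Lam2) else 0)
     | [C_R k] \<Rightarrow> (if k = 0 then C_A 0 \<otimes> ((Kap3, Inr Ya), Lam3) else 0) | _ \<Rightarrow> 0))"
  "all_composable Acan Ob_B 2 (\<lambda>as. ops KPL ((Kap3, Inr Ya), Lam3) as = (case as of
       [] \<Rightarrow> C_A 0 \<otimes> ((Kap2, Inr Xa), Lam3) + C_R 0 \<otimes> ((Kap4, Inr Ya), Lam3)
     | [C_B1 k] \<Rightarrow> (if k = 0 then C_A 0 \<otimes> ((Kap3, Inr Ya), Lam3) else 0) | _ \<Rightarrow> 0))"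
  "all_composable Acan Ob_B 2 (\<lambda>as. ops KPL ((Kap3, Inr Yb), Lam4) as = (case as of
       [] \<Rightarrow> C_A 0 \<otimes> ((Kap2, Inr Xb), Lam4) + C_R 0 \<otimes> ((Kap4, Inr Yb), Lam4)
     | [C_L k] \<Rightarrow> (if k = 0 then C_A 0 \<otimes> ((Kap3, Inr Ya), Lam2) else 0)
     | [C_B1 k] \<Rightarrow> (case k of 0 \<Rightarrow> C_A 0 \<otimes> ((Kap3, Inr Yb), Lam4) | Suc j \<Rightarrow> if j = 0 then C_A 0 \<otimes> ((Kap3, Inr Ya), Lam3) else 0)
     | [C_B2 k] \<Rightarrow> (if k = 0 then C_A 0 \<otimes> ((Kap3, Inr Ya), Lam3) else 0) | _ \<Rightarrow> 0))"
  "all_composable Acan Ob_B 2 (\<lambda>as. ops KPL ((Kap4, Inl Ob_uo), Lam4) as = (case as of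
       [] \<Rightarrow> C_B1 0 \<otimes> ((Kap4, Inr Ya), Lam3) + C_B2 0 \<otimes> ((Kap4, Inr Yb), Lam4)
     | [C_L k] \<Rightarrow> C_L k \<otimes> ((Kap2, Inl Ob_ou), Lam2)
     | [C_B1 k] \<Rightarrow> (case k of 0 \<Rightarrow> C_B1 0 \<otimes> ((Kap4, Inl Ob_uo), Lam4) | Suc j \<Rightarrow> C_L j \<otimes> ((Kap2, Inl Ob_ou), Lam3))
     | [C_B2 k] \<Rightarrow> C_B2 k \<otimes> ((Kap4, Inl Ob_uo), Lam4) | _ \<Rightarrow> 0))"
  "all_composable Acan Ob_A 2 (\<lambda>as. ops KPL ((Kap4, Inr Ya), Lam2) as = (case as of
       [C_A k] \<Rightarrow> U2_B k \<otimes> ((Kap4, Inr Ya), Lam2) + pred_case k (\<lambda>j. C_L j \<otimes> ((Kap2, Inr Xa), Lam2))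
     | [C_R k] \<Rightarrow> U2_B k \<otimes> ((Kap4, Inr Ya), Lam3) + pred_case k (\<lambda>j. C_L j \<otimes> ((Kap2, Inr Xa), Lam3)) | _ \<Rightarrow> 0))"
  "all_composable Acan Ob_B 2 (\<lambda>as. ops KPL ((Kap4, Inr Ya), Lam3) as = (case as of
       [C_L k] \<Rightarrow> C_B2 k \<otimes> ((Kap4, Inr Ya), Lam2) + C_L k \<otimes> ((Kap2, Inr Xa), Lam2)
     | [C_B1 k] \<Rightarrow> U2_B k \<otimes> ((Kap4, Inr Ya), Lam3) + pred_case k (\<lambda>j. C_L j \<otimes> ((Kap2, Inr Xa), Lam3)) | _ \<Rightarrow> 0))"
  "all_composable Acan Ob_B 2 (\<lambda>as. ops KPL ((Kap4, Inr Yb), Lam4) as = (case as of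
       [C_L k] \<Rightarrow> U2_B k \<otimes> ((Kap4, Inr Ya), Lam2) + pred_case k (\<lambda>j. C_L j \<otimes> ((Kap2, Inr Xa), Lam2))
     | [C_B1 k] \<Rightarrow> (case k of 0 \<Rightarrow> C_B1 0 \<otimes> ((Kap4, Inr Yb), Lam4) | Suc j \<Rightarrow> U2_B j \<otimes> ((Kap4, Inr Ya), Lam3) + pred_case j (\<lambda>i. C_L i \<otimes> ((Kap2, Inr Xa), Lam3)))
     | [C_B2 k] \<Rightarrow> U2_B k \<otimes> ((Kap4, Inr Ya), Lam3) + pred_case k (\<lambda>j. C_L j \<otimes> ((Kap2, Inr Xa), Lam3))
         + C_B2 k \<otimes> ((Kap4, Inr Yb), Lam4) + C_L k \<otimes> ((Kap2, Inr Xb), Lam4) | _ \<Rightarrow> 0))"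
  "all_composable Acan Ob_AB 2 (\<lambda>as. ops KPL ((Kap5, Inl Ob_oo), Lam5) as = (case as of
       [] \<Rightarrow> polv C_AB ((Kap5, Inr Zc), Lam5) 1 + polv C_AB ((Kap5, Inr Zd), Lam5) X2
     | [C_AB k l] \<Rightarrow> polv C_AB ((Kap5, Inl Ob_oo), Lam5) (X1 ^ k * X2 ^ l) | _ \<Rightarrow> 0))"
  "all_composable Acan Ob_AB 2 (\<lambda>as. ops KPL ((Kap5, Inr Zc), Lam5) as = (case as of
       [C_AB k l] \<Rightarrow> polv C_AB ((Kap5, Inr Zc), Lam5) (X1 ^ k * X2 ^ l + X2 * beta k l)
         + polv C_AB ((Kap5, Inr Zd), Lam5) (X2 * (X1 ^ k * X2 ^ l + X1 ^ l * X2 ^ k + X2 * beta k l)) | _ \<Rightarrow> 0))"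
  "all_composable Acan Ob_AB 2 (\<lambda>as. ops KPL ((Kap5, Inr Zd), Lam5) as = (case as of
       [C_AB k l] \<Rightarrow> polv C_AB ((Kap5, Inr Zc), Lam5) (beta k l)
         + polv C_AB ((Kap5, Inr Zd), Lam5) (X1 ^ l * X2 ^ k + X2 * beta k l) | _ \<Rightarrow> 0))"
  by (simp_all add: shapes eval_nat_numeral ops_KP_box box_eval ops_L ops_KP_rules U2_B_case polv_add algebra_simps
        split: nat.split)

lemma ops_KN_box:
  "ops (KN \<boxtimes> N) (m, n) as = (\<Sum>j\<le>2. box_from KN N j m [] n as)"
  by (rule ops_box_product) (rule max_inputs_KN)

lemma ops_KNL:
  "all_composable Acan Ob_none 2 (\<lambda>as. ops KNL ((Kap1, Inr Ob_uu), Lam1) as = (case as of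
       [C_none] \<Rightarrow> C_none \<otimes> ((Kap1, Inr Ob_uu), Lam1) | _ \<Rightarrow> 0))"
  "all_composable Acan Ob_A 2 (\<lambda>as. ops KNL ((Kap2, Inr Ob_ou), Lam2) as = (case as of
       [C_A k] \<Rightarrow> C_A k \<otimes> ((Kap2, Inr Ob_ou), Lam2)
     | [C_R k] \<Rightarrow> C_A k \<otimes> ((Kap2, Inr Ob_ou), Lam3) | _ \<Rightarrow> 0))"
  "all_composable Acan Ob_B 2 (\<lambda>as. ops KNL ((Kap2, Inr Ob_ou), Lam3) as = (case as of
       [C_L k] \<Rightarrow> C_A (Suc k) \<otimes> ((Kap2, Inr Ob_ou), Lam2)
     | [C_B1 k] \<Rightarrow> C_A k \<otimes> ((Kap2, Inr Ob_ou), Lam3) | _ \<Rightarrow> 0))"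
  "all_composable Acan Ob_A 2 (\<lambda>as. ops KNL ((Kap2, Inl Xa), Lam2) as = (case as of
       [] \<Rightarrow> C_A 1 \<otimes> ((Kap2, Inr Ob_ou), Lam2)
     | [C_A k] \<Rightarrow> C_A k \<otimes> ((Kap2, Inl Xa), Lam2)
     | [C_R k] \<Rightarrow> C_A k \<otimes> ((Kap2, Inl Xa), Lam3) | _ \<Rightarrow> 0))"
  "all_composable Acan Ob_B 2 (\<lambda>as. ops KNL ((Kap2, Inl Xa), Lam3) as = (case as of
       [] \<Rightarrow> C_A 1 \<otimes> ((Kap2, Inr Ob_ou), Lam3)
     | [C_L k] \<Rightarrow> C_A (Suc k) \<otimes> ((Kap2, Inl Xa), Lam2)
     | [C_B1 k] \<Rightarrow> C_A k \<otimes> ((Kap2, Inl Xa), Lam3) | _ \<Rightarrow> 0))"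
  "all_composable Acan Ob_B 2 (\<lambda>as. ops KNL ((Kap2, Inl Xb), Lam4) as = (case as of
       [] \<Rightarrow> C_A 0 \<otimes> ((Kap2, Inr Ob_ou), Lam3)
     | [C_L k] \<Rightarrow> C_A k \<otimes> ((Kap2, Inl Xa), Lam2)
     | [C_B1 k] \<Rightarrow> (case k of 0 \<Rightarrow> C_A 0 \<otimes> ((Kap2, Inl Xb), Lam4) | Suc j \<Rightarrow> C_A j \<otimes> ((Kap2, Inl Xa), Lam3))
     | [C_B2 k] \<Rightarrow> C_A k \<otimes> ((Kap2, Inl Xa), Lam3) + C_A (Suc k) \<otimes> ((Kap2, Inl Xb), Lam4) | _ \<Rightarrow> 0))"
  "all_composable Acan Ob_B 2 (\<lambda>as. ops KNL ((Kap3, Inr Ob_uo), Lam4) as = (case as of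
       [] \<Rightarrow> C_A 0 \<otimes> ((Kap2, Inr Ob_ou), Lam3) + C_R 0 \<otimes> ((Kap4, Inr Ob_uo), Lam4)
     | [C_B1 k] \<Rightarrow> (case k of 0 \<Rightarrow> C_A 0 \<otimes> ((Kap3, Inr Ob_uo), Lam4) | Suc j \<Rightarrow> 0) | _ \<Rightarrow> 0))"
  "all_composable Acan Ob_A 2 (\<lambda>as. ops KNL ((Kap3, Inl Ya), Lam2) as = (case as of
       [] \<Rightarrow> C_A 0 \<otimes> ((Kap2, Inl Xa), Lam2) + C_R 0 \<otimes> ((Kap4, Inl Ya), Lam2)
     | [C_A k] \<Rightarrow> (if k = 0 then C_A 0 \<otimes> ((Kap3, Inl Ya), Lam2) else 0)
     | [C_R k] \<Rightarrow> (if k = 0 then C_A 0 \<otimes> ((Kap3, Inl Ya), Lam3) else 0) | _ \<Rightarrow> 0))"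
  "all_composable Acan Ob_B 2 (\<lambda>as. ops KNL ((Kap3, Inl Ya), Lam3) as = (case as of
       [] \<Rightarrow> C_A 0 \<otimes> ((Kap2, Inl Xa), Lam3) + C_R 0 \<otimes> ((Kap4, Inl Ya), Lam3)
     | [C_B1 k] \<Rightarrow> (if k = 0 then C_A 0 \<otimes> ((Kap3, Inl Ya), Lam3) else 0) | _ \<Rightarrow> 0))"
  "all_composable Acan Ob_B 2 (\<lambda>as. ops KNL ((Kap3, Inl Yb), Lam4) as = (case as of
       [] \<Rightarrow> C_A 0 \<otimes> ((Kap2, Inl Xb), Lam4) + C_A 0 \<otimes> ((Kap3, Inr Ob_uo), Lam4) + C_R 0 \<otimes> ((Kap4, Inl Yb), Lam4)
     | [C_L k] \<Rightarrow> (if k = 0 then C_A 0 \<otimes> ((Kap3, Inl Ya), Lam2) else 0)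
     | [C_B1 k] \<Rightarrow> (case k of 0 \<Rightarrow> C_A 0 \<otimes> ((Kap3, Inl Yb), Lam4) | Suc j \<Rightarrow> if j = 0 then C_A 0 \<otimes> ((Kap3, Inl Ya), Lam3) else 0)
     | [C_B2 k] \<Rightarrow> (if k = 0 then C_A 0 \<otimes> ((Kap3, Inl Ya), Lam3) else 0) | _ \<Rightarrow> 0))"
  "all_composable Acan Ob_B 2 (\<lambda>as. ops KNL ((Kap4, Inr Ob_uo), Lam4) as = (case as of
       [C_L k] \<Rightarrow> C_L k \<otimes> ((Kap2, Inr Ob_ou), Lam2)
     | [C_B1 k] \<Rightarrow> (case k of 0 \<Rightarrow> C_B1 0 \<otimes> ((Kap4, Inr Ob_uo), Lam4) | Suc j \<Rightarrow> C_L j \<otimes> ((Kap2, Inr Ob_ou), Lam3))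
     | [C_B2 k] \<Rightarrow> C_B2 k \<otimes> ((Kap4, Inr Ob_uo), Lam4) | _ \<Rightarrow> 0))"
  "all_composable Acan Ob_A 2 (\<lambda>as. ops KNL ((Kap4, Inl Ya), Lam2) as = (case as of
       [] \<Rightarrow> C_L 0 \<otimes> ((Kap2, Inr Ob_ou), Lam2)
     | [C_A k] \<Rightarrow> U2_B k \<otimes> ((Kap4, Inl Ya), Lam2) + pred_case k (\<lambda>j. C_L j \<otimes> ((Kap2, Inl Xa), Lam2))
     | [C_R k] \<Rightarrow> U2_B k \<otimes> ((Kap4, Inl Ya), Lam3) + pred_case k (\<lambda>j. C_L j \<otimes> ((Kap2, Inl Xa), Lam3)) | _ \<Rightarrow> 0))"
  "all_composable Acan Ob_B 2 (\<lambda>as. ops KNL ((Kap4, Inl Ya), Lam3) as = (case as of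
       [] \<Rightarrow> C_L 0 \<otimes> ((Kap2, Inr Ob_ou), Lam3)
     | [C_L k] \<Rightarrow> C_B2 k \<otimes> ((Kap4, Inl Ya), Lam2) + C_L k \<otimes> ((Kap2, Inl Xa), Lam2)
     | [C_B1 k] \<Rightarrow> U2_B k \<otimes> ((Kap4, Inl Ya), Lam3) + pred_case k (\<lambda>j. C_L j \<otimes> ((Kap2, Inl Xa), Lam3)) | _ \<Rightarrow> 0))"
  "all_composable Acan Ob_B 2 (\<lambda>as. ops KNL ((Kap4, Inl Yb), Lam4) as = (case as of
       [] \<Rightarrow> C_B1 0 \<otimes> ((Kap4, Inr Ob_uo), Lam4)
     | [C_L k] \<Rightarrow> U2_B k \<otimes> ((Kap4, Inl Ya), Lam2) + pred_case k (\<lambda>j. C_L j \<otimes> ((Kap2, Inl Xa), Lam2))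
     | [C_B1 k] \<Rightarrow> (case k of 0 \<Rightarrow> C_B1 0 \<otimes> ((Kap4, Inl Yb), Lam4) | Suc j \<Rightarrow> U2_B j \<otimes> ((Kap4, Inl Ya), Lam3) + pred_case j (\<lambda>i. C_L i \<otimes> ((Kap2, Inl Xa), Lam3)))
     | [C_B2 k] \<Rightarrow> U2_B k \<otimes> ((Kap4, Inl Ya), Lam3) + pred_case k (\<lambda>j. C_L j \<otimes> ((Kap2, Inl Xa), Lam3))
         + C_B2 k \<otimes> ((Kap4, Inl Yb), Lam4) + C_L k \<otimes> ((Kap2, Inl Xb), Lam4) | _ \<Rightarrow> 0))"
  "all_composable Acan Ob_AB 2 (\<lambda>as. ops KNL ((Kap5, Inr Ob_oo), Lam5) as = (case as of
       [C_AB k l] \<Rightarrow> polv C_AB ((Kap5, Inr Ob_oo), Lam5) (X1 ^ k * X2 ^ l) | _ \<Rightarrow> 0))"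
  "all_composable Acan Ob_AB 2 (\<lambda>as. ops KNL ((Kap5, Inl Zc), Lam5) as = (case as of
       [] \<Rightarrow> polv C_AB ((Kap5, Inr Ob_oo), Lam5) X1
     | [C_AB k l] \<Rightarrow> polv C_AB ((Kap5, Inl Zc), Lam5) (X1 ^ k * X2 ^ l + X2 * beta k l)
         + polv C_AB ((Kap5, Inl Zd), Lam5) (X2 * (X1 ^ k * X2 ^ l + X1 ^ l * X2 ^ k + X2 * beta k l)) | _ \<Rightarrow> 0))"
  "all_composable Acan Ob_AB 2 (\<lambda>as. ops KNL ((Kap5, Inl Zd), Lam5) as = (case as of
       [] \<Rightarrow> polv C_AB ((Kap5, Inr Ob_oo), Lam5) 1
     | [C_AB k l] \<Rightarrow> polv C_AB ((Kap5, Inl Zc), Lam5) (beta k l)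
         + polv C_AB ((Kap5, Inl Zd), Lam5) (X1 ^ l * X2 ^ k + X2 * beta k l) | _ \<Rightarrow> 0))"
  by (simp_all add: shapes eval_nat_numeral ops_KN_box box_eval ops_L ops_KN_rules U2_B_case polv_add algebra_simps
        split: nat.split)

lemma ops_LP:
  "all_composable Acan Ob_none 2 (\<lambda>as. ops LP (Lam1, S_none) as =
     (case as of [C_none] \<Rightarrow> E_uu \<otimes> (Lam1, S_none) | _ \<Rightarrow> 0))"
  "all_composable Acan Ob_A 2 (\<lambda>as. ops LP (Lam2, S_A) as = (case as of
       [] \<Rightarrow> U_ou 0 \<otimes> (Lam3, W)
     | [C_A k] \<Rightarrow> (if k = 0 then U_ou 0 \<otimes> (Lam2, S_A) else 0) | _ \<Rightarrow> 0))"
  "all_composable Acan Ob_A 2 (\<lambda>as. ops LP (Lam3, W) as = (case as of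
       [C_A k] \<Rightarrow> (if k = 0 then U_ou 0 \<otimes> (Lam3, W) else 0) | _ \<Rightarrow> 0))"
  "all_composable Acan Ob_B 2 (\<lambda>as. ops LP (Lam3, N_B) as = (case as of
       [C_L k] \<Rightarrow> (if k = 0 then U_ou 0 \<otimes> (Lam3, W) else 0)
     | [C_B1 k] \<Rightarrow> (if k = 0 then U_ou 0 \<otimes> (Lam3, N_B) else 0)
     | [C_B2 k] \<Rightarrow> U_ou (Suc k) \<otimes> (Lam3, N_B)
     | [C_B2 k, C_L l] \<Rightarrow> (if l = 0 then U_ou (Suc k) \<otimes> (Lam2, S_A) else 0) | _ \<Rightarrow> 0))"
  "all_composable Acan Ob_A 2 (\<lambda>as. ops LP (Lam4, W) as = (case as of
       [] \<Rightarrow> Lam \<otimes> (Lam3, W) | [C_A k] \<Rightarrow> U_uo k \<otimes> (Lam4, W)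
     | [C_R k] \<Rightarrow> U_uo (Suc k) \<otimes> (Lam4, N_B) | _ \<Rightarrow> 0))"
  "all_composable Acan Ob_B 2 (\<lambda>as. ops LP (Lam4, N_B) as = (case as of
       [] \<Rightarrow> Lam \<otimes> (Lam3, N_B) | [C_L k] \<Rightarrow> U_uo k \<otimes> (Lam4, W)
     | [C_B1 k] \<Rightarrow> U_uo k \<otimes> (Lam4, N_B) | _ \<Rightarrow> 0))"
  "all_composable Acan Ob_AB 2 (\<lambda>as. ops LP (Lam5, N_AB) as = (case as of
       [C_AB k l] \<Rightarrow> polv U_oo (Lam5, N_AB) (X1 ^ l * X2 ^ k) | _ \<Rightarrow> 0))"
  by (simp_all add: shapes eval_nat_numeral ops_L_box box_eval ops_L ops_POSz polv_add algebra_simps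
        split: nat.split list.split)

lemma ops_LN:
  "all_composable Acan Ob_none 2 (\<lambda>as. ops LN (Lam1, S_none) as =
     (case as of [C_none] \<Rightarrow> E_uu \<otimes> (Lam1, S_none) | _ \<Rightarrow> 0))"
  "all_composable Acan Ob_A 2 (\<lambda>as. ops LN (Lam2, S_A) as = (case as of
       [C_A k] \<Rightarrow> (if k = 0 then U_ou 0 \<otimes> (Lam2, S_A) else 0)
     | [C_R k, C_B2 l] \<Rightarrow> (if k = 0 then U_ou l \<otimes> (Lam3, N_B) else 0) | _ \<Rightarrow> 0))"
  "all_composable Acan Ob_A 2 (\<lambda>as. ops LN (Lam3, W) as = (case as of
       [] \<Rightarrow> U_ou 1 \<otimes> (Lam2, S_A)
     | [C_A k] \<Rightarrow> (if k = 0 then U_ou 0 \<otimes> (Lam3, W) else 0)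
     | [C_R k] \<Rightarrow> (if k = 0 then U_ou 0 \<otimes> (Lam3, N_B) else 0) | _ \<Rightarrow> 0))"
  "all_composable Acan Ob_B 2 (\<lambda>as. ops LN (Lam3, N_B) as = (case as of
       [C_B1 k] \<Rightarrow> (if k = 0 then U_ou 0 \<otimes> (Lam3, N_B) else 0)
     | [C_B2 k] \<Rightarrow> U_ou (Suc k) \<otimes> (Lam3, N_B) | _ \<Rightarrow> 0))"
  "all_composable Acan Ob_A 2 (\<lambda>as. ops LN (Lam4, W) as = (case as of
       [] \<Rightarrow> Lam \<otimes> (Lam3, W) | [C_A k] \<Rightarrow> U_uo k \<otimes> (Lam4, W)
     | [C_R k] \<Rightarrow> U_uo k \<otimes> (Lam4, N_B) | _ \<Rightarrow> 0))"
  "all_composable Acan Ob_B 2 (\<lambda>as. ops LN (Lam4, N_B) as = (case as of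
       [] \<Rightarrow> Lam \<otimes> (Lam3, N_B) | [C_L k] \<Rightarrow> U_uo (Suc k) \<otimes> (Lam4, W)
     | [C_B1 k] \<Rightarrow> U_uo k \<otimes> (Lam4, N_B) | _ \<Rightarrow> 0))"
  "all_composable Acan Ob_AB 2 (\<lambda>as. ops LN (Lam5, N_AB) as = (case as of
       [C_AB k l] \<Rightarrow> polv U_oo (Lam5, N_AB) (X1 ^ l * X2 ^ k) | _ \<Rightarrow> 0))"
  by (simp_all add: shapes eval_nat_numeral ops_L_box box_eval ops_L ops_NOSz polv_add algebra_simps
        split: nat.split list.split)

lemmas ops_LP_rules = ops_LP[THEN all_composableD]
lemmas ops_LN_rules = ops_LN[THEN all_composableD]

lemma max_inputs_LP: "max_inputs 2 (ops LP)"
  by (rule max_inputsI[OF typed_LP proper_box_given(3)], unfold Ball_box gens_given all_UNIV all_lgen all_osz)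
    (simp add: ops_LP_rules split: list.split can.split)

lemma max_inputs_LN: "max_inputs 2 (ops LN)"
  by (rule max_inputsI[OF typed_LN proper_box_given(4)], unfold Ball_box gens_given all_UNIV all_lgen all_osz)
    (simp add: ops_LN_rules split: list.split can.split)

lemma ops_LP_box:
  "ops (LP \<boxtimes> N) (m, n) as = (\<Sum>j\<le>2. box_from LP N j m [] n as)"
  by (rule ops_box_product) (rule max_inputs_LP)

lemma ops_LN_box:
  "ops (LN \<boxtimes> N) (m, n) as = (\<Sum>j\<le>2. box_from LN N j m [] n as)"
  by (rule ops_box_product) (rule max_inputs_LN)

lemma ops_LPK:
  "all_composable A11 Ob_uu 4 (\<lambda>as. ops LPK ((Lam1, S_none), Kap1) as =
     (case as of [E_uu] \<Rightarrow> E_uu \<otimes> ((Lam1, S_none), Kap1) | _ \<Rightarrow> 0))"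
  "all_composable A11 Ob_ou 4 (\<lambda>as. ops LPK ((Lam2, S_A), Kap2) as = (case as of
       [] \<Rightarrow> U_ou 0 \<otimes> ((Lam3, W), Kap2)
     | [U_ou k] \<Rightarrow> (if k = 0 then U_ou 0 \<otimes> ((Lam2, S_A), Kap2) else 0) | _ \<Rightarrow> 0))"
  "all_composable A11 Ob_uo 4 (\<lambda>as. ops LPK ((Lam2, S_A), Kap3) as = (case as of
       [] \<Rightarrow> U_ou 0 \<otimes> ((Lam3, W), Kap3)
     | [U_uo k] \<Rightarrow> (if k = 0 then U_ou 0 \<otimes> ((Lam2, S_A), Kap3) else 0)
     | [Lam] \<Rightarrow> U_ou 0 \<otimes> ((Lam2, S_A), Kap2) | _ \<Rightarrow> 0))"
  "all_composable A11 Ob_ou 4 (\<lambda>as. ops LPK ((Lam3, W), Kap2) as = (case as of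
       [U_ou k] \<Rightarrow> (if k = 0 then U_ou 0 \<otimes> ((Lam3, W), Kap2) else 0) | _ \<Rightarrow> 0))"
  "all_composable A11 Ob_uo 4 (\<lambda>as. ops LPK ((Lam3, W), Kap3) as = (case as of
       [U_uo k] \<Rightarrow> (if k = 0 then U_ou 0 \<otimes> ((Lam3, W), Kap3) else 0)
     | [Lam] \<Rightarrow> U_ou 0 \<otimes> ((Lam3, W), Kap2) | _ \<Rightarrow> 0))"
  "all_composable A11 Ob_uo 4 (\<lambda>as. ops LPK ((Lam3, N_B), Kap4) as = (case as of
       [U_uo k] \<Rightarrow> U_ou k \<otimes> ((Lam3, N_B), Kap4)
     | [Lam, U_ou k] \<Rightarrow> (if k = 1 then U_ou 0 \<otimes> ((Lam3, W), Kap2) else 0)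
     | [U_uo k, Lam, U_ou l] \<Rightarrow> (if k \<noteq> 0 \<and> l = 1 then U_ou k \<otimes> ((Lam2, S_A), Kap2) else 0) | _ \<Rightarrow> 0))"
  "all_composable A11 Ob_ou 4 (\<lambda>as. ops LPK ((Lam4, W), Kap2) as = (case as of
       [] \<Rightarrow> Lam \<otimes> ((Lam3, W), Kap2) | [U_ou k] \<Rightarrow> U_uo k \<otimes> ((Lam4, W), Kap2) | _ \<Rightarrow> 0))"
  "all_composable A11 Ob_uo 4 (\<lambda>as. ops LPK ((Lam4, W), Kap3) as = (case as of
       [] \<Rightarrow> Lam \<otimes> ((Lam3, W), Kap3) + U_uo 1 \<otimes> ((Lam4, N_B), Kap4)
     | [U_uo k] \<Rightarrow> (if k = 0 then U_uo 0 \<otimes> ((Lam4, W), Kap3) else 0)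
     | [Lam] \<Rightarrow> U_uo 0 \<otimes> ((Lam4, W), Kap2) | _ \<Rightarrow> 0))"
  "all_composable A11 Ob_uo 4 (\<lambda>as. ops LPK ((Lam4, N_B), Kap4) as = (case as of
       [] \<Rightarrow> Lam \<otimes> ((Lam3, N_B), Kap4)
     | [U_uo k] \<Rightarrow> (if k = 0 then U_uo 0 \<otimes> ((Lam4, N_B), Kap4) else 0)
     | [Lam, U_ou k] \<Rightarrow> pred_case k (\<lambda>j. U_uo j \<otimes> ((Lam4, W), Kap2)) | _ \<Rightarrow> 0))"
  "all_composable A11 Ob_oo 4 (\<lambda>as. ops LPK ((Lam5, N_AB), Kap5) as = (case as of
       [U_oo k l] \<Rightarrow> polv U_oo ((Lam5, N_AB), Kap5) (X1 ^ l * X2 ^ k) | _ \<Rightarrow> 0))"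
  by (simp_all add: shapes eval_nat_numeral ops_LP_box box_eval ops_K ops_LP_rules polv_add algebra_simps
        split: nat.split)

lemma ops_LNK:
  "all_composable A11 Ob_uu 4 (\<lambda>as. ops LNK ((Lam1, S_none), Kap1) as =
     (case as of [E_uu] \<Rightarrow> E_uu \<otimes> ((Lam1, S_none), Kap1) | _ \<Rightarrow> 0))"
  "all_composable A11 Ob_ou 4 (\<lambda>as. ops LNK ((Lam2, S_A), Kap2) as = (case as of
       [U_ou k] \<Rightarrow> (if k = 0 then U_ou 0 \<otimes> ((Lam2, S_A), Kap2) else 0) | _ \<Rightarrow> 0))"
  "all_composable A11 Ob_uo 4 (\<lambda>as. ops LNK ((Lam2, S_A), Kap3) as = (case as of
       [U_uo k] \<Rightarrow> (case k of 0 \<Rightarrow> U_ou 0 \<otimes> ((Lam2, S_A), Kap3) | Suc j \<Rightarrow> U_ou j \<otimes> ((Lam3, N_B), Kap4))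
     | [Lam] \<Rightarrow> U_ou 0 \<otimes> ((Lam2, S_A), Kap2) | _ \<Rightarrow> 0))"
  "all_composable A11 Ob_ou 4 (\<lambda>as. ops LNK ((Lam3, W), Kap2) as = (case as of
       [] \<Rightarrow> U_ou 1 \<otimes> ((Lam2, S_A), Kap2)
     | [U_ou k] \<Rightarrow> (if k = 0 then U_ou 0 \<otimes> ((Lam3, W), Kap2) else 0) | _ \<Rightarrow> 0))"
  "all_composable A11 Ob_uo 4 (\<lambda>as. ops LNK ((Lam3, W), Kap3) as = (case as of
       [] \<Rightarrow> U_ou 1 \<otimes> ((Lam2, S_A), Kap3) + U_ou 0 \<otimes> ((Lam3, N_B), Kap4)
     | [U_uo k] \<Rightarrow> (if k = 0 then U_ou 0 \<otimes> ((Lam3, W), Kap3) else 0)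
     | [Lam] \<Rightarrow> U_ou 0 \<otimes> ((Lam3, W), Kap2) | _ \<Rightarrow> 0))"
  "all_composable A11 Ob_uo 4 (\<lambda>as. ops LNK ((Lam3, N_B), Kap4) as = (case as of
       [U_uo k] \<Rightarrow> U_ou k \<otimes> ((Lam3, N_B), Kap4) | _ \<Rightarrow> 0))"
  "all_composable A11 Ob_ou 4 (\<lambda>as. ops LNK ((Lam4, W), Kap2) as = (case as of
       [] \<Rightarrow> Lam \<otimes> ((Lam3, W), Kap2) | [U_ou k] \<Rightarrow> U_uo k \<otimes> ((Lam4, W), Kap2) | _ \<Rightarrow> 0))"
  "all_composable A11 Ob_uo 4 (\<lambda>as. ops LNK ((Lam4, W), Kap3) as = (case as of
       [] \<Rightarrow> Lam \<otimes> ((Lam3, W), Kap3) + U_uo 0 \<otimes> ((Lam4, N_B), Kap4)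
     | [U_uo k] \<Rightarrow> (if k = 0 then U_uo 0 \<otimes> ((Lam4, W), Kap3) else 0)
     | [Lam] \<Rightarrow> U_uo 0 \<otimes> ((Lam4, W), Kap2) | _ \<Rightarrow> 0))"
  "all_composable A11 Ob_uo 4 (\<lambda>as. ops LNK ((Lam4, N_B), Kap4) as = (case as of
       [] \<Rightarrow> Lam \<otimes> ((Lam3, N_B), Kap4)
     | [U_uo k] \<Rightarrow> (if k = 0 then U_uo 0 \<otimes> ((Lam4, N_B), Kap4) else 0)
     | [Lam, U_ou k] \<Rightarrow> (if k \<noteq> 0 then U_uo k \<otimes> ((Lam4, W), Kap2) else 0) | _ \<Rightarrow> 0))"
  "all_composable A11 Ob_oo 4 (\<lambda>as. ops LNK ((Lam5, N_AB), Kap5) as = (case as of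
       [U_oo k l] \<Rightarrow> polv U_oo ((Lam5, N_AB), Kap5) (X1 ^ l * X2 ^ k) | _ \<Rightarrow> 0))"
  by (simp_all add: shapes eval_nat_numeral ops_LN_box box_eval ops_K ops_LN_rules polv_add algebra_simps
        split: nat.split)

lemmas ops_KPL_rules = ops_KPL[THEN all_composableD]
lemmas ops_KNL_rules = ops_KNL[THEN all_composableD]
lemmas ops_LPK_rules = ops_LPK[THEN all_composableD]
lemmas ops_LNK_rules = ops_LNK[THEN all_composableD]

section \<open>Bounds for the triple products\<close>

lemma max_inputs_KPL: "max_inputs 1 (ops KPL)"
  by (rule max_inputsI[OF typed_box[OF typed_KP typed_L] proper_box[OF typed_KP proper_box_given(1) typed_L gens_given(2)]],
      unfold Ball_box gens_given all_UNIV all_kgen all_obxgen all_lgen)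
    (simp add: ops_KPL_rules split: list.split can.split)

lemma max_inputs_KNL: "max_inputs 1 (ops KNL)"
  by (rule max_inputsI[OF typed_box[OF typed_KN typed_L] proper_box[OF typed_KN proper_box_given(2) typed_L gens_given(2)]],
      unfold Ball_box gens_given all_UNIV all_kgen all_xgenob all_lgen)
    (simp add: ops_KNL_rules split: list.split can.split)

lemma max_inputs_LPK: "max_inputs 3 (ops LPK)"
  by (rule max_inputsI[OF typed_box[OF typed_LP typed_K] proper_box[OF typed_LP proper_box_given(3) typed_K gens_given(1)]],
      unfold Ball_box gens_given all_UNIV all_kgen all_osz all_lgen)
    (simp add: ops_LPK_rules split: list.split alg.split)

lemma max_inputs_LNK: "max_inputs 2 (ops LNK)"
  by (rule max_inputsI[OF typed_box[OF typed_LN typed_K] proper_box[OF typed_LN proper_box_given(4) typed_K gens_given(1)]],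
      unfold Ball_box gens_given all_UNIV all_kgen all_osz all_lgen)
    (simp add: ops_LNK_rules split: list.split alg.split)

section \<open>The structure relations\<close>

lemma degrees [simp]:
  "qgr K_bimod = (\<lambda>m. if m = Kap3 then -1 else 0)" "hgr K_bimod = (\<lambda>_. 0)"
  "qgr L_bimod = (\<lambda>m. if m = Lam3 then -1 else 0)" "hgr L_bimod = (\<lambda>m. if m = Lam3 then 1 else 0)"
  "qgr P_OSz = POSz_qgr" "hgr P_OSz = POSz_hgr" "qgr N_OSz = NOSz_qgr" "hgr N_OSz = NOSz_hgr"
  "qgr P' (Inl S) = -1" "hgr P' (Inl S) = 0" "qgr P' (Inr x) = X_qgr x" "hgr P' (Inr x) = X_hgr x - 1"
  "qgr N' (Inr S) = 1" "hgr N' (Inr S) = 0" "qgr N' (Inl x) = X_qgr x" "hgr N' (Inl x) = X_hgr x - 1"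
  by (simp_all add: K_bimod_def L_bimod_def P_OSz_def N_OSz_def P'_def N'_def cone_def shift_def
      id_bimod_def X_bimod_def)

lemma nat_literal_4: "(4 :: nat) = Suc (Suc (Suc (Suc 0)))"
  and nat_literal_5: "(5 :: nat) = Suc (Suc (Suc (Suc (Suc 0))))"
  by simp_all

lemmas nat_literals = numeral_2_eq_2 numeral_3_eq_3 nat_literal_4 nat_literal_5 One_nat_def add_Suc add_0

lemmas gens_unfold = Ball_box gens_given all_UNIV all_kgen all_lgen all_osz all_obxgen all_xgenob

lemmas object_simps = box_simps objects objects_P' objects_N' K_lft.simps K_rgt.simps L_lft.simps L_rgt.simps
  X_lft.simps X_rgt.simps osz_lft.simps osz_rgt.simps ob.distinct cob.distinct simp_thms

lemmas inputs_unfold = all_inputs_A11 all_inputs_Acan all_inputs_0 all_composable_A11 all_composable_Acan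
  all_composable_0

lemmas relation_unfold = comp_from.simps mult_from.simps append.simps

lemmas relation_simps = U2_B_case power_add beta_add polv_add algebra_simps

lemma beta_sum_X2:
  "X1 * (X2 * beta k l) = X2 * (X2 * beta k l + (X1 ^ k * X2 ^ l + X1 ^ l * X2 ^ k))"
  by (metis beta_sum mult.left_commute)

text \<open>Homogeneous polynomials of degree \<open>d\<close>, where \<open>U\<^sub>1\<close> and \<open>U\<^sub>2\<close> have degree 1\<close>

definition homogeneous_poly :: "int \<Rightarrow> poly2 \<Rightarrow> bool" where
  "homogeneous_poly d p \<longleftrightarrow> supported (\<lambda>(i, j). int i + int j = d) p"

lemma homogeneous_poly_simps [simp]:
  "homogeneous_poly d 0"
  "homogeneous_poly d p \<Longrightarrow> homogeneous_poly d q \<Longrightarrow> homogeneous_poly d (p + q)"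
  "homogeneous_poly d (X1 ^ i * X2 ^ j) \<longleftrightarrow> int i + int j = d"
  by (simp_all add: homogeneous_poly_def flip: gen_eq_monomial)

lemma linext_monomial: "linext T (X1 ^ i * X2 ^ j) = T (i, j)"
  by (simp flip: gen_eq_monomial)

lemma homogeneous_poly_mult:
  assumes "homogeneous_poly d p"
  shows "homogeneous_poly (int i + int j + d) (X1 ^ i * X2 ^ j * p)"
proof -
  have "X1 ^ i * X2 ^ j * p = linext (\<lambda>(k, l). X1 ^ (i + k) * X2 ^ (j + l)) p"
    by (induction p rule: poly2_induct) (simp_all add: linext_monomial distrib_left power_add ac_simps)
  also have "homogeneous_poly (int i + int j + d) \<dots>"
    unfolding homogeneous_poly_def
    by (rule supported_linext[OF assms[unfolded homogeneous_poly_def]]) (auto simp flip: gen_eq_monomial)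
  finally show ?thesis .
qed

lemma homogeneous_poly_X [simp]:
  "homogeneous_poly (d - 1) p \<Longrightarrow> homogeneous_poly d (X1 * p)"
  "homogeneous_poly (d - 1) p \<Longrightarrow> homogeneous_poly d (X2 * p)"
  "homogeneous_poly d X1 \<longleftrightarrow> d = 1" "homogeneous_poly d X2 \<longleftrightarrow> d = 1" "homogeneous_poly d 1 \<longleftrightarrow> d = 0"
  using homogeneous_poly_mult[of "d - 1" p 1 0] homogeneous_poly_mult[of "d - 1" p 0 1]
    homogeneous_poly_simps(3)[of d 1 0] homogeneous_poly_simps(3)[of d 0 1] homogeneous_poly_simps(3)[of d 0 0]
  by auto

lemma homogeneous_poly_beta [simp]: "d = int k + int l - 1 \<Longrightarrow> homogeneous_poly d (beta k l)"
proof -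
  have "homogeneous_poly (int k + int l - 1) (beta k l)"
    by (induction k l rule: beta.induct) (auto simp: homogeneous_poly_simps(3)[of _ 0, simplified])
  then show "d = int k + int l - 1 \<Longrightarrow> homogeneous_poly d (beta k l)" by simp
qed

lemma homogeneous_polv_aux:
  assumes "homogeneous_poly d p" and "\<And>i j. int i + int j = d \<Longrightarrow> homogeneous A' A M N s t m as (c i j \<otimes> n)"
  shows "homogeneous A' A M N s t m as (polv c n p)"
  using assms unfolding homogeneous_poly_def polv_def homogeneous_def
  by (elim supported_linext) auto

lemma homogeneous_polv [simp]:
  assumes "n \<in> gens N" "lft M m = Ob_oo" "lft N n = Ob_oo" "rgt N n = end_ob A (rgt M m) as"
    and "qgr N n + hgr N n = qgr M m + (\<Sum>a\<leftarrow>as. qdeg A a) + s + (hgr M m + (\<Sum>a\<leftarrow>as. hdeg A a - 1) + t)"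
    and "even (hgr M m + (\<Sum>a\<leftarrow>as. hdeg A a - 1) + t - hgr N n)"
    and "homogeneous_poly ((hgr M m + (\<Sum>a\<leftarrow>as. hdeg A a - 1) + t - hgr N n) div 2) p"
  shows "homogeneous A11 A M N s t m as (polv U_oo n p)"
  by (rule homogeneous_polv_aux[OF assms(7)]) (use assms(1-6) in auto)

lemma homogeneous_polv_can [simp]:
  assumes "n \<in> gens N" "lft M m = Ob_AB" "lft N n = Ob_AB" "rgt N n = end_ob A (rgt M m) as"
    and "qgr N n + 2 * hgr N n = qgr M m + (\<Sum>a\<leftarrow>as. qdeg A a) + s + 2 * (hgr M m + (\<Sum>a\<leftarrow>as. hdeg A a - 1) + t)
       - (hgr M m + (\<Sum>a\<leftarrow>as. hdeg A a - 1) + t - hgr N n)"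
    and "even (hgr M m + (\<Sum>a\<leftarrow>as. hdeg A a - 1) + t - hgr N n)"
    and "homogeneous_poly ((hgr M m + (\<Sum>a\<leftarrow>as. hdeg A a - 1) + t - hgr N n) div 2) p"
  shows "homogeneous Acan A M N s t m as (polv C_AB n p)"
  by (rule homogeneous_polv_aux[OF assms(7)]) (use assms(1-6) in auto)

lemma unit_oo [simp]: "U_oo 0 0 \<otimes> n = polv U_oo n 1" "C_AB 0 0 \<otimes> n = polv C_AB n 1"
  by (simp_all add: polv_1)

text \<open>
  In the following proofs, the generators and the shapes of the inputs are enumerated first; then each
  case is evaluated by the tables of operations, and its terms cancel in pairs.
\<close>

lemma DA_bimodule_KPL: "DA_bimodule Acan Acan KPL"
proof (rule DA_bimoduleI[OF dg_category_Acan dg_category_Acan Acan_simps(5) Acan_simps(5) max_inputs_KPL])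
  show "strictly_unital Acan Acan KPL"
    unfolding strictly_unital_def gens_unfold
    by (simp only: object_simps, simp only: nat_literals inputs_unfold, intro conjI allI impI TrueI)
      (auto simp: ops_KPL_rules identities_Acan split: nat.splits)
  show "homogeneous_up_to Acan Acan KPL KPL 0 1 1 (ops KPL)"
    unfolding homogeneous_up_to_def gens_unfold
    by (simp only: object_simps, simp only: nat_literals inputs_unfold, intro conjI allI impI TrueI;
      simp add: ops_KPL_rules U2_B_case split: nat.split)
  show "relation_up_to Acan Acan KPL (1 + 1)"
    unfolding relation_up_to_def gens_unfold
    by (simp only: object_simps, simp only: nat_literals inputs_unfold, intro conjI allI impI TrueI;
      simp only: relation_unfold; simp add: ops_KPL_rules relation_simps split: nat.split)
qed simp

lemma DA_bimodule_KNL: "DA_bimodule Acan Acan KNL"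
proof (rule DA_bimoduleI[OF dg_category_Acan dg_category_Acan Acan_simps(5) Acan_simps(5) max_inputs_KNL])
  show "strictly_unital Acan Acan KNL"
    unfolding strictly_unital_def gens_unfold
    by (simp only: object_simps, simp only: nat_literals inputs_unfold, intro conjI allI impI TrueI)
      (auto simp: ops_KNL_rules identities_Acan split: nat.splits)
  show "homogeneous_up_to Acan Acan KNL KNL 0 1 1 (ops KNL)"
    unfolding homogeneous_up_to_def gens_unfold
    by (simp only: object_simps, simp only: nat_literals inputs_unfold, intro conjI allI impI TrueI;
      simp add: ops_KNL_rules U2_B_case split: nat.split)
  show "relation_up_to Acan Acan KNL (1 + 1)"
    unfolding relation_up_to_def gens_unfold
    by (simp only: object_simps, simp only: nat_literals inputs_unfold, intro conjI allI impI TrueI;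
      simp only: relation_unfold; simp add: ops_KNL_rules relation_simps beta_sum beta_sum_X2 split: nat.split)
qed simp

lemma DA_bimodule_LPK: "DA_bimodule A11 A11 LPK"
proof (rule DA_bimoduleI[OF dg_category_A11 dg_category_A11 A11_simps(5) A11_simps(5) max_inputs_LPK])
  show "strictly_unital A11 A11 LPK"
    unfolding strictly_unital_def gens_unfold
    by (simp only: object_simps, simp only: nat_literals inputs_unfold, intro conjI allI impI TrueI)
      (auto simp: ops_LPK_rules identities_A11 split: nat.splits)
  show "homogeneous_up_to A11 A11 LPK LPK 0 1 3 (ops LPK)"
    unfolding homogeneous_up_to_def gens_unfold
    by (simp only: object_simps, simp only: nat_literals inputs_unfold, intro conjI allI impI TrueI;
      simp add: ops_LPK_rules U2_B_case split: nat.split)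
  show "relation_up_to A11 A11 LPK (3 + 3)"
    unfolding relation_up_to_def gens_unfold
    by (simp only: object_simps, simp only: nat_literals inputs_unfold, intro conjI allI impI TrueI;
      simp only: relation_unfold; simp add: ops_LPK_rules relation_simps split: nat.split)
qed simp

lemma DA_bimodule_LNK: "DA_bimodule A11 A11 LNK"
proof (rule DA_bimoduleI[OF dg_category_A11 dg_category_A11 A11_simps(5) A11_simps(5) max_inputs_LNK])
  show "strictly_unital A11 A11 LNK"
    unfolding strictly_unital_def gens_unfold
    by (simp only: object_simps, simp only: nat_literals inputs_unfold, intro conjI allI impI TrueI)
      (auto simp: ops_LNK_rules identities_A11 split: nat.splits)
  show "homogeneous_up_to A11 A11 LNK LNK 0 1 2 (ops LNK)"
    unfolding homogeneous_up_to_def gens_unfold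
    by (simp only: object_simps, simp only: nat_literals inputs_unfold, intro conjI allI impI TrueI;
      simp add: ops_LNK_rules U2_B_case split: nat.split)
  show "relation_up_to A11 A11 LNK (2 + 2)"
    unfolding relation_up_to_def gens_unfold
    by (simp only: object_simps, simp only: nat_literals inputs_unfold, intro conjI allI impI TrueI;
      simp only: relation_unfold; simp add: ops_LNK_rules relation_simps split: nat.split)
qed simp

lemma DA_bimodule_POSz: "DA_bimodule Acan Acan P_OSz"
proof (rule DA_bimoduleI[OF dg_category_Acan dg_category_Acan Acan_simps(5) Acan_simps(5) max_inputs_POSz])
  show "strictly_unital Acan Acan P_OSz"
    unfolding strictly_unital_def gens_unfold
    by (simp only: object_simps, simp only: nat_literals inputs_unfold, intro conjI allI impI TrueI)
      (auto simp: ops_POSz identities_Acan split: nat.splits)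
  show "homogeneous_up_to Acan Acan P_OSz P_OSz 0 1 2 (ops P_OSz)"
    unfolding homogeneous_up_to_def gens_unfold
    by (simp only: object_simps, simp only: nat_literals inputs_unfold, intro conjI allI impI TrueI;
      simp add: ops_POSz U2_B_case split: nat.split)
  show "relation_up_to Acan Acan P_OSz (2 + 2)"
    unfolding relation_up_to_def gens_unfold
    by (simp only: object_simps, simp only: nat_literals inputs_unfold, intro conjI allI impI TrueI;
      simp only: relation_unfold; simp add: ops_POSz relation_simps split: nat.split)
qed simp

lemma DA_bimodule_NOSz: "DA_bimodule Acan Acan N_OSz"
proof (rule DA_bimoduleI[OF dg_category_Acan dg_category_Acan Acan_simps(5) Acan_simps(5) max_inputs_NOSz])
  show "strictly_unital Acan Acan N_OSz"
    unfolding strictly_unital_def gens_unfold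
    by (simp only: object_simps, simp only: nat_literals inputs_unfold, intro conjI allI impI TrueI)
      (auto simp: ops_NOSz identities_Acan split: nat.splits)
  show "homogeneous_up_to Acan Acan N_OSz N_OSz 0 1 2 (ops N_OSz)"
    unfolding homogeneous_up_to_def gens_unfold
    by (simp only: object_simps, simp only: nat_literals inputs_unfold, intro conjI allI impI TrueI;
      simp add: ops_NOSz U2_B_case split: nat.split)
  show "relation_up_to Acan Acan N_OSz (2 + 2)"
    unfolding relation_up_to_def gens_unfold
    by (simp only: object_simps, simp only: nat_literals inputs_unfold, intro conjI allI impI TrueI;
      simp only: relation_unfold; simp add: ops_NOSz relation_simps split: nat.split)
qed simp

lemma DA_bimodule_P': "DA_bimodule A11 A11 P'"
proof (rule DA_bimoduleI[OF dg_category_A11 dg_category_A11 A11_simps(5) A11_simps(5) max_inputs_P'])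
  show "strictly_unital A11 A11 P'"
    unfolding strictly_unital_def gens_unfold
    by (simp only: object_simps, simp only: nat_literals inputs_unfold, intro conjI allI impI TrueI)
      (auto simp: ops_P' ops_X identities_A11 split: nat.splits)
  show "homogeneous_up_to A11 A11 P' P' 0 1 2 (ops P')"
    unfolding homogeneous_up_to_def gens_unfold
    by (simp only: object_simps, simp only: nat_literals inputs_unfold, intro conjI allI impI TrueI;
      simp add: ops_P' ops_X U2_B_case split: nat.split)
  show "relation_up_to A11 A11 P' (2 + 2)"
    unfolding relation_up_to_def gens_unfold
    by (simp only: object_simps, simp only: nat_literals inputs_unfold, intro conjI allI impI TrueI;
      simp only: relation_unfold; simp add: ops_P' ops_X relation_simps split: nat.split)
qed simp

lemma DA_bimodule_N': "DA_bimodule A11 A11 N'"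
proof (rule DA_bimoduleI[OF dg_category_A11 dg_category_A11 A11_simps(5) A11_simps(5) max_inputs_N'])
  show "strictly_unital A11 A11 N'"
    unfolding strictly_unital_def gens_unfold
    by (simp only: object_simps, simp only: nat_literals inputs_unfold, intro conjI allI impI TrueI)
      (auto simp: ops_N' ops_X identities_A11 split: nat.splits)
  show "homogeneous_up_to A11 A11 N' N' 0 1 2 (ops N')"
    unfolding homogeneous_up_to_def gens_unfold
    by (simp only: object_simps, simp only: nat_literals inputs_unfold, intro conjI allI impI TrueI;
      simp add: ops_N' ops_X U2_B_case split: nat.split)
  show "relation_up_to A11 A11 N' (2 + 2)"
    unfolding relation_up_to_def gens_unfold
    by (simp only: object_simps, simp only: nat_literals inputs_unfold, intro conjI allI impI TrueI;
      simp only: relation_unfold; simp add: ops_N' ops_X relation_simps beta_sum beta_sum_X2 split: nat.split)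
qed simp

section \<open>The homotopy equivalences\<close>

text \<open>The product rule with the roles of the two factors exchanged\<close>

lemma beta_add':
  "beta (k + k') (l + l') = beta k l * (X1 ^ l' * X2 ^ k') + X1 ^ k * X2 ^ l * beta k' l'"
  using beta_add[of k' k l' l] by (simp add: ac_simps)

lemma max_inputs_zero: "max_inputs 0 (\<lambda>_ _. 0)"
  by (simp add: max_inputs_def)

lemmas morphism_unfold = relation_unfold mor_id_def list.distinct if_False if_True

subsection \<open>The equivalence of \<open>\<K> \<boxtimes> P' \<boxtimes> \<L>\<close> and \<open>P\<^sub>O\<^sub>S\<^sub>z\<close>\<close>

text \<open>
  Projection, inclusion and homotopy for the cancellation of the pairs
  \<open>\<kappa>\<^sub>2 \<I> \<lambda>\<^sub>i \<rightarrow> \<kappa>\<^sub>2 xa \<lambda>\<^sub>i\<close> (\<open>i = 2, 3\<close>), \<open>\<kappa>\<^sub>3 yb \<lambda>\<^sub>4 \<rightarrow> \<kappa>\<^sub>2 xb \<lambda>\<^sub>4\<close>, \<open>\<kappa>\<^sub>i \<I> \<lambda>\<^sub>4 \<rightarrow> \<kappa>\<^sub>i ya \<lambda>\<^sub>3\<close> (\<open>i = 3, 4\<close>) and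
  \<open>\<kappa>\<^sub>5 \<I> \<lambda>\<^sub>5 \<rightarrow> \<kappa>\<^sub>5 zc \<lambda>\<^sub>5\<close>. The generators \<open>S\<^sub>\<emptyset>\<close>, \<open>S\<^sub>A\<close>, \<open>W\<close>, \<open>N\<^sub>B\<close>, \<open>N\<^bsub>AB\<^esub>\<close> correspond to
  \<open>\<kappa>\<^sub>1 \<I> \<lambda>\<^sub>1\<close>, \<open>\<kappa>\<^sub>3 ya \<lambda>\<^sub>2\<close>, \<open>\<kappa>\<^sub>4 ya \<lambda>\<^sub>2\<close>, \<open>\<kappa>\<^sub>4 yb \<lambda>\<^sub>4\<close>, \<open>\<kappa>\<^sub>5 zd \<lambda>\<^sub>5\<close>.
\<close>

definition f_KPL :: "(kgen \<times> (ob + xgen)) \<times> lgen \<Rightarrow> can list \<Rightarrow> (can \<times> osz_gen) vect" where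
  "f_KPL m as = (case m of
      ((Kap1, Inl Ob_uu), Lam1) \<Rightarrow> (case as of [] \<Rightarrow> C_none \<otimes> S_none | _ \<Rightarrow> 0)
    | ((Kap2, Inr Xb), Lam4) \<Rightarrow> (case as of [] \<Rightarrow> C_R 0 \<otimes> N_B
        | [C_L k] \<Rightarrow> (if k = 0 then C_A 0 \<otimes> S_A else 0) | _ \<Rightarrow> 0)
    | ((Kap3, Inr Ya), Lam2) \<Rightarrow> (case as of [] \<Rightarrow> C_A 0 \<otimes> S_A | _ \<Rightarrow> 0)
    | ((Kap4, Inr Ya), Lam2) \<Rightarrow> (case as of [] \<Rightarrow> C_B1 0 \<otimes> W | _ \<Rightarrow> 0)
    | ((Kap4, Inr Ya), Lam3) \<Rightarrow> (case as of [] \<Rightarrow> C_B2 0 \<otimes> N_B | _ \<Rightarrow> 0)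
    | ((Kap4, Inr Yb), Lam4) \<Rightarrow> (case as of [] \<Rightarrow> C_B1 0 \<otimes> N_B | _ \<Rightarrow> 0)
    | ((Kap5, Inr Zc), Lam5) \<Rightarrow> (case as of [] \<Rightarrow> polv C_AB N_AB X2 | _ \<Rightarrow> 0)
    | ((Kap5, Inr Zd), Lam5) \<Rightarrow> (case as of [] \<Rightarrow> polv C_AB N_AB 1 | _ \<Rightarrow> 0)
    | _ \<Rightarrow> 0)"

definition g_KPL :: "osz_gen \<Rightarrow> can list \<Rightarrow> (can \<times> ((kgen \<times> (ob + xgen)) \<times> lgen)) vect" where
  "g_KPL m as = (case m of
      S_none \<Rightarrow> (case as of [] \<Rightarrow> C_none \<otimes> ((Kap1, Inl Ob_uu), Lam1) | _ \<Rightarrow> 0)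
    | S_A \<Rightarrow> (case as of
          [] \<Rightarrow> C_A 0 \<otimes> ((Kap2, Inl Ob_ou), Lam2) + C_A 0 \<otimes> ((Kap3, Inr Ya), Lam2)
        | [C_R k] \<Rightarrow> (if k = 0 then C_A 0 \<otimes> ((Kap3, Inl Ob_uo), Lam4) else 0)
        | _ \<Rightarrow> 0)
    | W \<Rightarrow> (case as of
          [] \<Rightarrow> C_B1 0 \<otimes> ((Kap4, Inr Ya), Lam2)
        | [C_A k] \<Rightarrow> pred_case k (\<lambda>j. C_L j \<otimes> ((Kap2, Inl Ob_ou), Lam2))
        | [C_R k] \<Rightarrow> U2_B k \<otimes> ((Kap4, Inl Ob_uo), Lam4) + pred_case k (\<lambda>j. C_L j \<otimes> ((Kap2, Inl Ob_ou), Lam3))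
        | _ \<Rightarrow> 0)
    | N_B \<Rightarrow> (case as of
          [] \<Rightarrow> C_B1 0 \<otimes> ((Kap4, Inr Yb), Lam4)
        | [C_L k] \<Rightarrow> pred_case k (\<lambda>j. C_L j \<otimes> ((Kap2, Inl Ob_ou), Lam2))
        | [C_B1 k] \<Rightarrow> pred_case k (\<lambda>j. U2_B j \<otimes> ((Kap4, Inl Ob_uo), Lam4)
            + pred_case j (\<lambda>i. C_L i \<otimes> ((Kap2, Inl Ob_ou), Lam3)))
        | [C_B2 k] \<Rightarrow> U2_B k \<otimes> ((Kap4, Inl Ob_uo), Lam4) + C_L k \<otimes> ((Kap3, Inr Yb), Lam4)
            + pred_case k (\<lambda>j. C_L j \<otimes> ((Kap2, Inl Ob_ou), Lam3))
        | [C_B2 k, C_B1 l] \<Rightarrow> (if l = 1 then C_L k \<otimes> ((Kap3, Inl Ob_uo), Lam4) else 0)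
        | [C_B2 k, C_B2 l] \<Rightarrow> (if l = 0 then C_L k \<otimes> ((Kap3, Inl Ob_uo), Lam4) else 0)
        | _ \<Rightarrow> 0)
    | N_AB \<Rightarrow> (case as of
          [] \<Rightarrow> polv C_AB ((Kap5, Inr Zd), Lam5) 1
        | [C_AB k l] \<Rightarrow> polv C_AB ((Kap5, Inl Ob_oo), Lam5) (beta k l)
        | _ \<Rightarrow> 0))"

definition h_KPL :: "(kgen \<times> (ob + xgen)) \<times> lgen \<Rightarrow> can list \<Rightarrow> (can \<times> ((kgen \<times> (ob + xgen)) \<times> lgen)) vect" where
  "h_KPL m as = (case m of
      ((Kap2, Inr Xa), Lam2) \<Rightarrow> (case as of [] \<Rightarrow> C_A 0 \<otimes> ((Kap2, Inl Ob_ou), Lam2) | _ \<Rightarrow> 0)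
    | ((Kap2, Inr Xa), Lam3) \<Rightarrow> (case as of [] \<Rightarrow> C_A 0 \<otimes> ((Kap2, Inl Ob_ou), Lam3) | _ \<Rightarrow> 0)
    | ((Kap2, Inr Xb), Lam4) \<Rightarrow> (case as of
          [] \<Rightarrow> C_A 0 \<otimes> ((Kap3, Inr Yb), Lam4)
        | [C_B1 k] \<Rightarrow> (if k = 1 then C_A 0 \<otimes> ((Kap3, Inl Ob_uo), Lam4) else 0)
        | [C_B2 k] \<Rightarrow> (if k = 0 then C_A 0 \<otimes> ((Kap3, Inl Ob_uo), Lam4) else 0)
        | _ \<Rightarrow> 0)
    | ((Kap3, Inr Ya), Lam3) \<Rightarrow> (case as of [] \<Rightarrow> C_A 0 \<otimes> ((Kap3, Inl Ob_uo), Lam4) | _ \<Rightarrow> 0)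
    | ((Kap4, Inr Ya), Lam3) \<Rightarrow> (case as of [] \<Rightarrow> C_B1 0 \<otimes> ((Kap4, Inl Ob_uo), Lam4) | _ \<Rightarrow> 0)
    | ((Kap5, Inr Zc), Lam5) \<Rightarrow> (case as of [] \<Rightarrow> polv C_AB ((Kap5, Inl Ob_oo), Lam5) 1 | _ \<Rightarrow> 0)
    | _ \<Rightarrow> 0)"

lemma max_inputs_f_KPL: "max_inputs 1 f_KPL"
  unfolding max_inputs_def
  by (auto simp: f_KPL_def split: prod.split sum.split kgen.split ob.split xgen.split lgen.split can.split list.split)

lemma max_inputs_g_KPL: "max_inputs 2 g_KPL"
  unfolding max_inputs_def
  by (auto simp: g_KPL_def split: prod.split sum.split osz_gen.split can.split list.split)

lemma max_inputs_h_KPL: "max_inputs 1 h_KPL"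
  unfolding max_inputs_def
  by (auto simp: h_KPL_def split: prod.split sum.split kgen.split ob.split xgen.split lgen.split can.split list.split)

lemma closed_f_KPL: "closed_morphism Acan Acan KPL P_OSz 0 0 f_KPL"
proof (rule closed_morphismI[OF Acan_simps(5) Acan_simps(5) max_inputs_f_KPL max_inputs_KPL max_inputs_POSz])
  show "homogeneous_up_to Acan Acan KPL P_OSz 0 0 1 f_KPL"
    unfolding homogeneous_up_to_def gens_unfold
    by (simp only: object_simps, simp only: nat_literals inputs_unfold, intro conjI allI impI TrueI;
      simp add: f_KPL_def U2_B_case split: nat.split)
  show "closed_up_to Acan Acan KPL P_OSz 3 f_KPL"
    unfolding closed_up_to_def gens_unfold
    by (simp only: object_simps, simp only: nat_literals inputs_unfold, intro conjI allI impI TrueI;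
      simp only: morphism_unfold; simp add: ops_KPL_rules ops_POSz f_KPL_def
        relation_simps split: nat.split)
qed simp_all

lemma closed_g_KPL: "closed_morphism Acan Acan P_OSz KPL 0 0 g_KPL"
proof (rule closed_morphismI[OF Acan_simps(5) Acan_simps(5) max_inputs_g_KPL max_inputs_POSz max_inputs_KPL])
  show "homogeneous_up_to Acan Acan P_OSz KPL 0 0 2 g_KPL"
    unfolding homogeneous_up_to_def gens_unfold
    by (simp only: object_simps, simp only: nat_literals inputs_unfold, intro conjI allI impI TrueI;
      simp add: g_KPL_def U2_B_case split: nat.split)
  show "closed_up_to Acan Acan P_OSz KPL 4 g_KPL"
    unfolding closed_up_to_def gens_unfold
    by (simp only: object_simps, simp only: nat_literals inputs_unfold, intro conjI allI impI TrueI;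
      simp only: morphism_unfold; simp add: ops_KPL_rules ops_POSz g_KPL_def
        relation_simps split: nat.split)
qed simp_all

lemma homotopic_g_KPL_f_KPL: "homotopic Acan Acan KPL KPL (mor_comp Acan g_KPL f_KPL) (mor_id Acan KPL)"
proof (rule homotopicI[OF Acan_simps(5) Acan_simps(5) max_inputs_f_KPL max_inputs_g_KPL _ max_inputs_h_KPL max_inputs_KPL])
  show "homogeneous_up_to Acan Acan KPL KPL 0 (- 1) 1 h_KPL"
    unfolding homogeneous_up_to_def gens_unfold
    by (simp only: object_simps, simp only: nat_literals inputs_unfold, intro conjI allI impI TrueI;
      simp add: h_KPL_def U2_B_case split: nat.split)
  show "homotopy_up_to Acan Acan KPL 3 g_KPL f_KPL h_KPL"
    unfolding homotopy_up_to_def gens_unfold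
    by (simp only: object_simps, simp only: nat_literals inputs_unfold, intro conjI allI impI TrueI;
      simp only: morphism_unfold; simp add: ops_KPL_rules f_KPL_def g_KPL_def h_KPL_def
        relation_simps split: nat.split)
qed simp_all

lemma homotopic_f_KPL_g_KPL: "homotopic Acan Acan P_OSz P_OSz (mor_comp Acan f_KPL g_KPL) (mor_id Acan P_OSz)"
proof (rule homotopicI[OF Acan_simps(5) Acan_simps(5) max_inputs_g_KPL max_inputs_f_KPL _ max_inputs_zero max_inputs_POSz])
  show "homogeneous_up_to Acan Acan P_OSz P_OSz 0 (- 1) 0 (\<lambda>_ _. 0)"
    unfolding homogeneous_up_to_def gens_unfold
    by (simp only: object_simps, simp only: nat_literals inputs_unfold, intro conjI allI impI TrueI;
      simp add: U2_B_case split: nat.split)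
  show "homotopy_up_to Acan Acan P_OSz 3 f_KPL g_KPL (\<lambda>_ _. 0)"
    unfolding homotopy_up_to_def gens_unfold
    by (simp only: object_simps, simp only: nat_literals inputs_unfold, intro conjI allI impI TrueI;
      simp only: morphism_unfold; simp add: ops_POSz f_KPL_def g_KPL_def
        relation_simps split: nat.split)
qed simp_all

lemma homotopy_equivalent_KPL: "homotopy_equivalent Acan Acan KPL P_OSz"
  unfolding homotopy_equivalent_def
  using DA_bimodule_KPL DA_bimodule_POSz closed_f_KPL closed_g_KPL
    homotopic_g_KPL_f_KPL homotopic_f_KPL_g_KPL by blast

subsection \<open>The equivalence of \<open>\<K> \<boxtimes> N' \<boxtimes> \<L>\<close> and \<open>N\<^sub>O\<^sub>S\<^sub>z\<close>\<close>

text \<open>The multiple of \<open>m\<close> by \<open>U\<^sub>1\<^sup>k + U\<^sub>2\<^sup>k\<close> at \<open>B\<close> if \<open>k > 0\<close>, and by the identity if \<open>k = 0\<close>\<close>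

definition U1_plus_U2 :: "nat \<Rightarrow> 'm \<Rightarrow> (can \<times> 'm) vect" where
  "U1_plus_U2 k m = (case k of 0 \<Rightarrow> C_B1 0 \<otimes> m | Suc j \<Rightarrow> C_B1 k \<otimes> m + C_B2 j \<otimes> m)"

text \<open>
  The cancelled pairs are \<open>\<kappa>\<^sub>3 ya \<lambda>\<^sub>i \<rightarrow> \<kappa>\<^sub>2 xa \<lambda>\<^sub>i\<close> (\<open>i = 2, 3\<close>), \<open>\<kappa>\<^sub>2 xb \<lambda>\<^sub>4 \<rightarrow> \<kappa>\<^sub>2 \<I> \<lambda>\<^sub>3\<close>,
  \<open>\<kappa>\<^sub>i yb \<lambda>\<^sub>4 \<rightarrow> \<kappa>\<^sub>i \<I> \<lambda>\<^sub>4\<close> (\<open>i = 3, 4\<close>) and \<open>\<kappa>\<^sub>5 zd \<lambda>\<^sub>5 \<rightarrow> \<kappa>\<^sub>5 \<I> \<lambda>\<^sub>5\<close>, and \<open>S\<^sub>\<emptyset>\<close>, \<open>S\<^sub>A\<close>, \<open>W\<close>, \<open>N\<^sub>B\<close>, \<open>N\<^bsub>AB\<^esub>\<close>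
  correspond to \<open>\<kappa>\<^sub>1 \<I> \<lambda>\<^sub>1\<close>, \<open>\<kappa>\<^sub>2 \<I> \<lambda>\<^sub>2\<close>, \<open>\<kappa>\<^sub>4 ya \<lambda>\<^sub>2\<close>, \<open>\<kappa>\<^sub>4 ya \<lambda>\<^sub>3\<close>, \<open>\<kappa>\<^sub>5 zc \<lambda>\<^sub>5\<close>. The transferred bimodule is
  isomorphic to \<open>N\<^sub>O\<^sub>S\<^sub>z\<close> by the morphism that fixes the generators and has the further terms
  \<open>(S\<^sub>A; U\<^sub>1\<^bsup>k+1\<^esup>) \<mapsto> R\<^sub>1U\<^sub>1\<^sup>k W\<close> and \<open>(S\<^sub>A; R\<^sub>1U\<^sub>1\<^bsup>k+1\<^esup>) \<mapsto> R\<^sub>1U\<^sub>1\<^sup>k N\<^sub>B\<close>. It is contained in \<open>f\<close>, and its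
  inverse in \<open>g\<close>, which has moreover been changed by the differential of the morphism
  \<open>(S\<^sub>A; U\<^sub>1\<^bsup>k+1\<^esup>) \<mapsto> U\<^sub>1\<^sup>k \<kappa>\<^sub>3 ya \<lambda>\<^sub>2\<close>, \<open>(S\<^sub>A; R\<^sub>1U\<^sub>1\<^bsup>k+1\<^esup>) \<mapsto> U\<^sub>1\<^sup>k \<kappa>\<^sub>3 ya \<lambda>\<^sub>3\<close>.
\<close>

definition f_KNL :: "(kgen \<times> (xgen + ob)) \<times> lgen \<Rightarrow> can list \<Rightarrow> (can \<times> osz_gen) vect" where
  "f_KNL m as = (case m of
      ((Kap1, Inr Ob_uu), Lam1) \<Rightarrow> (case as of [] \<Rightarrow> C_none \<otimes> S_none | _ \<Rightarrow> 0)
    | ((Kap2, Inl Xa), Lam2) \<Rightarrow> (case as of [] \<Rightarrow> C_R 0 \<otimes> W | _ \<Rightarrow> 0)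
    | ((Kap2, Inl Xa), Lam3) \<Rightarrow> (case as of [] \<Rightarrow> C_R 0 \<otimes> N_B | _ \<Rightarrow> 0)
    | ((Kap2, Inr Ob_ou), Lam2) \<Rightarrow> (case as of
          [] \<Rightarrow> C_A 0 \<otimes> S_A
        | [C_A k] \<Rightarrow> pred_case k (\<lambda>j. C_R j \<otimes> W)
        | [C_R k] \<Rightarrow> pred_case k (\<lambda>j. C_R j \<otimes> N_B)
        | _ \<Rightarrow> 0)
    | ((Kap2, Inr Ob_ou), Lam3) \<Rightarrow> (case as of
          [C_L k] \<Rightarrow> C_R k \<otimes> W
        | [C_B1 k] \<Rightarrow> pred_case k (\<lambda>j. C_R j \<otimes> N_B)
        | [C_B2 k] \<Rightarrow> C_R k \<otimes> N_B
        | _ \<Rightarrow> 0)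
    | ((Kap4, Inl Ya), Lam2) \<Rightarrow> (case as of [] \<Rightarrow> C_B1 0 \<otimes> W | _ \<Rightarrow> 0)
    | ((Kap4, Inl Ya), Lam3) \<Rightarrow> (case as of [] \<Rightarrow> C_B1 0 \<otimes> N_B | _ \<Rightarrow> 0)
    | ((Kap4, Inr Ob_uo), Lam4) \<Rightarrow> (case as of
          [C_L k] \<Rightarrow> U1_plus_U2 k W
        | [C_B1 k] \<Rightarrow> pred_case k (\<lambda>j. U1_plus_U2 j N_B)
        | [C_B2 k] \<Rightarrow> U1_plus_U2 k N_B
        | _ \<Rightarrow> 0)
    | ((Kap5, Inl Zc), Lam5) \<Rightarrow> (case as of [] \<Rightarrow> polv C_AB N_AB 1 | _ \<Rightarrow> 0)
    | ((Kap5, Inr Ob_oo), Lam5) \<Rightarrow> (case as of [C_AB k l] \<Rightarrow> polv C_AB N_AB (beta k l) | _ \<Rightarrow> 0)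
    | _ \<Rightarrow> 0)"

definition g_KNL :: "osz_gen \<Rightarrow> can list \<Rightarrow> (can \<times> ((kgen \<times> (xgen + ob)) \<times> lgen)) vect" where
  "g_KNL m as = (case m of
      S_none \<Rightarrow> (case as of [] \<Rightarrow> C_none \<otimes> ((Kap1, Inr Ob_uu), Lam1) | _ \<Rightarrow> 0)
    | S_A \<Rightarrow> (case as of
          [] \<Rightarrow> C_A 0 \<otimes> ((Kap2, Inr Ob_ou), Lam2)
        | [C_A k] \<Rightarrow> pred_case k (\<lambda>j. C_A j \<otimes> ((Kap2, Inl Xa), Lam2))
        | [C_R k] \<Rightarrow> (case k of 0 \<Rightarrow> C_A 0 \<otimes> ((Kap2, Inl Xb), Lam4) | Suc j \<Rightarrow> C_A j \<otimes> ((Kap2, Inl Xa), Lam3))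
        | [C_R k, C_B2 l] \<Rightarrow> (if k = 0 then C_A l \<otimes> ((Kap3, Inl Ya), Lam3) else 0)
        | _ \<Rightarrow> 0)
    | W \<Rightarrow> (case as of [] \<Rightarrow> C_B1 0 \<otimes> ((Kap4, Inl Ya), Lam2) | _ \<Rightarrow> 0)
    | N_B \<Rightarrow> (case as of
          [] \<Rightarrow> C_B1 0 \<otimes> ((Kap4, Inl Ya), Lam3) + C_L 0 \<otimes> ((Kap2, Inl Xb), Lam4)
        | [C_B2 k] \<Rightarrow> C_L k \<otimes> ((Kap3, Inl Ya), Lam3)
        | _ \<Rightarrow> 0)
    | N_AB \<Rightarrow> (case as of
          [] \<Rightarrow> polv C_AB ((Kap5, Inl Zc), Lam5) 1 + polv C_AB ((Kap5, Inl Zd), Lam5) X1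
        | _ \<Rightarrow> 0))"

definition h_KNL :: "(kgen \<times> (xgen + ob)) \<times> lgen \<Rightarrow> can list \<Rightarrow> (can \<times> ((kgen \<times> (xgen + ob)) \<times> lgen)) vect" where
  "h_KNL m as = (case m of
      ((Kap2, Inl Xa), Lam2) \<Rightarrow> (case as of [] \<Rightarrow> C_A 0 \<otimes> ((Kap3, Inl Ya), Lam2) | _ \<Rightarrow> 0)
    | ((Kap2, Inl Xa), Lam3) \<Rightarrow> (case as of [] \<Rightarrow> C_A 0 \<otimes> ((Kap3, Inl Ya), Lam3) | _ \<Rightarrow> 0)
    | ((Kap2, Inr Ob_ou), Lam2) \<Rightarrow> (case as of
          [C_A k] \<Rightarrow> pred_case k (\<lambda>j. C_A j \<otimes> ((Kap3, Inl Ya), Lam2))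
        | [C_R k] \<Rightarrow> pred_case k (\<lambda>j. C_A j \<otimes> ((Kap3, Inl Ya), Lam3))
        | _ \<Rightarrow> 0)
    | ((Kap2, Inr Ob_ou), Lam3) \<Rightarrow> (case as of
          [] \<Rightarrow> C_A 0 \<otimes> ((Kap2, Inl Xb), Lam4)
        | [C_L k] \<Rightarrow> C_A k \<otimes> ((Kap3, Inl Ya), Lam2)
        | [C_B1 k] \<Rightarrow> pred_case k (\<lambda>j. C_A j \<otimes> ((Kap3, Inl Ya), Lam3))
        | [C_B2 k] \<Rightarrow> C_A k \<otimes> ((Kap3, Inl Ya), Lam3)
        | _ \<Rightarrow> 0)
    | ((Kap3, Inr Ob_uo), Lam4) \<Rightarrow> (case as of [] \<Rightarrow> C_A 0 \<otimes> ((Kap3, Inl Yb), Lam4) | _ \<Rightarrow> 0)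
    | ((Kap4, Inr Ob_uo), Lam4) \<Rightarrow> (case as of
          [] \<Rightarrow> C_B1 0 \<otimes> ((Kap4, Inl Yb), Lam4)
        | [C_L k] \<Rightarrow> pred_case k (\<lambda>j. C_L j \<otimes> ((Kap3, Inl Ya), Lam2))
        | [C_B1 k] \<Rightarrow> pred_case k (\<lambda>j. pred_case j (\<lambda>i. C_L i \<otimes> ((Kap3, Inl Ya), Lam3)))
        | [C_B2 k] \<Rightarrow> pred_case k (\<lambda>j. C_L j \<otimes> ((Kap3, Inl Ya), Lam3))
        | _ \<Rightarrow> 0)
    | ((Kap5, Inr Ob_oo), Lam5) \<Rightarrow> (case as of [] \<Rightarrow> polv C_AB ((Kap5, Inl Zd), Lam5) 1 | _ \<Rightarrow> 0)
    | _ \<Rightarrow> 0)"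

lemma max_inputs_f_KNL: "max_inputs 1 f_KNL"
  unfolding max_inputs_def
  by (auto simp: f_KNL_def split: prod.split sum.split kgen.split ob.split xgen.split lgen.split can.split list.split)

lemma max_inputs_g_KNL: "max_inputs 2 g_KNL"
  unfolding max_inputs_def
  by (auto simp: g_KNL_def split: prod.split sum.split osz_gen.split can.split list.split)

lemma max_inputs_h_KNL: "max_inputs 1 h_KNL"
  unfolding max_inputs_def
  by (auto simp: h_KNL_def split: prod.split sum.split kgen.split ob.split xgen.split lgen.split can.split list.split)

lemma closed_f_KNL: "closed_morphism Acan Acan KNL N_OSz 0 0 f_KNL"
proof (rule closed_morphismI[OF Acan_simps(5) Acan_simps(5) max_inputs_f_KNL max_inputs_KNL max_inputs_NOSz])
  show "homogeneous_up_to Acan Acan KNL N_OSz 0 0 1 f_KNL"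
    unfolding homogeneous_up_to_def gens_unfold
    by (simp only: object_simps, simp only: nat_literals inputs_unfold, intro conjI allI impI TrueI;
      simp add: f_KNL_def U1_plus_U2_def U2_B_case split: nat.split)
  show "closed_up_to Acan Acan KNL N_OSz 3 f_KNL"
    unfolding closed_up_to_def gens_unfold
    by (simp only: object_simps, simp only: nat_literals inputs_unfold, intro conjI allI impI TrueI;
      simp only: morphism_unfold; simp add: ops_KNL_rules ops_NOSz f_KNL_def U1_plus_U2_def
        U2_B_case power_add beta_add' polv_add algebra_simps beta_sum beta_sum_X2 split: nat.split)
qed simp_all

lemma closed_g_KNL: "closed_morphism Acan Acan N_OSz KNL 0 0 g_KNL"
proof (rule closed_morphismI[OF Acan_simps(5) Acan_simps(5) max_inputs_g_KNL max_inputs_NOSz max_inputs_KNL])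
  show "homogeneous_up_to Acan Acan N_OSz KNL 0 0 2 g_KNL"
    unfolding homogeneous_up_to_def gens_unfold
    by (simp only: object_simps, simp only: nat_literals inputs_unfold, intro conjI allI impI TrueI;
      simp add: g_KNL_def U1_plus_U2_def U2_B_case split: nat.split)
  show "closed_up_to Acan Acan N_OSz KNL 4 g_KNL"
    unfolding closed_up_to_def gens_unfold
    by (simp only: object_simps, simp only: nat_literals inputs_unfold, intro conjI allI impI TrueI;
      simp only: morphism_unfold; simp add: ops_KNL_rules ops_NOSz g_KNL_def U1_plus_U2_def
        relation_simps beta_sum beta_sum_X2 split: nat.split)
qed simp_all

lemma homotopic_g_KNL_f_KNL: "homotopic Acan Acan KNL KNL (mor_comp Acan g_KNL f_KNL) (mor_id Acan KNL)"
proof (rule homotopicI[OF Acan_simps(5) Acan_simps(5) max_inputs_f_KNL max_inputs_g_KNL _ max_inputs_h_KNL max_inputs_KNL])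
  show "homogeneous_up_to Acan Acan KNL KNL 0 (- 1) 1 h_KNL"
    unfolding homogeneous_up_to_def gens_unfold
    by (simp only: object_simps, simp only: nat_literals inputs_unfold, intro conjI allI impI TrueI;
      simp add: h_KNL_def U1_plus_U2_def U2_B_case split: nat.split)
  show "homotopy_up_to Acan Acan KNL 3 g_KNL f_KNL h_KNL"
    unfolding homotopy_up_to_def gens_unfold
    by (simp only: object_simps, simp only: nat_literals inputs_unfold, intro conjI allI impI TrueI;
      simp only: morphism_unfold; simp add: ops_KNL_rules f_KNL_def g_KNL_def h_KNL_def U1_plus_U2_def
        relation_simps beta_sum beta_sum_X2 split: nat.split)
qed simp_all

lemma homotopic_f_KNL_g_KNL: "homotopic Acan Acan N_OSz N_OSz (mor_comp Acan f_KNL g_KNL) (mor_id Acan N_OSz)"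
proof (rule homotopicI[OF Acan_simps(5) Acan_simps(5) max_inputs_g_KNL max_inputs_f_KNL _ max_inputs_zero max_inputs_NOSz])
  show "homogeneous_up_to Acan Acan N_OSz N_OSz 0 (- 1) 0 (\<lambda>_ _. 0)"
    unfolding homogeneous_up_to_def gens_unfold
    by (simp only: object_simps, simp only: nat_literals inputs_unfold, intro conjI allI impI TrueI;
      simp add: U2_B_case split: nat.split)
  show "homotopy_up_to Acan Acan N_OSz 3 f_KNL g_KNL (\<lambda>_ _. 0)"
    unfolding homotopy_up_to_def gens_unfold
    by (simp only: object_simps, simp only: nat_literals inputs_unfold, intro conjI allI impI TrueI;
      simp only: morphism_unfold; simp add: ops_NOSz f_KNL_def g_KNL_def U1_plus_U2_def
        relation_simps beta_sum beta_sum_X2 split: nat.split)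
qed simp_all

lemma homotopy_equivalent_KNL: "homotopy_equivalent Acan Acan KNL N_OSz"
  unfolding homotopy_equivalent_def
  using DA_bimodule_KNL DA_bimodule_NOSz closed_f_KNL closed_g_KNL
    homotopic_g_KNL_f_KNL homotopic_f_KNL_g_KNL by blast

subsection \<open>The equivalence of \<open>\<L> \<boxtimes> P\<^sub>O\<^sub>S\<^sub>z \<boxtimes> \<K>\<close> and \<open>P'\<close>\<close>

text \<open>
  Cancelling \<open>\<lambda>\<^sub>2 S\<^sub>A \<kappa>\<^sub>3 \<rightarrow> \<lambda>\<^sub>3 W \<kappa>\<^sub>3\<close> on the left and \<open>\<I> \<rightarrow> zc\<close> at \<open>oo\<close> on the right leaves isomorphic
  bimodules. Under the isomorphism, \<open>\<I>\<close>, \<open>xa\<close> at \<open>(ou, ou)\<close> correspond to \<open>\<lambda>\<^sub>2 S\<^sub>A \<kappa>\<^sub>2\<close>, \<open>\<lambda>\<^sub>3 W \<kappa>\<^sub>2\<close>, then \<open>ya\<close> and \<open>xb\<close>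
  correspond to \<open>\<lambda>\<^sub>4 W \<kappa>\<^sub>2\<close> and \<open>\<lambda>\<^sub>3 N\<^sub>B \<kappa>\<^sub>4\<close>, and \<open>\<I>\<close>, \<open>yb\<close> at \<open>(uo, uo)\<close> to \<open>\<lambda>\<^sub>4 W \<kappa>\<^sub>3\<close>, \<open>\<lambda>\<^sub>4 N\<^sub>B \<kappa>\<^sub>4\<close>; it has
  further terms, with inputs, on \<open>xa\<close>, \<open>xb\<close> and \<open>yb\<close>. The morphisms \<open>f\<close> and \<open>g\<close> are composed of
  projections, isomorphisms and inclusions, and \<open>h\<close> and \<open>k\<close> are the homotopies of the two cancellations.
\<close>

definition f_LPK :: "(lgen \<times> osz_gen) \<times> kgen \<Rightarrow> alg list \<Rightarrow> (alg \<times> (ob + xgen)) vect" where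
  "f_LPK m as = (case m of
      ((Lam1, S_none), Kap1) \<Rightarrow> (case as of [] \<Rightarrow> E_uu \<otimes> Inl Ob_uu | _ \<Rightarrow> 0)
    | ((Lam2, S_A), Kap2) \<Rightarrow> (case as of [] \<Rightarrow> U_ou 0 \<otimes> Inl Ob_ou | _ \<Rightarrow> 0)
    | ((Lam3, W), Kap2) \<Rightarrow> (case as of [] \<Rightarrow> U_ou 0 \<otimes> Inr Xa | [U_ou k] \<Rightarrow> U_ou k \<otimes> Inl Ob_ou | _ \<Rightarrow> 0)
    | ((Lam3, W), Kap3) \<Rightarrow> (case as of [Lam] \<Rightarrow> U_ou 0 \<otimes> Inl Ob_ou | _ \<Rightarrow> 0)
    | ((Lam3, N_B), Kap4) \<Rightarrow> (case as of
          [] \<Rightarrow> U_ou 0 \<otimes> Inr Xb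
        | [U_uo k, Lam] \<Rightarrow> pred_case k (\<lambda>j. U_ou j \<otimes> Inl Ob_ou)
        | [Lam, U_ou k] \<Rightarrow> pred_case k (\<lambda>j. if j = 0 then 0 else U_ou j \<otimes> Inl Ob_ou)
        | _ \<Rightarrow> 0)
    | ((Lam4, W), Kap2) \<Rightarrow> (case as of [] \<Rightarrow> U_uo 0 \<otimes> Inr Ya | _ \<Rightarrow> 0)
    | ((Lam4, W), Kap3) \<Rightarrow> (case as of [] \<Rightarrow> U_uo 0 \<otimes> Inl Ob_uo | _ \<Rightarrow> 0)
    | ((Lam4, N_B), Kap4) \<Rightarrow> (case as of
          [] \<Rightarrow> U_uo 0 \<otimes> Inr Yb
        | [U_uo k] \<Rightarrow> pred_case k (\<lambda>j. U_uo j \<otimes> Inl Ob_uo)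
        | _ \<Rightarrow> 0)
    | ((Lam5, N_AB), Kap5) \<Rightarrow> (case as of
          [] \<Rightarrow> polv U_oo (Inr Zd) 1
        | [U_oo k l] \<Rightarrow> polv U_oo (Inl Ob_oo) (beta k l)
        | _ \<Rightarrow> 0)
    | _ \<Rightarrow> 0)"

definition g_LPK :: "ob + xgen \<Rightarrow> alg list \<Rightarrow> (alg \<times> ((lgen \<times> osz_gen) \<times> kgen)) vect" where
  "g_LPK m as = (case m of
      Inl Ob_uu \<Rightarrow> (case as of [] \<Rightarrow> E_uu \<otimes> ((Lam1, S_none), Kap1) | _ \<Rightarrow> 0)
    | Inl Ob_ou \<Rightarrow> (case as of [] \<Rightarrow> U_ou 0 \<otimes> ((Lam2, S_A), Kap2) | _ \<Rightarrow> 0)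
    | Inl Ob_uo \<Rightarrow> (case as of [] \<Rightarrow> Lam \<otimes> ((Lam2, S_A), Kap3) + U_uo 0 \<otimes> ((Lam4, W), Kap3) | _ \<Rightarrow> 0)
    | Inl Ob_oo \<Rightarrow> 0
    | Inr Xa \<Rightarrow> (case as of
          [] \<Rightarrow> U_ou 0 \<otimes> ((Lam3, W), Kap2)
        | [U_ou k] \<Rightarrow> U_ou k \<otimes> ((Lam2, S_A), Kap2)
        | _ \<Rightarrow> 0)
    | Inr Ya \<Rightarrow> (case as of [] \<Rightarrow> U_uo 0 \<otimes> ((Lam4, W), Kap2) | _ \<Rightarrow> 0)
    | Inr Xb \<Rightarrow> (case as of
          [] \<Rightarrow> U_ou 0 \<otimes> ((Lam3, N_B), Kap4)
        | [U_uo k, Lam] \<Rightarrow> pred_case k (\<lambda>j. U_ou j \<otimes> ((Lam2, S_A), Kap2))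
        | [Lam, U_ou k] \<Rightarrow> pred_case k (\<lambda>j. if j = 0 then 0 else U_ou j \<otimes> ((Lam2, S_A), Kap2))
        | _ \<Rightarrow> 0)
    | Inr Yb \<Rightarrow> (case as of
          [] \<Rightarrow> U_uo 0 \<otimes> ((Lam4, N_B), Kap4)
        | [U_uo k] \<Rightarrow> pred_case k (\<lambda>j. U_uo j \<otimes> ((Lam4, W), Kap3) + (if j = 0 then Lam \<otimes> ((Lam2, S_A), Kap3) else 0))
        | _ \<Rightarrow> 0)
    | Inr Zc \<Rightarrow> (case as of [] \<Rightarrow> polv U_oo ((Lam5, N_AB), Kap5) X2 | _ \<Rightarrow> 0)
    | Inr Zd \<Rightarrow> (case as of [] \<Rightarrow> polv U_oo ((Lam5, N_AB), Kap5) 1 | _ \<Rightarrow> 0))"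

definition h_LPK :: "(lgen \<times> osz_gen) \<times> kgen \<Rightarrow> alg list \<Rightarrow> (alg \<times> ((lgen \<times> osz_gen) \<times> kgen)) vect" where
  "h_LPK m as = (case m of
      ((Lam3, W), Kap3) \<Rightarrow> (case as of [] \<Rightarrow> U_ou 0 \<otimes> ((Lam2, S_A), Kap3) | _ \<Rightarrow> 0)
    | _ \<Rightarrow> 0)"

definition k_LPK :: "ob + xgen \<Rightarrow> alg list \<Rightarrow> (alg \<times> (ob + xgen)) vect" where
  "k_LPK m as = (case m of
      Inr Zc \<Rightarrow> (case as of [] \<Rightarrow> polv U_oo (Inl Ob_oo) 1 | _ \<Rightarrow> 0)
    | _ \<Rightarrow> 0)"

lemma max_inputs_f_LPK: "max_inputs 2 f_LPK"
  unfolding max_inputs_def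
  by (auto simp: f_LPK_def split: prod.split sum.split kgen.split osz_gen.split lgen.split alg.split list.split)

lemma max_inputs_g_LPK: "max_inputs 2 g_LPK"
  unfolding max_inputs_def
  by (auto simp: g_LPK_def split: prod.split sum.split ob.split xgen.split alg.split list.split)

lemma max_inputs_h_LPK: "max_inputs 0 h_LPK"
  unfolding max_inputs_def
  by (auto simp: h_LPK_def split: prod.split sum.split kgen.split osz_gen.split lgen.split alg.split list.split)

lemma max_inputs_k_LPK: "max_inputs 0 k_LPK"
  unfolding max_inputs_def
  by (auto simp: k_LPK_def split: prod.split sum.split ob.split xgen.split alg.split list.split)

lemma closed_f_LPK: "closed_morphism A11 A11 LPK P' 0 0 f_LPK"
proof (rule closed_morphismI[OF A11_simps(5) A11_simps(5) max_inputs_f_LPK max_inputs_LPK max_inputs_P'])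
  show "homogeneous_up_to A11 A11 LPK P' 0 0 2 f_LPK"
    unfolding homogeneous_up_to_def gens_unfold
    by (simp only: object_simps, simp only: nat_literals inputs_unfold, intro conjI allI impI TrueI;
      simp add: f_LPK_def U2_B_case split: nat.split)
  show "closed_up_to A11 A11 LPK P' 5 f_LPK"
    unfolding closed_up_to_def gens_unfold
    by (simp only: object_simps, simp only: nat_literals inputs_unfold, intro conjI allI impI TrueI;
      simp only: morphism_unfold; simp add: ops_LPK_rules ops_P' ops_X f_LPK_def
        relation_simps split: nat.split)
qed simp_all

lemma closed_g_LPK: "closed_morphism A11 A11 P' LPK 0 0 g_LPK"
proof (rule closed_morphismI[OF A11_simps(5) A11_simps(5) max_inputs_g_LPK max_inputs_P' max_inputs_LPK])
  show "homogeneous_up_to A11 A11 P' LPK 0 0 2 g_LPK"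
    unfolding homogeneous_up_to_def gens_unfold
    by (simp only: object_simps, simp only: nat_literals inputs_unfold, intro conjI allI impI TrueI;
      simp add: g_LPK_def U2_B_case split: nat.split)
  show "closed_up_to A11 A11 P' LPK 5 g_LPK"
    unfolding closed_up_to_def gens_unfold
    by (simp only: object_simps, simp only: nat_literals inputs_unfold, intro conjI allI impI TrueI;
      simp only: morphism_unfold; simp add: ops_LPK_rules ops_P' ops_X g_LPK_def
        relation_simps split: nat.split)
qed simp_all

lemma homotopic_g_LPK_f_LPK: "homotopic A11 A11 LPK LPK (mor_comp A11 g_LPK f_LPK) (mor_id A11 LPK)"
proof (rule homotopicI[OF A11_simps(5) A11_simps(5) max_inputs_f_LPK max_inputs_g_LPK _ max_inputs_h_LPK max_inputs_LPK])
  show "homogeneous_up_to A11 A11 LPK LPK 0 (- 1) 0 h_LPK"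
    unfolding homogeneous_up_to_def gens_unfold
    by (simp only: object_simps, simp only: nat_literals inputs_unfold, intro conjI allI impI TrueI;
      simp add: h_LPK_def U2_B_case split: nat.split)
  show "homotopy_up_to A11 A11 LPK 4 g_LPK f_LPK h_LPK"
    unfolding homotopy_up_to_def gens_unfold
    by (simp only: object_simps, simp only: nat_literals inputs_unfold, intro conjI allI impI TrueI;
      simp only: morphism_unfold; simp add: ops_LPK_rules f_LPK_def g_LPK_def h_LPK_def
        relation_simps split: nat.split)
qed simp_all

lemma homotopic_f_LPK_g_LPK: "homotopic A11 A11 P' P' (mor_comp A11 f_LPK g_LPK) (mor_id A11 P')"
proof (rule homotopicI[OF A11_simps(5) A11_simps(5) max_inputs_g_LPK max_inputs_f_LPK _ max_inputs_k_LPK max_inputs_P'])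
  show "homogeneous_up_to A11 A11 P' P' 0 (- 1) 0 k_LPK"
    unfolding homogeneous_up_to_def gens_unfold
    by (simp only: object_simps, simp only: nat_literals inputs_unfold, intro conjI allI impI TrueI;
      simp add: k_LPK_def U2_B_case split: nat.split)
  show "homotopy_up_to A11 A11 P' 4 f_LPK g_LPK k_LPK"
    unfolding homotopy_up_to_def gens_unfold
    by (simp only: object_simps, simp only: nat_literals inputs_unfold, intro conjI allI impI TrueI;
      simp only: morphism_unfold; simp add: ops_P' ops_X f_LPK_def g_LPK_def k_LPK_def
        relation_simps split: nat.split)
qed simp_all

lemma homotopy_equivalent_LPK: "homotopy_equivalent A11 A11 LPK P'"
  unfolding homotopy_equivalent_def
  using DA_bimodule_LPK DA_bimodule_P' closed_f_LPK closed_g_LPK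
    homotopic_g_LPK_f_LPK homotopic_f_LPK_g_LPK by blast

subsection \<open>The equivalence of \<open>\<L> \<boxtimes> N\<^sub>O\<^sub>S\<^sub>z \<boxtimes> \<K>\<close> and \<open>N'\<close>\<close>

text \<open>
  Here \<open>\<lambda>\<^sub>3 W \<kappa>\<^sub>3 \<rightarrow> \<lambda>\<^sub>3 N\<^sub>B \<kappa>\<^sub>4\<close> and \<open>\<lambda>\<^sub>4 W \<kappa>\<^sub>3 \<rightarrow> \<lambda>\<^sub>4 N\<^sub>B \<kappa>\<^sub>4\<close> cancel on the left, and \<open>yb \<rightarrow> \<I>\<close>, \<open>zd \<rightarrow> \<I>\<close> on the
  right; the remaining bimodules are isomorphic by \<open>\<lambda>\<^sub>2 S\<^sub>A \<kappa>\<^sub>2 \<mapsto> \<I>\<close>, \<open>\<lambda>\<^sub>3 W \<kappa>\<^sub>2 \<mapsto> xa\<close>, \<open>\<lambda>\<^sub>2 S\<^sub>A \<kappa>\<^sub>3 \<mapsto> xb\<close>,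
  \<open>\<lambda>\<^sub>4 W \<kappa>\<^sub>2 \<mapsto> ya\<close>, \<open>\<lambda>\<^sub>5 N\<^bsub>AB\<^esub> \<kappa>\<^sub>5 \<mapsto> zc\<close> and the further term \<open>(\<lambda>\<^sub>2 S\<^sub>A \<kappa>\<^sub>2; U\<^sub>1\<^bsup>k+1\<^esup>) \<mapsto> U\<^sub>1\<^sup>k xa\<close>.
\<close>

definition f_LNK :: "(lgen \<times> osz_gen) \<times> kgen \<Rightarrow> alg list \<Rightarrow> (alg \<times> (xgen + ob)) vect" where
  "f_LNK m as = (case m of
      ((Lam1, S_none), Kap1) \<Rightarrow> (case as of [] \<Rightarrow> E_uu \<otimes> Inr Ob_uu | _ \<Rightarrow> 0)
    | ((Lam2, S_A), Kap2) \<Rightarrow> (case as of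
          [] \<Rightarrow> U_ou 0 \<otimes> Inr Ob_ou
        | [U_ou k] \<Rightarrow> pred_case k (\<lambda>j. U_ou j \<otimes> Inl Xa)
        | _ \<Rightarrow> 0)
    | ((Lam2, S_A), Kap3) \<Rightarrow> (case as of [] \<Rightarrow> U_ou 0 \<otimes> Inl Xb | _ \<Rightarrow> 0)
    | ((Lam3, W), Kap2) \<Rightarrow> (case as of [] \<Rightarrow> U_ou 0 \<otimes> Inl Xa | _ \<Rightarrow> 0)
    | ((Lam3, N_B), Kap4) \<Rightarrow> (case as of [] \<Rightarrow> U_ou 1 \<otimes> Inl Xb | [Lam] \<Rightarrow> U_ou 0 \<otimes> Inl Xa | _ \<Rightarrow> 0)
    | ((Lam4, W), Kap2) \<Rightarrow> (case as of [] \<Rightarrow> U_uo 0 \<otimes> Inl Ya | _ \<Rightarrow> 0)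
    | ((Lam4, N_B), Kap4) \<Rightarrow> (case as of [Lam] \<Rightarrow> U_uo 0 \<otimes> Inl Ya | _ \<Rightarrow> 0)
    | ((Lam5, N_AB), Kap5) \<Rightarrow> (case as of [] \<Rightarrow> polv U_oo (Inl Zc) 1 + polv U_oo (Inl Zd) X1 | _ \<Rightarrow> 0)
    | _ \<Rightarrow> 0)"

definition g_LNK :: "xgen + ob \<Rightarrow> alg list \<Rightarrow> (alg \<times> ((lgen \<times> osz_gen) \<times> kgen)) vect" where
  "g_LNK m as = (case m of
      Inr Ob_uu \<Rightarrow> (case as of [] \<Rightarrow> E_uu \<otimes> ((Lam1, S_none), Kap1) | _ \<Rightarrow> 0)
    | Inr Ob_ou \<Rightarrow> (case as of
          [] \<Rightarrow> U_ou 0 \<otimes> ((Lam2, S_A), Kap2)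
        | [U_ou k] \<Rightarrow> pred_case k (\<lambda>j. U_ou j \<otimes> ((Lam3, W), Kap2))
        | _ \<Rightarrow> 0)
    | Inr Ob_uo \<Rightarrow> (case as of
          [] \<Rightarrow> Lam \<otimes> ((Lam2, S_A), Kap3)
        | [U_uo k] \<Rightarrow> (if k = 1 then Lam \<otimes> ((Lam3, W), Kap3) else 0)
        | [U_uo k, Lam] \<Rightarrow> pred_case k (\<lambda>j. U_uo j \<otimes> ((Lam4, W), Kap2))
        | [Lam, U_ou k] \<Rightarrow> pred_case k (\<lambda>j. U_uo j \<otimes> ((Lam4, W), Kap2))
        | _ \<Rightarrow> 0)
    | Inr Ob_oo \<Rightarrow> (case as of [U_oo k l] \<Rightarrow> polv U_oo ((Lam5, N_AB), Kap5) (beta k l) | _ \<Rightarrow> 0)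
    | Inl Xa \<Rightarrow> (case as of [] \<Rightarrow> U_ou 0 \<otimes> ((Lam3, W), Kap2) | _ \<Rightarrow> 0)
    | Inl Ya \<Rightarrow> (case as of [] \<Rightarrow> U_uo 0 \<otimes> ((Lam4, W), Kap2) | _ \<Rightarrow> 0)
    | Inl Xb \<Rightarrow> (case as of
          [] \<Rightarrow> U_ou 0 \<otimes> ((Lam2, S_A), Kap3)
        | [U_uo k] \<Rightarrow> pred_case k (\<lambda>j. U_ou j \<otimes> ((Lam3, W), Kap3))
        | _ \<Rightarrow> 0)
    | Inl Yb \<Rightarrow> 0
    | Inl Zc \<Rightarrow> (case as of [] \<Rightarrow> polv U_oo ((Lam5, N_AB), Kap5) 1 | _ \<Rightarrow> 0)
    | Inl Zd \<Rightarrow> 0)"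

definition h_LNK :: "(lgen \<times> osz_gen) \<times> kgen \<Rightarrow> alg list \<Rightarrow> (alg \<times> ((lgen \<times> osz_gen) \<times> kgen)) vect" where
  "h_LNK m as = (case m of
      ((Lam3, N_B), Kap4) \<Rightarrow> (case as of [] \<Rightarrow> U_ou 0 \<otimes> ((Lam3, W), Kap3) | _ \<Rightarrow> 0)
    | ((Lam4, N_B), Kap4) \<Rightarrow> (case as of [] \<Rightarrow> U_uo 0 \<otimes> ((Lam4, W), Kap3) | _ \<Rightarrow> 0)
    | _ \<Rightarrow> 0)"

definition k_LNK :: "xgen + ob \<Rightarrow> alg list \<Rightarrow> (alg \<times> (xgen + ob)) vect" where
  "k_LNK m as = (case m of
      Inr Ob_uo \<Rightarrow> (case as of [] \<Rightarrow> U_uo 0 \<otimes> Inl Yb | _ \<Rightarrow> 0)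
    | Inr Ob_oo \<Rightarrow> (case as of [] \<Rightarrow> polv U_oo (Inl Zd) 1 | _ \<Rightarrow> 0)
    | _ \<Rightarrow> 0)"

lemma max_inputs_f_LNK: "max_inputs 1 f_LNK"
  unfolding max_inputs_def
  by (auto simp: f_LNK_def split: prod.split sum.split kgen.split osz_gen.split lgen.split alg.split list.split)

lemma max_inputs_g_LNK: "max_inputs 2 g_LNK"
  unfolding max_inputs_def
  by (auto simp: g_LNK_def split: prod.split sum.split ob.split xgen.split alg.split list.split)

lemma max_inputs_h_LNK: "max_inputs 0 h_LNK"
  unfolding max_inputs_def
  by (auto simp: h_LNK_def split: prod.split sum.split kgen.split osz_gen.split lgen.split alg.split list.split)

lemma max_inputs_k_LNK: "max_inputs 0 k_LNK"
  unfolding max_inputs_def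
  by (auto simp: k_LNK_def split: prod.split sum.split ob.split xgen.split alg.split list.split)

lemma closed_f_LNK: "closed_morphism A11 A11 LNK N' 0 0 f_LNK"
proof (rule closed_morphismI[OF A11_simps(5) A11_simps(5) max_inputs_f_LNK max_inputs_LNK max_inputs_N'])
  show "homogeneous_up_to A11 A11 LNK N' 0 0 1 f_LNK"
    unfolding homogeneous_up_to_def gens_unfold
    by (simp only: object_simps, simp only: nat_literals inputs_unfold, intro conjI allI impI TrueI;
      simp add: f_LNK_def U2_B_case split: nat.split)
  show "closed_up_to A11 A11 LNK N' 3 f_LNK"
    unfolding closed_up_to_def gens_unfold
    by (simp only: object_simps, simp only: nat_literals inputs_unfold, intro conjI allI impI TrueI;
      simp only: morphism_unfold; simp add: ops_LNK_rules ops_N' ops_X f_LNK_def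
        relation_simps beta_sum beta_sum_X2 split: nat.split)
qed simp_all

lemma closed_g_LNK: "closed_morphism A11 A11 N' LNK 0 0 g_LNK"
proof (rule closed_morphismI[OF A11_simps(5) A11_simps(5) max_inputs_g_LNK max_inputs_N' max_inputs_LNK])
  show "homogeneous_up_to A11 A11 N' LNK 0 0 2 g_LNK"
    unfolding homogeneous_up_to_def gens_unfold
    by (simp only: object_simps, simp only: nat_literals inputs_unfold, intro conjI allI impI TrueI;
      simp add: g_LNK_def U2_B_case split: nat.split)
  show "closed_up_to A11 A11 N' LNK 4 g_LNK"
    unfolding closed_up_to_def gens_unfold
    by (simp only: object_simps, simp only: nat_literals inputs_unfold, intro conjI allI impI TrueI;
      simp only: morphism_unfold; simp add: ops_LNK_rules ops_N' ops_X g_LNK_def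
        U2_B_case power_add beta_add' polv_add algebra_simps beta_sum beta_sum_X2 split: nat.split)
qed simp_all

lemma homotopic_g_LNK_f_LNK: "homotopic A11 A11 LNK LNK (mor_comp A11 g_LNK f_LNK) (mor_id A11 LNK)"
proof (rule homotopicI[OF A11_simps(5) A11_simps(5) max_inputs_f_LNK max_inputs_g_LNK _ max_inputs_h_LNK max_inputs_LNK])
  show "homogeneous_up_to A11 A11 LNK LNK 0 (- 1) 0 h_LNK"
    unfolding homogeneous_up_to_def gens_unfold
    by (simp only: object_simps, simp only: nat_literals inputs_unfold, intro conjI allI impI TrueI;
      simp add: h_LNK_def U2_B_case split: nat.split)
  show "homotopy_up_to A11 A11 LNK 3 g_LNK f_LNK h_LNK"
    unfolding homotopy_up_to_def gens_unfold
    by (simp only: object_simps, simp only: nat_literals inputs_unfold, intro conjI allI impI TrueI;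
      simp only: morphism_unfold; simp add: ops_LNK_rules f_LNK_def g_LNK_def h_LNK_def
        relation_simps beta_sum beta_sum_X2 split: nat.split)
qed simp_all

lemma homotopic_f_LNK_g_LNK: "homotopic A11 A11 N' N' (mor_comp A11 f_LNK g_LNK) (mor_id A11 N')"
proof (rule homotopicI[OF A11_simps(5) A11_simps(5) max_inputs_g_LNK max_inputs_f_LNK _ max_inputs_k_LNK max_inputs_N'])
  show "homogeneous_up_to A11 A11 N' N' 0 (- 1) 0 k_LNK"
    unfolding homogeneous_up_to_def gens_unfold
    by (simp only: object_simps, simp only: nat_literals inputs_unfold, intro conjI allI impI TrueI;
      simp add: k_LNK_def U2_B_case split: nat.split)
  show "homotopy_up_to A11 A11 N' 3 f_LNK g_LNK k_LNK"
    unfolding homotopy_up_to_def gens_unfold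
    by (simp only: object_simps, simp only: nat_literals inputs_unfold, intro conjI allI impI TrueI;
      simp only: morphism_unfold; simp add: ops_N' ops_X f_LNK_def g_LNK_def k_LNK_def
        relation_simps beta_sum beta_sum_X2 split: nat.split)
qed simp_all

lemma homotopy_equivalent_LNK: "homotopy_equivalent A11 A11 LNK N'"
  unfolding homotopy_equivalent_def
  using DA_bimodule_LNK DA_bimodule_N' closed_f_LNK closed_g_LNK
    homotopic_g_LNK_f_LNK homotopic_f_LNK_g_LNK by blast

theorem theorem1p14:
  shows "homotopy_equivalent Acan Acan (K_bimod \<boxtimes> P' \<boxtimes> L_bimod) P_OSz
       \<and> homotopy_equivalent Acan Acan (K_bimod \<boxtimes> N' \<boxtimes> L_bimod) N_OSz
       \<and> homotopy_equivalent A11 A11 (L_bimod \<boxtimes> P_OSz \<boxtimes> K_bimod) P'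
       \<and> homotopy_equivalent A11 A11 (L_bimod \<boxtimes> N_OSz \<boxtimes> K_bimod) N'"
  by (intro conjI homotopy_equivalent_KPL homotopy_equivalent_KNL
      homotopy_equivalent_LPK homotopy_equivalent_LNK)

end
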